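(* Let $m\ge 2$ be an integer and let $L$ be a finite, connected, simplicial, bipartite graph with vertex set $\{x_1,\dots,x_{q_1}\}\sqcup\{y_1,\dots,y_{q_2}\}$, where $q_1,q_2\ge 2$ and every edge joins some $x_i$ to some $y_j$. Let $H=\pi_1(X_{2m,L})$ and $W=W_{2m,L}$ be the groups defined in the context. Then $H$ is (isomorphic to) a subgroup of $W$ of index $2m$. Moreover, this subgroup is a maximal torsion-free subgroup of $W$ with minimal index; that is, it is torsion-free, it is not properly contained in any torsion-free subgroup of $W$, and every torsion-free finite-index subgroup of $W$ has index at least $2m$.
   Context: Write $E(L)$ for the edge set of $L$ and $(x_i,y_j)$ for its elements. The complex $X=X_{2m,L}$. For each edge $(x_i,y_j)\in E(L)$ take a $2m$-gon $P_{ij}$, orient its boundary edges cyclically, and label them in cyclic order by the word $x_i^1y_j^1x_i^2y_j^2\cdots x_i^my_j^m$ (the superscripts are indices, not powers, so the $2m$ labels are pairwise distinct). $X$ is the 2-dimensional cell complex obtained by gluing all the polygons $P_{ij}$ together along edges with the same label, respecting orientation. $H=\pi_1(X)$ is its topological fundamental group. The Coxeter group $W=W_{2m,L}$ has generators $x_1,\dots,x_{q_1},y_1,\dots,y_{q_2}$ and relations $x_i^2=y_j^2=1$ for $1\le i\le q_1$, $1\le j\le q_2$, and $(x_iy_j)^m=1$ for each $(x_i,y_j)\in E(L)$. *)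

theory Defs
  imports
    "HOL-Analysis.Analysis"
    "HOL-Algebra.Coset"
    "Graph_Theory.Digraph_Component"
begin

section \<open>Group presentations\<close>

text \<open>A letter \<open>(a, True)\<close> stands for the generator \<open>a\<close>, and \<open>(a, False)\<close> for its formal inverse.\<close>

type_synonym 'a gword = "('a \<times> bool) list"

definition gwords :: "'a set \<Rightarrow> 'a gword set" where
  "gwords S = lists (S \<times> UNIV)"

inductive_set pres_cong :: "'a set \<Rightarrow> 'a gword set \<Rightarrow> 'a gword rel"
  for S :: "'a set" and R :: "'a gword set" where
  pres_refl: "w \<in> gwords S \<Longrightarrow> (w, w) \<in> pres_cong S R"
| pres_sym: "(v, w) \<in> pres_cong S R \<Longrightarrow> (w, v) \<in> pres_cong S R"
| pres_trans: "(u, v) \<in> pres_cong S R \<Longrightarrow> (v, w) \<in> pres_cong S R \<Longrightarrow> (u, w) \<in> pres_cong S R"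
| pres_append: "(u, u') \<in> pres_cong S R \<Longrightarrow> (v, v') \<in> pres_cong S R
    \<Longrightarrow> (u @ v, u' @ v') \<in> pres_cong S R"
| pres_cancel: "a \<in> S \<Longrightarrow> ([(a, b), (a, \<not> b)], []) \<in> pres_cong S R"
| pres_relator: "r \<in> R \<Longrightarrow> r \<in> gwords S \<Longrightarrow> (r, []) \<in> pres_cong S R"

definition presented_group :: "'a set \<Rightarrow> 'a gword set \<Rightarrow> 'a gword set monoid" where
  "presented_group S R =
    \<lparr>carrier = gwords S // pres_cong S R,
     mult = (\<lambda>A B. \<Union>u\<in>A. \<Union>v\<in>B. pres_cong S R `` {u @ v}),
     one = pres_cong S R `` {[]}\<rparr>"

lemma pres_cong_subset: "pres_cong S R \<subseteq> gwords S \<times> gwords S"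
proof -
  have "v \<in> gwords S \<and> w \<in> gwords S" if "(v, w) \<in> pres_cong S R" for v w
    using that by induction (auto simp: gwords_def)
  then show ?thesis by auto
qed

lemma equiv_pres_cong: "equiv (gwords S) (pres_cong S R)"
proof (intro equivI pres_cong_subset)
  show "refl_on (gwords S) (pres_cong S R)" by (simp add: refl_on_def pres_refl)
  show "sym (pres_cong S R)" by (rule symI) (rule pres_sym)
  show "trans (pres_cong S R)" by (rule transI) (rule pres_trans)
qed

lemma presented_group_mult:
  assumes "u \<in> gwords S" "v \<in> gwords S"
  shows "(pres_cong S R `` {u}) \<otimes>\<^bsub>presented_group S R\<^esub> (pres_cong S R `` {v})
    = pres_cong S R `` {u @ v}"
proof -
  let ?C = "\<lambda>w. pres_cong S R `` {w}"
  have eq: "?C (u' @ v') = ?C (u @ v)" if "u' \<in> ?C u" "v' \<in> ?C v" for u' v'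
    using equiv_class_eq[OF equiv_pres_cong pres_append, of u u' S R v v'] that by simp
  have ne: "u \<in> ?C u" "v \<in> ?C v" using assms by (simp_all add: pres_refl)
  have "(\<Union>u'\<in>?C u. \<Union>v'\<in>?C v. ?C (u' @ v')) = (\<Union>u'\<in>?C u. \<Union>v'\<in>?C v. ?C (u @ v))"
    by (intro SUP_cong refl eq)
  also have "\<dots> = ?C (u @ v)" using ne by blast
  finally show ?thesis by (simp add: presented_group_def)
qed

lemma pres_cong_inverse:
  "w \<in> gwords S \<Longrightarrow> (rev (map (\<lambda>(a, b). (a, \<not> b)) w) @ w, []) \<in> pres_cong S R"
proof (induction w)
  case Nil
  have "([], []) \<in> pres_cong S R" by (rule pres_refl) (simp add: gwords_def)
  then show ?case by simp
next
  case (Cons x w)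
  obtain a b where x: "x = (a, b)" by force
  let ?i = "rev (map (\<lambda>(a, b). (a, \<not> b)) w)"
  have w: "a \<in> S" "w \<in> gwords S" using Cons.prems by (auto simp: x gwords_def)
  then have i: "?i \<in> gwords S" by (auto simp: gwords_def in_lists_conv_set)
  have "([(a, \<not> b), (a, b)], []) \<in> pres_cong S R"
    using pres_cancel[OF w(1), of "\<not> b"] by simp
  then have "([(a, \<not> b), (a, b)] @ w, [] @ w) \<in> pres_cong S R"
    by (rule pres_append) (rule pres_refl[OF w(2)])
  then have "(?i @ ([(a, \<not> b), (a, b)] @ w), ?i @ ([] @ w)) \<in> pres_cong S R"
    by (rule pres_append[OF pres_refl[OF i]])
  then have "(?i @ ([(a, \<not> b), (a, b)] @ w), []) \<in> pres_cong S R"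
    using pres_trans Cons.IH[OF w(2)] by simp
  then show ?case by (simp add: x)
qed

lemma group_presented_group: "group (presented_group S R)"
proof (rule groupI)
  let ?G = "presented_group S R"
  have car: "carrier ?G = {pres_cong S R `` {w} | w. w \<in> gwords S}"
    by (auto simp: presented_group_def quotient_def)
  have one: "\<one>\<^bsub>?G\<^esub> = pres_cong S R `` {[]}" by (simp add: presented_group_def)
  have nil: "[] \<in> gwords S" and app: "\<And>u v. u \<in> gwords S \<Longrightarrow> v \<in> gwords S \<Longrightarrow> u @ v \<in> gwords S"
    by (auto simp: gwords_def)
  show "\<one>\<^bsub>?G\<^esub> \<in> carrier ?G" using nil by (auto simp: car one)
  fix x assume "x \<in> carrier ?G"
  then obtain u where u: "u \<in> gwords S" "x = pres_cong S R `` {u}" by (auto simp: car)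
  show "\<one>\<^bsub>?G\<^esub> \<otimes>\<^bsub>?G\<^esub> x = x" by (simp add: one u nil presented_group_mult)
  let ?i = "rev (map (\<lambda>(a, b). (a, \<not> b)) u)"
  have i: "?i \<in> gwords S" using u(1) by (auto simp: gwords_def in_lists_conv_set)
  have "(pres_cong S R `` {?i}) \<otimes>\<^bsub>?G\<^esub> x = \<one>\<^bsub>?G\<^esub>"
    using equiv_class_eq[OF equiv_pres_cong pres_cong_inverse[OF u(1)]]
    by (simp add: one u i presented_group_mult)
  then show "\<exists>y\<in>carrier ?G. y \<otimes>\<^bsub>?G\<^esub> x = \<one>\<^bsub>?G\<^esub>" using i by (auto simp: car)
  fix y assume "y \<in> carrier ?G"
  then obtain v where v: "v \<in> gwords S" "y = pres_cong S R `` {v}" by (auto simp: car)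
  show "x \<otimes>\<^bsub>?G\<^esub> y \<in> carrier ?G" using u v app by (auto simp: car presented_group_mult)
  fix z assume "z \<in> carrier ?G"
  then obtain w where w: "w \<in> gwords S" "z = pres_cong S R `` {w}" by (auto simp: car)
  show "x \<otimes>\<^bsub>?G\<^esub> y \<otimes>\<^bsub>?G\<^esub> z = x \<otimes>\<^bsub>?G\<^esub> (y \<otimes>\<^bsub>?G\<^esub> z)"
    by (simp add: u v w app presented_group_mult)
qed

definition torsion_free :: "('a, 'b) monoid_scheme \<Rightarrow> bool" where
  "torsion_free G \<longleftrightarrow>
    (\<forall>x\<in>carrier G. \<forall>n::nat. n > 0 \<longrightarrow> x [^]\<^bsub>G\<^esub> n = \<one>\<^bsub>G\<^esub> \<longrightarrow> x = \<one>\<^bsub>G\<^esub>)"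


section \<open>Quotient spaces\<close>

definition quotient_topology :: "'a topology \<Rightarrow> 'a rel \<Rightarrow> 'a set topology" where
  "quotient_topology T r = topology (\<lambda>U. U \<subseteq> topspace T // r \<and> openin T (\<Union>U))"

lemma openin_quotient_topology:
  assumes "equiv (topspace T) r"
  shows "openin (quotient_topology T r) U \<longleftrightarrow> U \<subseteq> topspace T // r \<and> openin T (\<Union>U)"
proof -
  have "istopology (\<lambda>U. U \<subseteq> topspace T // r \<and> openin T (\<Union>U))"
    unfolding istopology_def
  proof (intro conjI allI impI)
    fix U V
    assume U: "U \<subseteq> topspace T // r \<and> openin T (\<Union>U)"
      and V: "V \<subseteq> topspace T // r \<and> openin T (\<Union>V)"
    have "\<Union>(U \<inter> V) = \<Union>U \<inter> \<Union>V"
    proof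
      show "\<Union>U \<inter> \<Union>V \<subseteq> \<Union>(U \<inter> V)"
      proof
        fix x assume "x \<in> \<Union>U \<inter> \<Union>V"
        then obtain A B where AB: "A \<in> U" "B \<in> V" "x \<in> A" "x \<in> B" by blast
        then have "A = B" using quotient_disj[OF assms, of A B] U V by blast
        with AB show "x \<in> \<Union>(U \<inter> V)" by blast
      qed
    qed blast
    with U V show "openin T (\<Union>(U \<inter> V))" "U \<inter> V \<subseteq> topspace T // r" by auto
  next
    fix K
    assume K: "\<forall>U\<in>K. U \<subseteq> topspace T // r \<and> openin T (\<Union>U)"
    have "\<Union>(\<Union>K) = \<Union>(Union ` K)" by blast
    with K show "openin T (\<Union>(\<Union>K))" by auto
    from K show "\<Union>K \<subseteq> topspace T // r" by blast
  qed
  then show ?thesis by (simp add: quotient_topology_def)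
qed

lemma topspace_quotient_topology:
  assumes "equiv (topspace T) r"
  shows "topspace (quotient_topology T r) = topspace T // r"
proof
  show "topspace (quotient_topology T r) \<subseteq> topspace T // r"
    using openin_quotient_topology[OF assms] by (metis openin_topspace)
  have "openin (quotient_topology T r) (topspace T // r)"
    by (simp add: openin_quotient_topology[OF assms] Union_quotient[OF assms])
  then show "topspace T // r \<subseteq> topspace (quotient_topology T r)" by (rule openin_subset)
qed

lemma quotient_map_quotient_topology:
  assumes "equiv (topspace T) r"
  shows "quotient_map T (quotient_topology T r) (\<lambda>x. r `` {x})"
  unfolding quotient_map_def topspace_quotient_topology[OF assms]
proof (intro conjI allI impI)
  show "(\<lambda>x. r `` {x}) ` topspace T = topspace T // r" by (auto simp: quotient_def)
  fix U assume U: "U \<subseteq> topspace T // r"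
  have "{x \<in> topspace T. r `` {x} \<in> U} = \<Union>U"
  proof (intro equalityI subsetI)
    fix x assume "x \<in> {x \<in> topspace T. r `` {x} \<in> U}"
    then show "x \<in> \<Union>U" using equiv_class_self[OF assms] by blast
  next
    fix x assume "x \<in> \<Union>U"
    then obtain A where A: "A \<in> U" "x \<in> A" by blast
    then obtain a where a: "A = r `` {a}" "a \<in> topspace T" using U by (auto elim: quotientE)
    then have "A = r `` {x}" using A equiv_class_eq[OF assms] by auto
    moreover have "x \<in> topspace T" using A U Union_quotient[OF assms] by blast
    ultimately show "x \<in> {x \<in> topspace T. r `` {x} \<in> U}" using A by simp
  qed
  then show "openin T {x \<in> topspace T. r `` {x} \<in> U} \<longleftrightarrow> openin (quotient_topology T r) U"
    using U by (simp add: openin_quotient_topology[OF assms])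
qed


section \<open>The fundamental group of an abstract topological space\<close>

text \<open>Only the values of a path on \<open>{0..1}\<close> matter: \<^const>\<open>pathin\<close> and the homotopy relation below
  ignore the values elsewhere.\<close>

definition loops_at :: "'a topology \<Rightarrow> 'a \<Rightarrow> (real \<Rightarrow> 'a) set" where
  "loops_at X x0 = {p. pathin X p \<and> p 0 = x0 \<and> p 1 = x0}"

definition loop_homotopy :: "'a topology \<Rightarrow> 'a \<Rightarrow> (real \<Rightarrow> 'a) rel" where
  "loop_homotopy X x0 = {(p, q). p \<in> loops_at X x0 \<and> q \<in> loops_at X x0 \<and>
     homotopic_with (\<lambda>r. r 0 = x0 \<and> r 1 = x0) (top_of_set {0..1}) X p q}"

text \<open>The library's \<^const>\<open>joinpaths\<close> is restricted to spaces of class \<^class>\<open>topological_space\<close>.\<close>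

definition join_loops :: "(real \<Rightarrow> 'a) \<Rightarrow> (real \<Rightarrow> 'a) \<Rightarrow> real \<Rightarrow> 'a" where
  "join_loops p q = (\<lambda>t. if t \<le> 1 / 2 then p (2 * t) else q (2 * t - 1))"

definition fundamental_group :: "'a topology \<Rightarrow> 'a \<Rightarrow> (real \<Rightarrow> 'a) set monoid" where
  "fundamental_group X x0 =
    \<lparr>carrier = loops_at X x0 // loop_homotopy X x0,
     mult = (\<lambda>A B. \<Union>p\<in>A. \<Union>q\<in>B. loop_homotopy X x0 `` {join_loops p q}),
     one = loop_homotopy X x0 `` {\<lambda>_. x0}\<rparr>"


section \<open>The graph, the polygonal complex and the Coxeter group\<close>

datatype vertex = Xv nat | Yv nat

text \<open>\<open>(i, j)\<close> represents the edge joining \<open>x\<^sub>i\<close> and \<open>y\<^sub>j\<close>.\<close>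

definition bip_edges :: "vertex pair_pre_digraph \<Rightarrow> (nat \<times> nat) set" where
  "bip_edges L = {(i, j). (Xv i, Yv j) \<in> parcs L}"

definition polygon_corner :: "nat \<Rightarrow> nat \<Rightarrow> complex" where
  "polygon_corner n k = cis (2 * pi * real k / real n)"

definition polygon :: "nat \<Rightarrow> complex set" where
  "polygon n = convex hull (polygon_corner n ` {..<n})"

text \<open>The \<open>k\<close>-th boundary edge for \<open>k < n\<close>; it is oriented counterclockwise.\<close>

definition polygon_edge :: "nat \<Rightarrow> nat \<Rightarrow> real \<Rightarrow> complex" where
  "polygon_edge n k = linepath (polygon_corner n k) (polygon_corner n (Suc k))"

text \<open>The label of the \<open>k\<close>-th boundary edge of \<open>P\<^sub>i\<^sub>j\<close>, where \<open>(x\<^sub>i, s)\<close> encodes \<open>x\<^sub>i\<close> with superscript \<open>s\<close>: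
  for \<open>k = 0, 1, 2, \<dots>\<close> the labels are \<open>(x\<^sub>i, 1), (y\<^sub>j, 1), (x\<^sub>i, 2), (y\<^sub>j, 2), \<dots>\<close>.\<close>

fun edge_label :: "nat \<times> nat \<Rightarrow> nat \<Rightarrow> vertex \<times> nat" where
  "edge_label (i, j) k = (if even k then Xv i else Yv j, k div 2 + 1)"

definition polygon_union :: "nat \<Rightarrow> vertex pair_pre_digraph \<Rightarrow> ((nat \<times> nat) \<times> complex) topology" where
  "polygon_union m L = sum_topology (\<lambda>_. top_of_set (polygon (2 * m))) (bip_edges L)"

definition glue :: "nat \<Rightarrow> vertex pair_pre_digraph \<Rightarrow> ((nat \<times> nat) \<times> complex) rel" where
  "glue m L = {((e, polygon_edge (2 * m) k t), (e', polygon_edge (2 * m) k' t)) | e e' k k' t.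
     e \<in> bip_edges L \<and> e' \<in> bip_edges L \<and> k < 2 * m \<and> k' < 2 * m \<and> t \<in> {0..1} \<and>
     edge_label e k = edge_label e' k'}"

text \<open>Since \<^term>\<open>glue m L\<close> is symmetric, this is the equivalence relation generated by it.\<close>

definition glue_equiv :: "nat \<Rightarrow> vertex pair_pre_digraph \<Rightarrow> ((nat \<times> nat) \<times> complex) rel" where
  "glue_equiv m L = Restr ((glue m L)\<^sup>*) (topspace (polygon_union m L))"

definition polygon_complex ::
  "nat \<Rightarrow> vertex pair_pre_digraph \<Rightarrow> ((nat \<times> nat) \<times> complex) set topology" where
  "polygon_complex m L = quotient_topology (polygon_union m L) (glue_equiv m L)"

lemma equiv_glue_equiv: "equiv (topspace (polygon_union m L)) (glue_equiv m L)"
proof -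
  have "sym (glue m L)"
  proof (rule symI)
    fix a b assume "(a, b) \<in> glue m L"
    then obtain e e' k k' t where
      "a = (e, polygon_edge (2 * m) k t)" "b = (e', polygon_edge (2 * m) k' t)"
      "e \<in> bip_edges L" "e' \<in> bip_edges L" "k < 2 * m" "k' < 2 * m" "t \<in> {0..1}"
      "edge_label e k = edge_label e' k'"
      unfolding glue_def by blast
    then show "(b, a) \<in> glue m L"
      unfolding glue_def mem_Collect_eq
      by (intro exI[of _ e'] exI[of _ e] exI[of _ k'] exI[of _ k] exI[of _ t]) simp
  qed
  then have "sym ((glue m L)\<^sup>*)" by (rule sym_rtrancl)
  then show ?thesis
    by (intro equivI) (auto simp: glue_equiv_def refl_on_def sym_def trans_def)
qed

definition coxeter_relators :: "nat \<Rightarrow> vertex pair_pre_digraph \<Rightarrow> vertex gword set" where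
  "coxeter_relators m L =
    {[(v, True), (v, True)] | v. v \<in> pverts L} \<union>
    {concat (replicate m [(Xv i, True), (Yv j, True)]) | i j. (i, j) \<in> bip_edges L}"

definition coxeter_group :: "nat \<Rightarrow> vertex pair_pre_digraph \<Rightarrow> vertex gword set monoid" where
  "coxeter_group m L = presented_group (pverts L) (coxeter_relators m L)"

end

theory Submission
  imports Defs "HOL-Number_Theory.Cong"
begin

text \<open>
  Sending every \<open>x\<^sub>i\<close> and every \<open>y\<^sub>j\<close> to the two standard generators of the dihedral group of order
  \<open>2m\<close> defines a homomorphism on \<open>W\<close>; the subgroup in question is its kernel \<open>K\<close>. Each
  \<open>\<langle>x\<^sub>i, y\<^sub>j\<rangle>\<close> with \<open>(i, j)\<close> an edge maps isomorphically to the dihedral group, which gives the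
  index of \<open>K\<close>, its maximality and the lower bound on the index of a torsion-free subgroup.

  For torsion-freeness take \<open>g \<noteq> 1\<close> of finite order in \<open>K\<close> of minimal length. Two reflections with the
  same dihedral image never lie in a common conjugate of a \<open>\<langle>x\<^sub>i, y\<^sub>j\<rangle>\<close> unless they are equal, so the
  wall of a left descent \<open>s\<close> of \<open>g\<close> and its translate by \<open>g\<close> do not cross; nested half-spaces would make
  the order of \<open>g\<close> infinite, hence \<open>g\<close> commutes with \<open>s\<close>. Then all cyclic rotations of a reduced word
  are reduced words of \<open>g\<close>, any two letters of \<open>g\<close> have crossing walls, and \<open>g\<close> lies in a conjugate
  of a \<open>\<langle>x\<^sub>i, y\<^sub>j\<rangle>\<close>, on which the map to the dihedral group is injective.

  The complex has \<open>2m\<close> vertices, and its edge paths from a given vertex are the words in the generators of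
  \<open>W\<close>, closed exactly when the word lies in \<open>K\<close>. The open stars of the vertices are contractible and cover the
  complex, so every loop is homotopic to an edge path, and relators bound polygons. Conversely, the
  change-of-vertex elements on overlapping stars define a flat \<open>W\<close>-bundle whose holonomy along an edge path is
  the element of \<open>W\<close> spelled by it, so homotopic edge paths spell the same element.
\<close>

section \<open>The regular polygon and an embedding of the complex\<close>

text \<open>All that is known of \<open>W\<close> is its presentation, so each invariant is defined
  on words and checked on relators: \<open>shift\<close> modulo \<open>2m\<close>, the parity of the
  crossings of a wall, the parity of the order in which two walls are crossed. Neither a normal form
  nor a linear representation of \<open>W\<close> enters. The obstacle in the torsion-free part is
  that the order parity is guaranteed to survive a relator \<open>(x y)^m\<close> only if not both
  walls pass through its 2-cell; the kernel supplies this, because it meets every conjugate of a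
  dihedral subgroup trivially (\<open>apart_iff_K\<close>). On the topological side, a polygon
  containing a given point cannot be chosen continuously. Therefore the complex is realised as a
  subset \<open>S\<close> of \<open>complex \<times> real \<times> real\<close>, whose last two
  coordinates are the indices of the polygon multiplied by weights that vanish where the index has
  to be forgotten. Continuity then concerns explicit functions of these coordinates. Corners are
  indexed by all integers, so that following a letter adds \<open>1\<close> or \<open>-1\<close>,
  and the identification modulo \<open>period\<close> is postponed.\<close>

lemma cos_less_cos:
  assumes "0 \<le> a" "a < x" "x < 2 * pi - a" shows "cos x < cos a"
proof (cases "x \<le> pi")
  case True
  then show ?thesis using assms by (intro cos_monotone_0_pi) auto
next
  case False
  have "cos x = cos (2 * pi - x)" by (simp add: cos_diff)
  also have "\<dots> < cos a" using assms False by (intro cos_monotone_0_pi) auto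
  finally show ?thesis .
qed

locale even_polygon =
  fixes m :: nat
  assumes m_ge_2: "2 \<le> m"
begin

abbreviation period :: int where "period \<equiv> 2 * int m"

definition corner :: "int \<Rightarrow> complex" where
  "corner k = cis (2 * pi * real_of_int k / real (2 * m))"

abbreviation P :: "complex set" where "P \<equiv> polygon (2 * m)"

text \<open>The distance of \<open>z\<close> from the line through the \<open>k\<close>-th side.\<close>

definition side_dist :: "int \<Rightarrow> complex \<Rightarrow> real" where
  "side_dist k z = cos (pi / real (2 * m)) - Re (z * cis (- (2 * real_of_int k + 1) * pi / real (2 * m)))"

lemma period_pos: "0 < period"
  using m_ge_2 by simp

lemma angle_shift: "2 * pi * real_of_int (k + period * c) / real (2 * m) = 2 * pi * real_of_int k / real (2 * m) + 2 * pi * real_of_int c"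
  using m_ge_2 by (simp add: field_simps)

lemma cis_add_2pi: "cis (x + 2 * pi * real_of_int c) = cis x"
  by (simp add: cis_multiple_2pi flip: cis_mult)

lemma corner_periodic: "corner (k + period * c) = corner k"
  unfolding corner_def angle_shift by (rule cis_add_2pi)

lemma corner_cong: "[k = l] (mod period) \<Longrightarrow> corner k = corner l"
  by (metis cong_iff_lin corner_periodic)

lemma side_dist_periodic: "side_dist (k + period * c) z = side_dist k z"
proof -
  have "- (2 * real_of_int (k + period * c) + 1) * pi / real (2 * m) =
    - (2 * real_of_int k + 1) * pi / real (2 * m) + 2 * pi * real_of_int (- c)"
    using m_ge_2 by (simp add: field_simps)
  then show ?thesis unfolding side_dist_def by (simp only: cis_add_2pi)
qed

lemma side_dist_cong: "[k = l] (mod period) \<Longrightarrow> side_dist k z = side_dist l z"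
  by (metis cong_iff_lin side_dist_periodic)

lemma polygon_corner_eq: "polygon_corner (2 * m) k = corner (int k)"
  by (simp add: polygon_corner_def corner_def)

lemma corner_in_corners: "corner k \<in> polygon_corner (2 * m) ` {..<2 * m}"
proof (rule image_eqI)
  show "corner k = polygon_corner (2 * m) (nat (k mod period))"
    using m_ge_2 by (simp add: polygon_corner_eq) (rule corner_cong, simp add: cong_def)
  show "nat (k mod period) \<in> {..<2 * m}" using m_ge_2 by (simp add: nat_less_iff)
qed

lemma corner_in_P: "corner k \<in> P"
  unfolding polygon_def by (rule hull_inc[OF corner_in_corners])

lemma convex_P: "convex P"
  by (simp add: polygon_def)

lemma compact_P: "compact P"
  by (simp add: polygon_def finite_imp_compact_convex_hull)

lemma side_dist_combination:
  assumes "sum u A = 1"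
  shows "side_dist k (\<Sum>x\<in>A. u x *\<^sub>R x) = (\<Sum>x\<in>A. u x * side_dist k x)"
proof -
  have 1: "Re ((\<Sum>x\<in>A. u x *\<^sub>R x) * c) = (\<Sum>x\<in>A. u x * Re (x * c))" for c
    by (simp only: sum_distrib_right Re_sum mult_scaleR_left scaleR_complex.sel)
  have 2: "(\<Sum>x\<in>A. u x * (C - f x)) = C * sum u A - (\<Sum>x\<in>A. u x * f x)" for C and f :: "complex \<Rightarrow> real"
    by (simp only: right_diff_distrib sum_subtractf sum_distrib_left mult.commute)
  show ?thesis unfolding side_dist_def 1 2 assms by simp
qed

lemma side_dist_linepath:
  "side_dist k ((1 - t) *\<^sub>R x + t *\<^sub>R y) = (1 - t) * side_dist k x + t * side_dist k y"
  by (simp add: side_dist_def algebra_simps)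

lemma continuous_side_dist [continuous_intros]:
  "continuous_on A f \<Longrightarrow> continuous_on A (\<lambda>x. side_dist k (f x))"
  unfolding side_dist_def by (intro continuous_intros)

lemma side_dist_corner:
  "side_dist k (corner l) = cos (pi / real (2 * m)) - cos ((2 * real_of_int (l - k) - 1) * pi / real (2 * m))"
proof -
  have "2 * pi * real_of_int l / real (2 * m) + - (2 * real_of_int k + 1) * pi / real (2 * m) =
    (2 * real_of_int (l - k) - 1) * pi / real (2 * m)"
    by (simp add: divide_simps) (simp add: algebra_simps)
  then show ?thesis unfolding side_dist_def corner_def cis_mult by simp
qed

lemma side_dist_corner_pos:
  assumes "\<not> [k = l] (mod period)" "\<not> [k = l - 1] (mod period)"
  shows "0 < side_dist k (corner l)"
proof -
  define r where "r = (l - k) mod period"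
  have "[l - k = r] (mod period)" by (simp add: r_def cong_def)
  then have "corner l = corner (r + k)" by (intro corner_cong) (simp add: cong_diff_iff_cong_0 cong_iff_dvd_diff algebra_simps)
  moreover have "0 \<le> r" "r < period" using period_pos by (simp_all add: r_def)
  moreover have "r \<noteq> 0" using assms(1) by (auto simp: r_def cong_iff_dvd_diff dvd_diff_commute mod_eq_0_iff_dvd)
  moreover have "r \<noteq> 1"
  proof
    assume "r = 1"
    then have "(l - k) mod period = 1 mod period" using period_pos by (simp add: r_def)
    then have "period dvd (l - k) - 1" by (simp add: mod_eq_dvd_iff)
    moreover have "k - (l - 1) = - (l - k - 1)" by simp
    ultimately have "period dvd k - (l - 1)" by (simp only: dvd_minus_iff)
    then show False using assms(2) by (simp add: cong_iff_dvd_diff)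
  qed
  ultimately have r: "corner l = corner (r + k)" "2 \<le> r" "r \<le> period - 1" by auto
  \<comment> \<open>Measured from the normal of side \<open>k\<close>, the corners \<open>k\<close>
    and \<open>k + 1\<close> lie at the angles \<open>-pi/(2m)\<close> and \<open>pi/(2m)\<close>;
    all other corners are strictly farther away on the circle.\<close>
  have "cos ((2 * real_of_int r - 1) * pi / real (2 * m)) < cos (pi / real (2 * m))"
  proof (rule cos_less_cos)
    show "pi / real (2 * m) < (2 * real_of_int r - 1) * pi / real (2 * m)"
      using m_ge_2 r(2) by (simp add: divide_simps)
    have "(2 * real_of_int r - 1) * pi < (4 * real m - 1) * pi" using r(3) by simp
    then show "(2 * real_of_int r - 1) * pi / real (2 * m) < 2 * pi - pi / real (2 * m)"
      using m_ge_2 by (simp add: divide_simps) (simp add: algebra_simps)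
  qed simp
  then show ?thesis unfolding r(1) side_dist_corner by simp
qed

lemma side_dist_corner_0: "side_dist k (corner k) = 0" "side_dist k (corner (k + 1)) = 0"
  by (simp_all add: side_dist_corner)

lemma side_dist_corner_eq_0_iff:
  "side_dist k (corner l) = 0 \<longleftrightarrow> [k = l] (mod period) \<or> [k = l - 1] (mod period)"
proof
  show "[k = l] (mod period) \<or> [k = l - 1] (mod period) \<Longrightarrow> side_dist k (corner l) = 0"
    using side_dist_cong[of k l] side_dist_cong[of k "l - 1"] side_dist_corner_0(1)[of l] side_dist_corner_0(2)[of "l - 1"]
    by auto
qed (use side_dist_corner_pos[of k l] in force)

lemma side_dist_corner_nonneg: "0 \<le> side_dist k (corner l)"
  using side_dist_corner_eq_0_iff side_dist_corner_pos by (metis less_le order_refl)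

lemma P_combination:
  assumes "z \<in> P"
  shows "\<exists>A u. A \<subseteq> range corner \<and> finite A \<and> (\<forall>x\<in>A. 0 \<le> u x) \<and> sum u A = 1 \<and>
    z = (\<Sum>x\<in>A. u x *\<^sub>R x)"
proof -
  let ?A = "polygon_corner (2 * m) ` {..<2 * m}"
  have "?A \<subseteq> range corner" by (auto simp: polygon_corner_eq)
  moreover have "finite ?A" by simp
  ultimately show ?thesis using assms unfolding polygon_def convex_hull_finite[OF \<open>finite ?A\<close>] by blast
qed

lemma side_dist_nonneg: assumes "z \<in> P" shows "0 \<le> side_dist k z"
proof -
  obtain A u where *: "A \<subseteq> range corner" "finite A" "\<forall>x\<in>A. 0 \<le> u x" "sum u A = 1"
    "z = (\<Sum>x\<in>A. u x *\<^sub>R x)" using P_combination[OF assms] by blast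
  show ?thesis unfolding *(5) side_dist_combination[OF *(4)]
    by (rule sum_nonneg) (use * side_dist_corner_nonneg in fastforce)
qed

text \<open>As \<open>side_dist k\<close> is affine, nonnegative at the corners and positive off the
  side, a convex combination of corners on which it vanishes has no weight on corners off the
  side.\<close>

lemma side_dist_0_segment:
  assumes "z \<in> P" "side_dist k z = 0" shows "z \<in> closed_segment (corner k) (corner (k + 1))"
proof -
  obtain A u where *: "A \<subseteq> range corner" "finite A" "\<forall>x\<in>A. 0 \<le> u x" "sum u A = 1"
    "z = (\<Sum>x\<in>A. u x *\<^sub>R x)" using P_combination[OF assms(1)] by blast
  let ?B = "{corner k, corner (k + 1)}"
  have "(\<Sum>x\<in>A. u x * side_dist k x) = 0" using assms(2) unfolding *(5) side_dist_combination[OF *(4)] .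
  then have 0: "\<forall>x\<in>A. u x * side_dist k x = 0"
    by (subst (asm) sum_nonneg_eq_0_iff) (use * side_dist_corner_nonneg in fastforce)+
  have zero: "u x = 0" if x: "x \<in> A" "x \<notin> ?B" for x
  proof -
    obtain l where l: "x = corner l" using subsetD[OF *(1) x(1)] by blast
    have "\<not> [k = l] (mod period)" using x(2) l corner_cong[of k l] by auto
    moreover have "\<not> [k = l - 1] (mod period)"
    proof
      assume "[k = l - 1] (mod period)"
      then have "[k + 1 = l - 1 + 1] (mod period)" by (intro cong_add) auto
      then show False using x(2) l corner_cong[of "k + 1" l] by simp
    qed
    ultimately have "side_dist k x > 0" unfolding l by (rule side_dist_corner_pos)
    then show ?thesis using 0 x by auto
  qed
  have "sum u (A \<inter> ?B) = 1" "(\<Sum>x\<in>A \<inter> ?B. u x *\<^sub>R x) = z"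
    using *(2,4,5) zero by (subst sum.mono_neutral_left[of A]; force)+
  then have "z \<in> convex hull (A \<inter> ?B)" using *(3) unfolding convex_hull_finite[OF finite_Int[OF disjI2[OF finite.insertI[OF finite.insertI[OF finite.emptyI]]]]] by blast
  then have "z \<in> convex hull ?B" using hull_mono[of "A \<inter> ?B" ?B convex] by blast
  then show ?thesis by (simp add: segment_convex_hull)
qed

text \<open>The open star of corner \<open>k\<close> within one polygon, phrased by the sides that
  must be avoided; this makes openness a matter of finitely many inequations. Interior points lie in
  the star of every corner.\<close>

definition in_star :: "int \<Rightarrow> complex \<Rightarrow> bool" where
  "in_star k z \<longleftrightarrow> (\<forall>l. side_dist l z = 0 \<longrightarrow> [l = k] (mod period) \<or> [l = k - 1] (mod period))"

lemma in_star_corner: "in_star k (corner k)"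
  by (simp add: in_star_def side_dist_corner_eq_0_iff)

lemma in_star_cong: assumes "[k = l] (mod period)" shows "in_star k z \<longleftrightarrow> in_star l z"
proof -
  have "[k - 1 = l - 1] (mod period)" using assms by (intro cong_diff) auto
  with assms show ?thesis unfolding in_star_def by (metis cong_sym cong_trans)
qed

text \<open>A sum of two nonnegative terms vanishes only if both do; for \<open>t > 0\<close> the
  term of corner \<open>k\<close> then leaves only the two sides at that corner.\<close>

lemma in_star_side:
  assumes "z \<in> P" "in_star k z" "t \<in> {0..1}"
  shows "in_star k ((1 - t) *\<^sub>R z + t *\<^sub>R corner k)"
proof (cases "t = 0")
  case False
  show ?thesis unfolding in_star_def side_dist_linepath
  proof (intro allI impI)
    fix l assume "(1 - t) * side_dist l z + t * side_dist l (corner k) = 0"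
    moreover have "0 \<le> (1 - t) * side_dist l z" using assms side_dist_nonneg by simp
    moreover have "0 \<le> t * side_dist l (corner k)" using assms side_dist_corner_nonneg by simp
    ultimately have "t * side_dist l (corner k) = 0" by linarith
    then show "[l = k] (mod period) \<or> [l = k - 1] (mod period)"
      using False by (simp add: side_dist_corner_eq_0_iff)
  qed
qed (use assms in simp)

lemma ex_in_star: assumes "z \<in> P" shows "\<exists>k. in_star k z"
proof (cases "\<exists>l. side_dist l z = 0")
  case True
  then obtain l where l: "side_dist l z = 0" by blast
  obtain t where t: "0 \<le> t" "t \<le> 1" "z = (1 - t) *\<^sub>R corner l + t *\<^sub>R corner (l + 1)"
    using side_dist_0_segment[OF assms l] by (auto simp: in_segment)
  show ?thesis
  \<comment> \<open>A point of side \<open>l\<close> other than its far corner belongs to the star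
    of \<open>l\<close>; the far corner belongs to its own star.\<close>
  proof (cases "t = 1")
    case True
    then show ?thesis using in_star_corner[of "l + 1"] t by auto
  next
    case False
    have "in_star l z" unfolding in_star_def
    proof (intro allI impI)
      fix k assume "side_dist k z = 0"
      then have "(1 - t) * side_dist k (corner l) + t * side_dist k (corner (l + 1)) = 0"
        by (simp add: t(3) side_dist_linepath)
      moreover have "0 \<le> (1 - t) * side_dist k (corner l)" "0 \<le> t * side_dist k (corner (l + 1))"
        using t side_dist_corner_nonneg by simp_all
      ultimately have "(1 - t) * side_dist k (corner l) = 0" by linarith
      then show "[k = l] (mod period) \<or> [k = l - 1] (mod period)"
        using False by (simp add: side_dist_corner_eq_0_iff)
    qed
    then show ?thesis ..
  qed
qed (auto simp: in_star_def)

lemma in_star_segment: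
  assumes "0 \<le> t" "t < 1" shows "in_star k ((1 - t) *\<^sub>R corner k + t *\<^sub>R corner l)"
  unfolding in_star_def side_dist_linepath
proof (intro allI impI)
  fix s assume "(1 - t) * side_dist s (corner k) + t * side_dist s (corner l) = 0"
  moreover have "0 \<le> (1 - t) * side_dist s (corner k)" "0 \<le> t * side_dist s (corner l)"
    using assms side_dist_corner_nonneg by simp_all
  ultimately have "(1 - t) * side_dist s (corner k) = 0" by linarith
  then show "[s = k] (mod period) \<or> [s = k - 1] (mod period)"
    using assms by (simp add: side_dist_corner_eq_0_iff)
qed

text \<open>Corner \<open>k\<close> has the sides \<open>k - 1\<close> and \<open>k\<close>, corner
  \<open>k + 1\<close> the sides \<open>k\<close> and \<open>k + 1\<close>; only \<open>k\<close> is
  common, because \<open>2m\<close> does not divide \<open>2\<close>.\<close>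

lemma star_inter_side:
  assumes "in_star k z" "in_star (k + 1) z" "side_dist s z = 0" shows "[s = k] (mod period)"
proof (rule ccontr)
  assume ne: "\<not> ?thesis"
  then have "[s = k - 1] (mod period)" "[s = k + 1] (mod period)"
    using assms unfolding in_star_def by fastforce+
  then have "[k + 1 = k - 1] (mod period)" using cong_sym cong_trans by blast
  then have "period dvd 2" by (simp add: cong_iff_dvd_diff)
  then show False using m_ge_2 zdvd_imp_le[of period 2] by simp
qed

text \<open>The sides \<open>k - 1\<close> and \<open>k\<close> both pass through the common point,
  and with at least four sides only one corner lies on both.\<close>

lemma corner_inj: assumes "corner k = corner l" shows "[k = l] (mod period)"
proof (rule ccontr)
  assume ne: "\<not> ?thesis"
  have "side_dist k (corner l) = 0" "side_dist (k - 1) (corner l) = 0"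
    using side_dist_corner_0(1)[of k] side_dist_corner_0(2)[of "k - 1"] assms by simp_all
  then have *: "period dvd k - (l - 1)" "period dvd k - 1 - l \<or> period dvd k - 1 - (l - 1)"
    using ne by (simp_all add: side_dist_corner_eq_0_iff cong_iff_dvd_diff)
  from *(2) show False
  proof
    assume "period dvd k - 1 - l"
    then have "period dvd (k - (l - 1)) - (k - 1 - l)" using *(1) by (rule dvd_diff[rotated])
    then have "period dvd 2" by simp
    then show False using m_ge_2 zdvd_imp_le[of period 2] by simp
  next
    assume "period dvd k - 1 - (l - 1)"
    then have "period dvd k - l" by simp
    then show False using ne by (simp add: cong_iff_dvd_diff)
  qed
qed

section \<open>Weights vanishing on alternate sides, and the embedding built from them\<close>

definition x_weight :: "complex \<Rightarrow> real" where "x_weight z = (\<Prod>l<m. side_dist (2 * int l + 1) z)"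
definition y_weight :: "complex \<Rightarrow> real" where "y_weight z = (\<Prod>l<m. side_dist (2 * int l) z)"

lemma continuous_weights [continuous_intros]:
  "continuous_on A f \<Longrightarrow> continuous_on A (\<lambda>x. x_weight (f x))"
  "continuous_on A f \<Longrightarrow> continuous_on A (\<lambda>x. y_weight (f x))"
  unfolding x_weight_def y_weight_def by (intro continuous_intros; assumption)+

text \<open>The weights run over side indices below \<open>2m\<close>, split by parity; reduction
  modulo the even number \<open>2m\<close> keeps the parity.\<close>

lemma side_representative:
  assumes "side_dist l z = 0"
  obtains r where "r < m" "side_dist (2 * int r + (if even l then 0 else 1)) z = 0"
proof
  define q where "q = l mod period"
  have q: "0 \<le> q" "q < period" "[l = q] (mod period)" using period_pos by (simp_all add: q_def cong_def)
  have ev: "even q \<longleftrightarrow> even l" by (simp add: q_def dvd_mod_iff)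
  show "nat (q div 2) < m" using q by linarith
  have "2 * int (nat (q div 2)) + (if even l then 0 else 1) = q"
    using q(1) ev by (auto simp: odd_iff_mod_2_eq_one minus_mod_eq_mult_div[symmetric])
  then show "side_dist (2 * int (nat (q div 2)) + (if even l then 0 else 1)) z = 0"
    using assms side_dist_cong[OF q(3), of z] by simp
qed

lemma x_weight_eq_0_iff: "x_weight z = 0 \<longleftrightarrow> (\<exists>l. odd l \<and> side_dist l z = 0)"
proof
  assume "\<exists>l. odd l \<and> side_dist l z = 0"
  then obtain l where l: "odd l" "side_dist l z = 0" by blast
  obtain r where "r < m" "side_dist (2 * int r + 1) z = 0" using side_representative[OF l(2)] l(1) by auto
  then show "x_weight z = 0" by (auto simp: x_weight_def)
next
  assume "x_weight z = 0"
  then obtain l where "side_dist (2 * int l + 1) z = 0" by (auto simp: x_weight_def)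
  then show "\<exists>l. odd l \<and> side_dist l z = 0" by (intro exI[of _ "2 * int l + 1"]) simp
qed

lemma y_weight_eq_0_iff: "y_weight z = 0 \<longleftrightarrow> (\<exists>l. even l \<and> side_dist l z = 0)"
proof
  assume "\<exists>l. even l \<and> side_dist l z = 0"
  then obtain l where l: "even l" "side_dist l z = 0" by blast
  obtain r where "r < m" "side_dist (2 * int r) z = 0" using side_representative[OF l(2)] l(1) by auto
  then show "y_weight z = 0" by (auto simp: y_weight_def)
next
  assume "y_weight z = 0"
  then obtain l where "side_dist (2 * int l) z = 0" by (auto simp: y_weight_def)
  then show "\<exists>l. even l \<and> side_dist l z = 0" by (intro exI[of _ "2 * int l"]) simp
qed

text \<open>\<^term>\<open>x_weight\<close> vanishes exactly on the sides labelled by some \<open>y\<close>, where the index \<open>i\<close> of the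
  polygon has to be forgotten, and \<^term>\<open>y_weight\<close> on those labelled by some \<open>x\<close>. So these maps agree
  on two points exactly when the points are glued.\<close>

definition embed :: "nat \<times> nat \<Rightarrow> complex \<Rightarrow> complex \<times> real \<times> real" where
  "embed e z = (z, x_weight z * real (fst e), y_weight z * real (snd e))"

lemma fst_embed [simp]: "fst (embed e z) = z"
  by (simp add: embed_def)

lemma continuous_embed [continuous_intros]:
  "continuous_on A f \<Longrightarrow> continuous_on A (\<lambda>x. embed e (f x))"
  unfolding embed_def by (intro continuous_intros)

lemma weights_corner [simp]: "x_weight (corner k) = 0" "y_weight (corner k) = 0"
proof -
  have "side_dist k (corner k) = 0" "side_dist (k - 1) (corner k) = 0"
    using side_dist_corner_0(1)[of k] side_dist_corner_0(2)[of "k - 1"] by simp_all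
  moreover have "odd (k - 1) \<longleftrightarrow> even k" by simp
  ultimately show "x_weight (corner k) = 0" "y_weight (corner k) = 0"
    unfolding x_weight_eq_0_iff y_weight_eq_0_iff by metis+
qed

lemma embed_corner: "embed e (corner k) = (corner k, 0, 0)"
  by (simp add: embed_def)

text \<open>The coordinates of the point at time \<open>t\<close> on the segment from \<open>z\<close> to the corner \<open>k\<close> are multiples of
  those of \<open>z\<close>; the multiplier is written so as to stay continuous on the two sides at the corner.\<close>

definition side_ratio :: "int \<Rightarrow> int \<Rightarrow> real \<Rightarrow> complex \<Rightarrow> real" where
  "side_ratio k l t z = (if side_dist l (corner k) = 0 then 1 - t
     else side_dist l ((1 - t) *\<^sub>R z + t *\<^sub>R corner k) / side_dist l z)"

definition contract :: "int \<Rightarrow> real \<Rightarrow> complex \<times> real \<times> real \<Rightarrow> complex \<times> real \<times> real" where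
  "contract k t p = ((1 - t) *\<^sub>R fst p + t *\<^sub>R corner k,
     fst (snd p) * (\<Prod>l<m. side_ratio k (2 * int l + 1) t (fst p)),
     snd (snd p) * (\<Prod>l<m. side_ratio k (2 * int l) t (fst p)))"

text \<open>The distance to a side through corner \<open>k\<close> shrinks by the factor
  \<open>1 - t\<close>; any other side is avoided by the star, so the division is
  legitimate.\<close>

lemma side_ratio:
  assumes "in_star k z"
  shows "side_dist l ((1 - t) *\<^sub>R z + t *\<^sub>R corner k) = side_dist l z * side_ratio k l t z"
  using assms by (auto simp: side_ratio_def side_dist_linepath in_star_def side_dist_corner_eq_0_iff)

text \<open>\<open>contract\<close> sees the coordinates only and no polygon, yet on each polygon it
  is the straight contraction to the corner. This is why the contractions of the single polygons fit
  together continuously.\<close>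

lemma contract_embed:
  assumes "in_star k z"
  shows "contract k t (embed e z) = embed e ((1 - t) *\<^sub>R z + t *\<^sub>R corner k)"
  by (simp add: contract_def embed_def x_weight_def y_weight_def side_ratio[OF assms] prod.distrib mult_ac)

end

section \<open>Open stars of the glued complex\<close>

locale polygon_space = even_polygon m for m :: nat +
  fixes E :: "(nat \<times> nat) set"
  assumes finite_E: "finite E"
begin

definition S :: "(complex \<times> real \<times> real) set" where "S = (\<Union>e\<in>E. embed e ` P)"

definition star :: "int \<Rightarrow> (complex \<times> real \<times> real) set" where
  "star k = {p \<in> S. in_star k (fst p)}"

lemma star_subset: "star k \<subseteq> S"
  by (auto simp: star_def)

lemma star_cong: "[k = l] (mod period) \<Longrightarrow> star k = star l"
  by (auto simp: star_def in_star_cong)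

lemma embed_in_S: "e \<in> E \<Longrightarrow> z \<in> P \<Longrightarrow> embed e z \<in> S"
  by (auto simp: S_def)

lemma ex_star: "p \<in> S \<Longrightarrow> \<exists>k. p \<in> star k"
  using ex_in_star by (auto simp: S_def star_def)

lemma contract_star:
  assumes "p \<in> star k" "t \<in> {0..1}" shows "contract k t p \<in> star k"
proof -
  obtain e z where p: "e \<in> E" "z \<in> P" "p = embed e z" using assms by (auto simp: star_def S_def)
  then have z: "in_star k z" using assms by (simp add: star_def)
  have "(1 - t) *\<^sub>R z + t *\<^sub>R corner k \<in> P"
    using convexD_alt[OF convex_P p(2) corner_in_P, of t] assms by simp
  then show ?thesis
    using p z in_star_side[OF p(2) z assms(2)] by (simp add: contract_embed star_def embed_in_S)
qed

lemma continuous_contract: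
  "continuous_on ({0..1} \<times> star k) (\<lambda>x. contract k (fst x) (snd x))"
proof -
  have "continuous_on ({0..1} \<times> star k) (\<lambda>x. side_ratio k l (fst x) (fst (snd x)))" for l
  proof (cases "side_dist l (corner k) = 0")
    case True
    then show ?thesis by (simp add: side_ratio_def) (intro continuous_intros)
  next
    case False
    then have "side_dist l (fst p) \<noteq> 0" if "p \<in> star k" for p
      using that by (auto simp: star_def in_star_def side_dist_corner_eq_0_iff)
    then show ?thesis using False by (simp add: side_ratio_def) (intro continuous_intros; auto)
  qed
  then show ?thesis unfolding contract_def by (intro continuous_intros)
qed

lemma contract_0: assumes "p \<in> star k" shows "contract k 0 p = p"
proof -
  obtain e z where p: "e \<in> E" "z \<in> P" "p = embed e z" using assms by (auto simp: star_def S_def)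
  then show ?thesis using assms contract_embed[of k z 0 e] by (simp add: star_def)
qed

lemma contract_1: assumes "p \<in> star k" shows "contract k 1 p = (corner k, 0, 0)"
proof -
  obtain e z where p: "e \<in> E" "z \<in> P" "p = embed e z" using assms by (auto simp: star_def S_def)
  then show ?thesis using assms contract_embed[of k z 1 e] by (simp add: star_def embed_corner)
qed

lemma contractible_star: "contractible (star k)"
proof -
  have "homotopic_with_canon (\<lambda>x. True) (star k) (star k) id (\<lambda>x. (corner k, 0, 0))"
    using continuous_contract contract_star contract_0 contract_1
    by (subst homotopic_with) (auto simp: prod_topology_subtopology_eu image_subset_iff
      intro!: exI[of _ "\<lambda>x. contract k (fst x) (snd x)"])
  then show ?thesis unfolding contractible_def by blast
qed

lemma openin_star: "openin (top_of_set S) (star k)"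
proof -
  \<comment> \<open>Only representatives of the forbidden sides modulo \<open>2m\<close>, so that
    the intersection of open sets is finite.\<close>
  let ?A = "{l \<in> {0..<period}. \<not> [l = k] (mod period) \<and> \<not> [l = k - 1] (mod period)}"
  have "star k = S \<inter> (\<Inter>l\<in>?A. {p. side_dist l (fst p) \<noteq> 0})"
  proof (intro equalityI subsetI)
    fix p assume p: "p \<in> S \<inter> (\<Inter>l\<in>?A. {p. side_dist l (fst p) \<noteq> 0})"
    have "in_star k (fst p)" unfolding in_star_def
    proof (intro allI impI, rule ccontr)
      fix l assume l: "side_dist l (fst p) = 0" "\<not> ([l = k] (mod period) \<or> [l = k - 1] (mod period))"
      have "[l mod period = l] (mod period)" by simp
      moreover from this have "side_dist (l mod period) (fst p) = 0" using l side_dist_cong by metis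
      moreover have "l mod period \<in> {0..<period}" using period_pos by simp
      ultimately have "l mod period \<in> ?A" using l(2) by simp
      then show False using p \<open>side_dist (l mod period) (fst p) = 0\<close> by blast
    qed
    with p show "p \<in> star k" by (simp add: star_def)
  qed (auto simp: star_def in_star_def)
  moreover have "open (\<Inter>l\<in>?A. {p :: complex \<times> real \<times> real. side_dist l (fst p) \<noteq> 0})"
  proof (rule open_INT)
    show "\<forall>l\<in>?A. open {p :: complex \<times> real \<times> real. side_dist l (fst p) \<noteq> 0}"
      by (intro ballI open_Collect_neq continuous_intros)
  qed (rule finite_subset[of _ "{0..<period}"], auto)
  ultimately show ?thesis by auto
qed

end

section \<open>Words, walls and the dihedral quotient\<close>

fun letter_shift :: "vertex \<Rightarrow> int" where
  "letter_shift (Xv _) = 1"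
| "letter_shift (Yv _) = - 1"

text \<open>Numbering the vertices of the polygon by the integers modulo \<open>2m\<close>, a word read from an even vertex
  \<open>k\<close> leads to \<open>k + shift w\<close>, and from an odd vertex to \<open>k - shift w\<close>. Hence \<open>shift w\<close> modulo
  \<open>2m\<close> encodes the image of \<open>w\<close> in the dihedral group.\<close>

fun shift :: "vertex gword \<Rightarrow> int" where
  "shift [] = 0"
| "shift (x # w) = letter_shift (fst x) - shift w"

lemma letter_shift_cases: "letter_shift v = 1 \<or> letter_shift v = - 1"
  by (cases v) auto

lemma odd_letter_shift [simp]: "odd (letter_shift v)"
  by (cases v) auto

lemma even_shift_iff [simp]: "even (shift w) \<longleftrightarrow> even (length w)"
  by (induction w) auto

lemma shift_append:
  "shift (u @ w) = shift u + (if even (length u) then shift w else - shift w)"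
  by (induction u) auto

text \<open>Counts the pairs of positions \<open>p < q\<close> carrying \<open>s\<close> and
  \<open>t\<close>. On a list of walls in which both occur once, it tells which of the two is
  crossed first.\<close>

fun ordered_pairs :: "'a list \<Rightarrow> 'a \<Rightarrow> 'a \<Rightarrow> nat" where
  "ordered_pairs [] s t = 0"
| "ordered_pairs (x # l) s t = (if x = s then count_list l t else 0) + ordered_pairs l s t"

lemma ordered_pairs_append:
  "ordered_pairs (k @ l) s t = ordered_pairs k s t + ordered_pairs l s t + count_list k s * count_list l t"
  by (induction k) auto

lemma ordered_pairs_eq_0: "s \<notin> set l \<or> t \<notin> set l \<Longrightarrow> ordered_pairs l s t = 0"
  by (induction l) (auto simp: count_list_0_iff)

lemma odd_count_iff_distinct: "distinct l \<Longrightarrow> odd (count_list l t) \<longleftrightarrow> t \<in> set l"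
  by (induction l) (auto simp: count_list_0_iff)

lemma count_list_map_bij:
  assumes "\<And>x. x \<in> set l \<Longrightarrow> f x = t \<longleftrightarrow> x = t'"
  shows "count_list (map f l) t = count_list l t'"
  using assms by (induction l) auto

lemma ordered_pairs_map_bij:
  assumes "\<And>x. x \<in> set l \<Longrightarrow> f x = s \<longleftrightarrow> x = s'" "\<And>x. x \<in> set l \<Longrightarrow> f x = t \<longleftrightarrow> x = t'"
  shows "ordered_pairs (map f l) s t = ordered_pairs l s' t'"
  using assms by (induction l) (auto simp: count_list_map_bij)

section \<open>Conjugation and right cosets in a group\<close>

definition conjugate :: "('a, 'b) monoid_scheme \<Rightarrow> 'a \<Rightarrow> 'a \<Rightarrow> 'a" where
  "conjugate G g t = g \<otimes>\<^bsub>G\<^esub> t \<otimes>\<^bsub>G\<^esub> inv\<^bsub>G\<^esub> g"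

context group begin

lemma inv_mult_cancel_left [simp]:
  "x \<in> carrier G \<Longrightarrow> y \<in> carrier G \<Longrightarrow> inv x \<otimes> (x \<otimes> y) = y"
  "x \<in> carrier G \<Longrightarrow> y \<in> carrier G \<Longrightarrow> x \<otimes> (inv x \<otimes> y) = y"
  by (simp_all flip: m_assoc)

lemma conjugate_closed [simp]:
  "g \<in> carrier G \<Longrightarrow> t \<in> carrier G \<Longrightarrow> conjugate G g t \<in> carrier G"
  by (simp add: conjugate_def)

lemma conjugate_mult:
  "g \<in> carrier G \<Longrightarrow> h \<in> carrier G \<Longrightarrow> t \<in> carrier G \<Longrightarrow>
    conjugate G (g \<otimes> h) t = conjugate G g (conjugate G h t)"
  by (simp add: conjugate_def inv_mult_group m_assoc)

lemma conjugate_one [simp]: "t \<in> carrier G \<Longrightarrow> conjugate G \<one> t = t"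
  by (simp add: conjugate_def)

lemma conjugate_conjugate_inv [simp]:
  "g \<in> carrier G \<Longrightarrow> t \<in> carrier G \<Longrightarrow> conjugate G (inv g) (conjugate G g t) = t"
  "g \<in> carrier G \<Longrightarrow> t \<in> carrier G \<Longrightarrow> conjugate G g (conjugate G (inv g) t) = t"
  by (simp_all flip: conjugate_mult)

lemma conjugate_eq_iff:
  "g \<in> carrier G \<Longrightarrow> s \<in> carrier G \<Longrightarrow> t \<in> carrier G \<Longrightarrow>
    conjugate G g s = t \<longleftrightarrow> s = conjugate G (inv g) t"
  by auto

lemma conjugate_mult_dist:
  "g \<in> carrier G \<Longrightarrow> s \<in> carrier G \<Longrightarrow> t \<in> carrier G \<Longrightarrow>
    conjugate G g s \<otimes> conjugate G g t = conjugate G g (s \<otimes> t)"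
  by (simp add: conjugate_def m_assoc)

lemma conjugate_unit [simp]: "g \<in> carrier G \<Longrightarrow> conjugate G g \<one> = \<one>"
  by (simp add: conjugate_def)

lemma conjugate_pow:
  "g \<in> carrier G \<Longrightarrow> h \<in> carrier G \<Longrightarrow> conjugate G g h [^] (n::nat) = conjugate G g (h [^] n)"
  by (induction n) (simp_all add: conjugate_mult_dist)

lemma rcoset_eq_iff:
  assumes "subgroup H G" "x \<in> carrier G" "y \<in> carrier G"
  shows "H #> x = H #> y \<longleftrightarrow> x \<otimes> inv y \<in> H"
proof
  assume "H #> x = H #> y"
  then have "x \<in> H #> y" using rcos_self[OF assms(2,1)] by simp
  then obtain h where "h \<in> H" "x = h \<otimes> y" by (auto simp: r_coset_def)
  then show "x \<otimes> inv y \<in> H" using assms subgroup.mem_carrier[OF assms(1)] by (simp add: m_assoc)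
next
  assume "x \<otimes> inv y \<in> H"
  then have "x \<otimes> inv y \<otimes> y \<in> H #> y" by (auto simp: r_coset_def)
  then have "x \<in> H #> y" using assms by (simp add: m_assoc)
  then show "H #> x = H #> y" using repr_independence[OF _ assms(3,1)] by simp
qed

end

section \<open>The Coxeter group and its dihedral subgroups\<close>

locale bipartite_coxeter = even_polygon m for m :: nat +
  fixes L :: "vertex pair_pre_digraph"
  assumes edge_verts: "(i, j) \<in> bip_edges L \<Longrightarrow> Xv i \<in> pverts L \<and> Yv j \<in> pverts L"
begin

abbreviation W where "W \<equiv> coxeter_group m L"
abbreviation W_mult (infixl "\<cdot>" 70) where "g \<cdot> h \<equiv> g \<otimes>\<^bsub>W\<^esub> h"
abbreviation words where "words \<equiv> gwords (pverts L)"
abbreviation pcong where "pcong \<equiv> pres_cong (pverts L) (coxeter_relators m L)"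

definition cls :: "vertex gword \<Rightarrow> vertex gword set" where "cls w = pcong `` {w}"
definition gen :: "vertex \<Rightarrow> vertex gword set" where "gen v = cls [(v, True)]"

sublocale W: group W
  unfolding coxeter_group_def by (rule group_presented_group)

lemma words_simps [simp]:
  "[] \<in> words" "x # w \<in> words \<longleftrightarrow> fst x \<in> pverts L \<and> w \<in> words"
  "u @ w \<in> words \<longleftrightarrow> u \<in> words \<and> w \<in> words"
  by (cases x; auto simp: gwords_def)+

lemma carrier_eq: "carrier W = cls ` words"
  by (auto simp: coxeter_group_def presented_group_def quotient_def cls_def)

lemma cls_closed [simp]: "w \<in> words \<Longrightarrow> cls w \<in> carrier W"
  by (simp add: carrier_eq)

lemma cls_eq_iff: "u \<in> words \<Longrightarrow> w \<in> words \<Longrightarrow> cls u = cls w \<longleftrightarrow> (u, w) \<in> pcong"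
  using eq_equiv_class_iff[OF equiv_pres_cong] by (simp add: cls_def)

lemma cls_append: "u \<in> words \<Longrightarrow> w \<in> words \<Longrightarrow> cls (u @ w) = cls u \<cdot> cls w"
  by (simp add: cls_def coxeter_group_def presented_group_mult)

lemma cls_Nil: "cls [] = \<one>\<^bsub>W\<^esub>"
  by (simp add: cls_def coxeter_group_def presented_group_def)

lemma gen_closed [simp]: "v \<in> pverts L \<Longrightarrow> gen v \<in> carrier W"
  by (simp add: gen_def)

lemma gen_sq: assumes "v \<in> pverts L" shows "gen v \<cdot> gen v = \<one>\<^bsub>W\<^esub>"
proof -
  have "([(v, True), (v, True)], []) \<in> pcong"
    by (rule pres_relator) (use assms in \<open>auto simp: coxeter_relators_def\<close>)
  then have "cls ([(v, True)] @ [(v, True)]) = cls []" using assms by (subst cls_eq_iff) auto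
  then show ?thesis using assms by (simp add: cls_append cls_Nil gen_def del: append.simps)
qed

lemma gen_inv: "v \<in> pverts L \<Longrightarrow> inv\<^bsub>W\<^esub> (gen v) = gen v"
  using gen_sq by (simp add: W.inv_equality)

lemma gen_gen_cancel [simp]:
  "v \<in> pverts L \<Longrightarrow> g \<in> carrier W \<Longrightarrow> gen v \<cdot> (gen v \<cdot> g) = g"
  by (simp add: gen_sq flip: W.m_assoc)

text \<open>Generators are involutions, so a formal inverse denotes the same element; for this
  reason \<open>shift\<close> and \<open>walls\<close> disregard the sign of a letter.\<close>

lemma cls_letter: assumes "fst x \<in> pverts L" shows "cls [x] = gen (fst x)"
proof (cases "snd x")
  case True
  then show ?thesis by (metis gen_def prod.collapse)
next
  case False
  then have x: "x = (fst x, False)" by (metis prod.collapse)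
  have "([(fst x, True), (fst x, False)], []) \<in> pcong"
    using pres_cancel[of "fst x" "pverts L" True] assms by simp
  then have "cls ([(fst x, True)] @ [(fst x, False)]) = cls []"
    using assms by (subst cls_eq_iff) auto
  then have "gen (fst x) \<cdot> cls [x] = \<one>\<^bsub>W\<^esub>"
    using assms x by (simp add: cls_append cls_Nil gen_def del: append.simps)
  then have "inv\<^bsub>W\<^esub> gen (fst x) = cls [x]" using assms by (metis W.inv_equality W.inv_inv W.inv_closed cls_closed words_simps(1,2) gen_closed)
  then show ?thesis using gen_inv assms by simp
qed

lemma cls_Cons: "fst x \<in> pverts L \<Longrightarrow> w \<in> words \<Longrightarrow> cls (x # w) = gen (fst x) \<cdot> cls w"
  using cls_append[of "[x]" w] by (simp add: cls_letter)

lemma cls_rev: "w \<in> words \<Longrightarrow> rev w \<in> words \<and> cls (rev w) = inv\<^bsub>W\<^esub> (cls w)"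
proof (induction w)
  case (Cons x w)
  then show ?case by (simp add: cls_append cls_letter cls_Cons cls_Nil W.inv_mult_group gen_inv)
qed (simp add: cls_Nil)

text \<open>The alternating word \<open>x y x ...\<close> of length \<open>k\<close>, or
  \<open>y x y ...\<close> of length \<open>-k\<close> for negative \<open>k\<close>: the word read
  along the boundary of the polygon \<open>e\<close> from corner \<open>0\<close> to corner
  \<open>k\<close>.\<close>

definition dih :: "nat \<times> nat \<Rightarrow> int \<Rightarrow> vertex gword set" where
  "dih e k = (gen (Xv (fst e)) \<cdot> gen (Yv (snd e))) [^]\<^bsub>W\<^esub> (k div 2) \<cdot>
     (if even k then \<one>\<^bsub>W\<^esub> else gen (Xv (fst e)))"

lemma cls_replicate:
  "u \<in> words \<Longrightarrow> cls (concat (replicate n u)) = cls u [^]\<^bsub>W\<^esub> n \<and> concat (replicate n u) \<in> words"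
  by (induction n) (simp_all add: cls_Nil cls_append flip: W.nat_pow_Suc2)

context
  fixes i j :: nat
  assumes ij: "(i, j) \<in> bip_edges L"
begin

lemma verts_ij [simp]: "Xv i \<in> pverts L" "Yv j \<in> pverts L"
  using edge_verts[OF ij] by auto

lemma dih_closed [simp]: "dih (i, j) k \<in> carrier W"
  by (simp add: dih_def)

lemma dih_0 [simp]: "dih (i, j) 0 = \<one>\<^bsub>W\<^esub>"
  by (simp add: dih_def)

lemma rotation_pow: "(gen (Xv i) \<cdot> gen (Yv j)) [^]\<^bsub>W\<^esub> m = \<one>\<^bsub>W\<^esub>"
proof -
  let ?r = "concat (replicate m [(Xv i, True), (Yv j, True)])"
  have "(?r, []) \<in> pcong"
  proof (rule pres_relator)
    show "?r \<in> coxeter_relators m L" using ij by (auto simp: coxeter_relators_def)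
    show "?r \<in> words" using cls_replicate[of "[(Xv i, True), (Yv j, True)]"] by simp
  qed
  then have "cls ?r = \<one>\<^bsub>W\<^esub>"
    using cls_replicate[of "[(Xv i, True), (Yv j, True)]" m] by (metis cls_Nil cls_eq_iff words_simps(1) verts_ij fst_conv words_simps(2))
  then show ?thesis
    using cls_replicate[of "[(Xv i, True), (Yv j, True)]" m] by (simp add: cls_Cons cls_Nil)
qed

lemma dih_periodic: "dih (i, j) (k + 2 * int m * c) = dih (i, j) k"
proof -
  let ?r = "gen (Xv i) \<cdot> gen (Yv j)"
  have "?r [^]\<^bsub>W\<^esub> (int m * c) = \<one>\<^bsub>W\<^esub>"
    using rotation_pow W.int_pow_pow[of ?r "int m" c] by (simp add: int_pow_int W.int_pow_one)
  moreover have "(k + 2 * int m * c) div 2 = k div 2 + int m * c" by auto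
  ultimately show ?thesis by (simp add: dih_def W.int_pow_mult)
qed

lemma dih_cong: "[k = l] (mod 2 * int m) \<Longrightarrow> dih (i, j) k = dih (i, j) l"
  by (metis cong_iff_lin dih_periodic)

lemma dih_Suc:
  "dih (i, j) (k + 1) = dih (i, j) k \<cdot> (if even k then gen (Xv i) else gen (Yv j))"
proof (cases "even k")
  case True
  then show ?thesis by (simp add: dih_def)
next
  case False
  then have "(k + 1) div 2 = k div 2 + 1" by presburger
  with False show ?thesis by (simp add: dih_def W.int_pow_mult W.m_assoc)
qed

lemma dih_pred:
  "dih (i, j) (k - 1) = dih (i, j) k \<cdot> (if even k then gen (Yv j) else gen (Xv i))"
  using dih_Suc[of "k - 1"] by (simp add: W.m_assoc gen_sq)

text \<open>Left multiplication reflects the index while right multiplication moves it by one; the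
  two sides do not interfere, so induction by right multiplication reduces everything to
  \<open>k = 0\<close>.\<close>

lemma gen_mult_dih:
  "gen (Xv i) \<cdot> dih (i, j) k = dih (i, j) (1 - k)"
  "gen (Yv j) \<cdot> dih (i, j) k = dih (i, j) (- 1 - k)"
proof -
  have "gen (Xv i) \<cdot> dih (i, j) k = dih (i, j) (1 - k) \<and>
    gen (Yv j) \<cdot> dih (i, j) k = dih (i, j) (- 1 - k)"
  proof (induction k rule: int_induct[where k = 0])
    case base
    show ?case using dih_Suc[of 0] dih_pred[of 0] by simp
  next
    case (step1 k)
    then show ?case using dih_pred[of "1 - k"] dih_pred[of "- 1 - k"]
      by (auto simp: dih_Suc simp flip: W.m_assoc)
  next
    case (step2 k)
    then show ?case using dih_Suc[of "1 - k"] dih_Suc[of "- 1 - k"]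
      by (auto simp: dih_pred simp flip: W.m_assoc)
  qed
  then show "gen (Xv i) \<cdot> dih (i, j) k = dih (i, j) (1 - k)"
    "gen (Yv j) \<cdot> dih (i, j) k = dih (i, j) (- 1 - k)" by auto
qed

lemma dih_mult:
  "dih (i, j) k \<cdot> dih (i, j) l = dih (i, j) (k + (if even k then l else - l))"
proof (induction k arbitrary: l rule: int_induct[where k = 0])
  case (step1 k)
  then show ?case by (simp add: dih_Suc W.m_assoc gen_mult_dih) (auto simp: algebra_simps)
next
  case (step2 k)
  then show ?case by (simp add: dih_pred W.m_assoc gen_mult_dih) (auto simp: algebra_simps)
qed simp

end

lemma cls_eq_dih:
  assumes ij: "(i, j) \<in> bip_edges L"
  shows "w \<in> lists ({Xv i, Yv j} \<times> UNIV) \<Longrightarrow> w \<in> words \<and> cls w = dih (i, j) (shift w)"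
proof (induction w)
  case (Cons x w)
  then show ?case
    using verts_ij[OF ij] by (auto simp: cls_Cons gen_mult_dih[OF ij])
qed (simp add: cls_Nil dih_0[OF ij])

lemma ex_edge_word: "\<exists>w\<in>lists ({Xv i, Yv j} \<times> UNIV). shift w = k"
proof (induction k rule: int_induct[where k = 0])
  case base
  show ?case by (rule bexI[of _ "[]"]) auto
next
  case (step1 k)
  then obtain w where w: "w \<in> lists ({Xv i, Yv j} \<times> UNIV)" "shift w = k" by blast
  have "even (length w) \<longleftrightarrow> even k" using w(2) even_shift_iff[of w] by simp
  then show ?case
    by (intro bexI[of _ "w @ [(if even k then Xv i else Yv j, True)]"]) (use w in \<open>auto simp: shift_append\<close>)
next
  case (step2 k)
  then obtain w where w: "w \<in> lists ({Xv i, Yv j} \<times> UNIV)" "shift w = k" by blast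
  have "even (length w) \<longleftrightarrow> even k" using w(2) even_shift_iff[of w] by simp
  then show ?case
    by (intro bexI[of _ "w @ [(if even k then Yv j else Xv i, True)]"]) (use w in \<open>auto simp: shift_append\<close>)
qed

section \<open>The map to the dihedral group and its kernel\<close>

lemma even_mod_period: "[a = b] (mod period) \<Longrightarrow> even a \<longleftrightarrow> even b"
  by (auto simp: cong_iff_lin)

lemma shift_concat_replicate:
  "shift (concat (replicate n [(Xv i, b), (Yv j, c)])) = 2 * int n"
  by (induction n) auto

text \<open>A relator \<open>v v\<close> has shift \<open>0\<close> and a relator
  \<open>(x y)^m\<close> has shift \<open>2m\<close>. The sign in \<open>shift_append\<close>
  depends only on the parity of a shift, which is meaningful modulo the even number
  \<open>2m\<close>.\<close>

lemma shift_pcong: "(u, w) \<in> pcong \<Longrightarrow> [shift u = shift w] (mod period)"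
proof (induction rule: pres_cong.induct)
  case (pres_append u u' v v')
  have "even (length u) \<longleftrightarrow> even (length u')"
    using even_mod_period[OF pres_append.IH(1)] by simp
  then show ?case
    using pres_append.IH by (auto simp: shift_append cong_add cong_diff)
next
  case (pres_relator r)
  then show ?case
    by (auto simp: coxeter_relators_def shift_concat_replicate cong_iff_dvd_diff)
next
  case (pres_sym v w)
  then show ?case by (simp add: cong_sym)
next
  case (pres_trans u v w)
  then show ?case using cong_trans by blast
qed auto

lemma shift_cong: "cls u = cls w \<Longrightarrow> u \<in> words \<Longrightarrow> w \<in> words \<Longrightarrow> [shift u = shift w] (mod period)"
  using shift_pcong by (simp add: cls_eq_iff)

definition gshift :: "vertex gword set \<Rightarrow> int" where
  "gshift g = shift (SOME w. w \<in> words \<and> cls w = g) mod period"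

lemma gshift_cls: assumes "w \<in> words" shows "gshift (cls w) = shift w mod period"
proof -
  let ?u = "SOME u. u \<in> words \<and> cls u = cls w"
  have "?u \<in> words \<and> cls ?u = cls w"
    by (rule someI[of _ w]) (use assms in simp)
  then have "[shift ?u = shift w] (mod period)" using shift_cong assms by blast
  then show ?thesis by (simp add: gshift_def cong_def)
qed

lemma gshift_dih: "(i, j) \<in> bip_edges L \<Longrightarrow> gshift (dih (i, j) k) = k mod period"
  using ex_edge_word[of i j k] cls_eq_dih[of i j] gshift_cls by metis

lemma even_gshift: "w \<in> words \<Longrightarrow> even (gshift (cls w)) \<longleftrightarrow> even (length w)"
  by (simp add: gshift_cls dvd_mod_iff)

text \<open>This is the multiplication of the dihedral group, with rotations as even and reflections
  as odd residues; so \<open>gshift\<close> amounts to a homomorphism into that group.\<close>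

lemma gshift_mult:
  assumes "g \<in> carrier W" "h \<in> carrier W"
  shows "gshift (g \<cdot> h) = (gshift g + (if even (gshift g) then gshift h else - gshift h)) mod period"
proof -
  obtain u w where uw: "u \<in> words" "g = cls u" "w \<in> words" "h = cls w"
    using assms by (auto simp: carrier_eq)
  have e: "even (gshift g) \<longleftrightarrow> even (length u)" using uw even_gshift by simp
  have "gshift (g \<cdot> h) = shift (u @ w) mod period" using uw by (simp add: gshift_cls flip: cls_append)
  then show ?thesis unfolding e using uw
    by (simp add: gshift_cls shift_append mod_add_eq mod_diff_eq)
qed

lemma gshift_one [simp]: "gshift \<one>\<^bsub>W\<^esub> = 0"
  using gshift_cls[of "[]"] by (simp add: cls_Nil)

definition K :: "vertex gword set set" where "K = {g \<in> carrier W. gshift g = 0}"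

lemma gshift_range: "0 \<le> gshift g" "gshift g < period"
  using m_ge_2 by (simp_all add: gshift_def)

lemma gshift_inv_eq_0: "g \<in> carrier W \<Longrightarrow> gshift (inv\<^bsub>W\<^esub> g) = 0 \<longleftrightarrow> gshift g = 0"
proof -
  have *: "gshift (inv\<^bsub>W\<^esub> g) = 0" if "g \<in> carrier W" "gshift g = 0" for g
    using gshift_mult[of g "inv\<^bsub>W\<^esub> g"] that gshift_range[of "inv\<^bsub>W\<^esub> g"] by simp
  show "g \<in> carrier W \<Longrightarrow> ?thesis" using *[of g] *[of "inv\<^bsub>W\<^esub> g"] by auto
qed

lemma subgroup_K: "subgroup K W"
proof (rule W.subgroupI)
  have "\<one>\<^bsub>W\<^esub> \<in> K" by (simp add: K_def)
  then show "K \<noteq> {}" by blast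
qed (auto simp: K_def gshift_mult gshift_inv_eq_0)

lemma gshift_eq_iff:
  assumes "g \<in> carrier W" "h \<in> carrier W"
  shows "gshift g = gshift h \<longleftrightarrow> g \<cdot> inv\<^bsub>W\<^esub> h \<in> K"
proof
  assume "g \<cdot> inv\<^bsub>W\<^esub> h \<in> K"
  then have "gshift (g \<cdot> inv\<^bsub>W\<^esub> h \<cdot> h) = gshift h"
    using assms gshift_mult[of "g \<cdot> inv\<^bsub>W\<^esub> h" h] gshift_range[of h] by (simp add: K_def)
  then show "gshift g = gshift h" using assms by (simp add: W.m_assoc)
next
  assume eq: "gshift g = gshift h"
  have "gshift (h \<cdot> inv\<^bsub>W\<^esub> h) = 0" using assms by simp
  then have "gshift (g \<cdot> inv\<^bsub>W\<^esub> h) = 0"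
    using assms by (simp only: gshift_mult W.inv_closed eq)
  then show "g \<cdot> inv\<^bsub>W\<^esub> h \<in> K" using assms by (simp add: K_def)
qed

lemma conjugate_mem_K:
  assumes "g \<in> carrier W" "h \<in> carrier W" "conjugate W g h \<in> K" shows "h \<in> K"
proof -
  have "gshift (g \<cdot> h) = gshift g"
    using assms gshift_eq_iff[of "g \<cdot> h" g] by (simp add: conjugate_def)
  then have "(gshift g + (if even (gshift g) then gshift h else - gshift h)) mod period = gshift g mod period"
    using gshift_mult[of g h] assms gshift_range[of g] by simp
  then have "period dvd (if even (gshift g) then gshift h else - gshift h)"
    by (simp add: mod_eq_dvd_iff split: if_splits)
  then have "gshift h mod period = 0" by (auto split: if_splits)
  then show ?thesis using assms gshift_range[of h] by (simp add: K_def)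
qed

definition D :: "nat \<times> nat \<Rightarrow> vertex gword set set" where "D e = range (dih e)"

lemma D_K_trivial: assumes "(i, j) \<in> bip_edges L" "d \<in> D (i, j)" "d \<in> K" shows "d = \<one>\<^bsub>W\<^esub>"
proof -
  obtain k where k: "d = dih (i, j) k" using assms by (auto simp: D_def)
  then have "k mod period = 0" using assms gshift_dih by (simp add: K_def)
  then have "dih (i, j) k = dih (i, j) 0" using dih_cong[OF assms(1), of k 0] by (simp add: cong_def)
  with k show ?thesis by (simp add: dih_0[OF assms(1)])
qed

text \<open>The reflections in the walls crossed by the gallery that starts at \<open>1\<close> and spells the word.\<close>

fun walls :: "vertex gword \<Rightarrow> vertex gword set list" where
  "walls [] = []"
| "walls (x # w) = gen (fst x) # map (conjugate W (gen (fst x))) (walls w)"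

lemma length_walls [simp]: "length (walls w) = length w"
  by (induction w) auto

lemma walls_closed: "w \<in> words \<Longrightarrow> t \<in> set (walls w) \<Longrightarrow> t \<in> carrier W"
  by (induction w arbitrary: t) auto

lemma walls_append:
  "u \<in> words \<Longrightarrow> w \<in> words \<Longrightarrow> walls (u @ w) = walls u @ map (conjugate W (cls u)) (walls w)"
proof (induction u)
  case Nil
  then show ?case using walls_closed[of w] by (simp add: cls_Nil cong: map_cong)
next
  case (Cons x u)
  then show ?case using walls_closed[of w] by (simp add: cls_Cons W.conjugate_mult cong: map_cong)
qed

text \<open>For \<open>w = u x v\<close> the wall is the conjugate of \<open>x\<close> by
  \<open>u\<close>, which turns \<open>u x v\<close> into \<open>u v\<close>. Deleting a letter by a
  reflection is the mechanism behind the exchange property.\<close>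

lemma nth_walls:
  assumes "w \<in> words" "k < length w"
  shows "walls w ! k \<cdot> cls w = cls (take k w @ drop (Suc k) w)"
proof -
  define u x v where "u = take k w" and "x = w ! k" and "v = drop (Suc k) w"
  have w: "w = u @ x # v" using assms by (simp add: u_def x_def v_def id_take_nth_drop)
  have l: "length u = k" using assms by (simp add: u_def)
  have [simp]: "u \<in> words" "v \<in> words" "fst x \<in> pverts L" using assms(1) by (simp_all add: w)
  have "walls w ! k = conjugate W (cls u) (gen (fst x))"
    using l by (simp add: w walls_append nth_append)
  moreover have "take k w @ drop (Suc k) w = u @ v" by (simp add: u_def v_def)
  ultimately show ?thesis
    using w by (simp add: conjugate_def cls_append cls_Cons W.m_assoc)
qed

definition reduced :: "vertex gword \<Rightarrow> bool" where
  "reduced w \<longleftrightarrow> w \<in> words \<and> (\<forall>u\<in>words. cls u = cls w \<longrightarrow> length w \<le> length u)"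

lemma wall_sq:
  assumes "w \<in> words" "t \<in> set (walls w)" shows "t \<cdot> t = \<one>\<^bsub>W\<^esub>"
  using assms
proof (induction w arbitrary: t)
  case (Cons x w)
  then show ?case
    using walls_closed[of w] by (auto simp: W.conjugate_mult_dist gen_sq)
qed simp

lemma reduced_distinct:
  assumes "reduced w" shows "distinct (walls w)"
proof (rule ccontr)
  assume "\<not> distinct (walls w)"
  then obtain p q where pq: "p < q" "q < length w" "walls w ! p = walls w ! q"
    unfolding distinct_conv_nth by (metis length_walls nat_neq_iff)
  have w: "w \<in> words" using assms by (simp add: reduced_def)
  define t where "t = walls w ! q"
  define u where "u = take q w @ drop (Suc q) w"
  \<comment> \<open>Deleting letter \<open>q\<close> leaves the wall of the earlier letter
    \<open>p\<close> unchanged, so applying the same reflection twice deletes both letters without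
    changing the element.\<close>
  define u' where "u' = take p u @ drop (Suc p) u"
  have tw: "take n v \<in> words" "drop n v \<in> words" if "v \<in> words" for n v
    using that by (metis append_take_drop_id words_simps(3))+
  have u: "u \<in> words" using w by (simp add: u_def tw)
  have lu: "length u = length w - 1" using pq by (simp add: u_def)
  have t: "t \<in> set (walls w)" unfolding t_def using pq by (metis length_walls nth_mem)
  have tu: "t \<cdot> cls w = cls u" using nth_walls[OF w pq(2)] by (simp add: t_def u_def)
  have "walls u = walls (take q w) @ map (conjugate W (cls (take q w))) (walls (drop (Suc q) w))"
    unfolding u_def using w by (simp add: walls_append tw)
  then have "walls u ! p = walls (take q w) ! p" using pq by (simp add: nth_append)
  also have "\<dots> = walls (take q w @ drop q w) ! p"
    using pq w by (simp add: walls_append tw nth_append del: append_take_drop_id)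
  finally have "walls u ! p = t" using pq by (simp add: t_def)
  then have "t \<cdot> cls u = cls u'" using nth_walls[OF u, of p] pq lu by (simp add: u'_def)
  then have "cls u' = t \<cdot> (t \<cdot> cls w)" using tu by simp
  then have "cls u' = cls w"
    using wall_sq[OF w t] walls_closed[OF w t] w W.m_assoc[of t t "cls w"] by simp
  moreover have "u' \<in> words" using u by (simp add: u'_def tw)
  moreover have "length u' < length w" using lu pq by (simp add: u'_def)
  ultimately show False using assms by (force simp: reduced_def)
qed

lemma walls_relator:
  assumes ij: "(i, j) \<in> bip_edges L"
  shows "walls (concat (replicate n [(Xv i, True), (Yv j, True)])) = map (\<lambda>p. dih (i, j) (2 * int p + 1)) [0..<2 * n]"
proof (induction n)
  case (Suc n)
  let ?r = "concat (replicate n [(Xv i, True), (Yv j, True)])"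
  have v: "Xv i \<in> pverts L" "Yv j \<in> pverts L" using edge_verts[OF ij] by auto
  have x: "gen (Xv i) = dih (i, j) 1" using dih_Suc[OF ij, of 0] v by (simp add: dih_0[OF ij])
  have y: "gen (Yv j) = dih (i, j) (- 1)" using dih_pred[OF ij, of 0] v by (simp add: dih_0[OF ij])
  have inv: "inv\<^bsub>W\<^esub> (dih (i, j) 1) = dih (i, j) 1" "inv\<^bsub>W\<^esub> (dih (i, j) (- 1)) = dih (i, j) (- 1)"
    using v gen_inv by (simp_all flip: x y)
  have c1: "conjugate W (gen (Xv i)) (dih (i, j) k) = dih (i, j) (if even k then - k else 2 - k)" for k
    unfolding x conjugate_def inv by (simp add: dih_mult[OF ij])
  have c2: "conjugate W (gen (Yv j)) (dih (i, j) k) = dih (i, j) (if even k then - k else - 2 - k)" for k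
    unfolding y conjugate_def inv by (simp add: dih_mult[OF ij])
  have c: "conjugate W (gen (Xv i)) (conjugate W (gen (Yv j)) (dih (i, j) (2 * int p + 1))) =
      dih (i, j) (2 * int (p + 2) + 1)" for p
    by (simp add: c1 c2 algebra_simps)
  have d: "conjugate W (gen (Xv i)) (gen (Yv j)) = dih (i, j) 3" by (simp add: y c1)
  have u: "[0..<2 * Suc n] = 0 # 1 # map (\<lambda>p. p + 2) [0..<2 * n]"
  proof -
    have "map (\<lambda>p. p + 2) [0..<2 * n] = map Suc (map Suc [0..<2 * n])" by simp
    also have "\<dots> = [2..<2 * Suc n]" unfolding map_Suc_upt by (simp add: numeral_2_eq_2 del: upt_Suc)
    finally show ?thesis by (simp add: upt_conv_Cons numeral_2_eq_2 del: upt_Suc)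
  qed
  show ?case unfolding u by (simp add: Suc c d o_def flip: x del: upt_Suc mult_Suc_right)
qed simp

text \<open>Opposite sides of a polygon have the same wall, since their indices differ by
  \<open>2m\<close>. Hence a relator meets every wall an even number of times.\<close>

lemma walls_relator_double:
  assumes ij: "(i, j) \<in> bip_edges L"
  shows "\<exists>l. walls (concat (replicate m [(Xv i, True), (Yv j, True)])) = l @ l \<and> set l \<subseteq> D (i, j)"
proof (intro exI conjI)
  let ?l = "map (\<lambda>p. dih (i, j) (2 * int p + 1)) [0..<m]"
  have "[0..<2 * m] = [0..<m] @ map (\<lambda>p. p + m) [0..<m]"
    by (simp only: map_add_upt mult_2 upt_add_eq_append[OF le0])
  moreover have "dih (i, j) (2 * int (p + m) + 1) = dih (i, j) (2 * int p + 1)" for p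
    using dih_periodic[OF ij, of "2 * int p + 1" 1] by (simp add: algebra_simps)
  ultimately show "walls (concat (replicate m [(Xv i, True), (Yv j, True)])) = ?l @ ?l"
    unfolding walls_relator[OF ij] by (simp add: o_def)
  show "set ?l \<subseteq> D (i, j)" by (auto simp: D_def)
qed

lemma count_walls_append:
  assumes "u \<in> words" "w \<in> words" "t \<in> carrier W"
  shows "count_list (walls (u @ w)) t =
    count_list (walls u) t + count_list (walls w) (conjugate W (inv\<^bsub>W\<^esub> (cls u)) t)"
  using assms walls_closed[OF assms(2)]
  by (simp add: walls_append count_list_append)
    (rule count_list_map_bij, simp add: W.conjugate_eq_iff)

text \<open>Relators contribute evenly, and the walls of a word placed behind \<open>u\<close> are
  conjugated by \<open>cls u\<close>, which depends only on the class of \<open>u\<close>.\<close>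

lemma even_count_pcong:
  "(u, w) \<in> pcong \<Longrightarrow> t \<in> carrier W \<Longrightarrow>
    even (count_list (walls u) t) \<longleftrightarrow> even (count_list (walls w) t)"
proof (induction arbitrary: t rule: pres_cong.induct)
  case (pres_append u u' v v')
  have [simp]: "u \<in> words" "u' \<in> words" "v \<in> words" "v' \<in> words"
    using pres_append.hyps pres_cong_subset by blast+
  have "cls u = cls u'" using pres_append.hyps by (simp add: cls_eq_iff)
  then show ?case using pres_append.IH pres_append.prems by (simp add: count_walls_append)
next
  case (pres_cancel a b)
  then show ?case by (simp add: conjugate_def gen_inv gen_sq)
next
  case (pres_relator r)
  then consider v where "v \<in> pverts L" "r = [(v, True), (v, True)]"
    | i j where "(i, j) \<in> bip_edges L" "r = concat (replicate m [(Xv i, True), (Yv j, True)])"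
    by (auto simp: coxeter_relators_def)
  then show ?case
  proof cases
    case 1
    then show ?thesis by (simp add: conjugate_def gen_inv gen_sq)
  next
    case 2
    then show ?thesis using walls_relator_double[OF 2(1)] by (auto simp: count_list_append)
  qed
qed auto

text \<open>The wall of \<open>t\<close> separates \<open>1\<close> from \<open>g\<close>; as a
  parity this does not depend on the gallery chosen.\<close>

definition crosses :: "vertex gword set \<Rightarrow> vertex gword set \<Rightarrow> bool" where
  "crosses g t \<longleftrightarrow> odd (count_list (walls (SOME w. w \<in> words \<and> cls w = g)) t)"

lemma crosses_cls:
  assumes "w \<in> words" "t \<in> carrier W"
  shows "crosses (cls w) t \<longleftrightarrow> odd (count_list (walls w) t)"
proof -
  let ?u = "SOME u. u \<in> words \<and> cls u = cls w"
  have "?u \<in> words \<and> cls ?u = cls w"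
    by (rule someI[of _ w]) (use assms in simp)
  then have "(?u, w) \<in> pcong" using assms cls_eq_iff[of ?u w] by blast
  from even_count_pcong[OF this assms(2)] show ?thesis by (simp add: crosses_def)
qed

lemma crosses_reduced: "reduced w \<Longrightarrow> t \<in> carrier W \<Longrightarrow> crosses (cls w) t \<longleftrightarrow> t \<in> set (walls w)"
  using reduced_distinct[of w] by (simp add: reduced_def crosses_cls odd_count_iff_distinct)

lemma crosses_mult:
  assumes "g \<in> carrier W" "h \<in> carrier W" "t \<in> carrier W"
  shows "crosses (g \<cdot> h) t \<longleftrightarrow> crosses g t \<noteq> crosses h (conjugate W (inv\<^bsub>W\<^esub> g) t)"
proof -
  obtain u w where "u \<in> words" "g = cls u" "w \<in> words" "h = cls w"
    using assms by (auto simp: carrier_eq)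
  then show ?thesis
    using assms by (simp add: crosses_cls count_walls_append flip: cls_append)
qed

lemma crosses_gen: "v \<in> pverts L \<Longrightarrow> t \<in> carrier W \<Longrightarrow> crosses (gen v) t \<longleftrightarrow> gen v = t"
  unfolding gen_def[of v] by (subst crosses_cls) (auto simp flip: gen_def)

lemma crosses_one [simp]: "t \<in> carrier W \<Longrightarrow> \<not> crosses \<one>\<^bsub>W\<^esub> t"
  using crosses_cls[of "[]"] by (simp add: cls_Nil)

text \<open>The walls of \<open>s\<close> and \<open>t\<close> do not cross in any 2-cell of the Davis complex. In that case each relator
  crosses at most one of them, twice, so the parity of \<^const>\<open>ordered_pairs\<close> is an invariant of the group
  element.\<close>

definition apart :: "vertex gword set \<Rightarrow> vertex gword set \<Rightarrow> bool" where
  "apart s t \<longleftrightarrow> s \<noteq> t \<and> \<not> (\<exists>g\<in>carrier W. \<exists>e\<in>bip_edges L. s \<in> conjugate W g ` D e \<and> t \<in> conjugate W g ` D e)"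

lemma D_closed: "e \<in> bip_edges L \<Longrightarrow> d \<in> D e \<Longrightarrow> d \<in> carrier W"
  by (cases e) (auto simp: D_def dih_closed)

lemma apart_conjugate:
  assumes "apart s t" "s \<in> carrier W" "t \<in> carrier W" "g \<in> carrier W"
  shows "apart (conjugate W g s) (conjugate W g t)"
  unfolding apart_def
proof (intro conjI notI; (elim bexE conjE)?)
  assume "conjugate W g s = conjugate W g t"
  then show False using assms by (metis W.conjugate_conjugate_inv(1) apart_def)
next
  fix h e assume h: "h \<in> carrier W" "e \<in> bip_edges L"
    and *: "conjugate W g s \<in> conjugate W h ` D e" "conjugate W g t \<in> conjugate W h ` D e"
  have "s' \<in> conjugate W (inv\<^bsub>W\<^esub> g \<cdot> h) ` D e"
    if s': "s' \<in> carrier W" "conjugate W g s' \<in> conjugate W h ` D e" for s'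
  proof -
    obtain d where d: "d \<in> D e" "conjugate W g s' = conjugate W h d" using s' by auto
    then have "conjugate W (inv\<^bsub>W\<^esub> g) (conjugate W g s') = conjugate W (inv\<^bsub>W\<^esub> g \<cdot> h) d"
      using assms h d(1) D_closed[OF h(2)] by (simp add: W.conjugate_mult)
    then have "s' = conjugate W (inv\<^bsub>W\<^esub> g \<cdot> h) d" using s' assms by simp
    then show ?thesis using d by blast
  qed
  from this[OF assms(2) *(1)] this[OF assms(3) *(2)] have "\<not> apart s t"
    unfolding apart_def using W.m_closed[OF W.inv_closed[OF assms(4)] h(1)] h(2) by blast
  with assms(1) show False by simp
qed

lemma ordered_pairs_walls_append:
  assumes "u \<in> words" "w \<in> words" "s \<in> carrier W" "t \<in> carrier W"
  shows "ordered_pairs (walls (u @ w)) s t = ordered_pairs (walls u) s t +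
    ordered_pairs (walls w) (conjugate W (inv\<^bsub>W\<^esub> (cls u)) s) (conjugate W (inv\<^bsub>W\<^esub> (cls u)) t) +
    count_list (walls u) s * count_list (walls w) (conjugate W (inv\<^bsub>W\<^esub> (cls u)) t)"
proof -
  have 1: "ordered_pairs (map (conjugate W (cls u)) (walls w)) s t =
    ordered_pairs (walls w) (conjugate W (inv\<^bsub>W\<^esub> (cls u)) s) (conjugate W (inv\<^bsub>W\<^esub> (cls u)) t)"
    by (rule ordered_pairs_map_bij) (use assms walls_closed[OF assms(2)] in \<open>simp_all add: W.conjugate_eq_iff\<close>)
  have 2: "count_list (map (conjugate W (cls u)) (walls w)) t =
    count_list (walls w) (conjugate W (inv\<^bsub>W\<^esub> (cls u)) t)"
    by (rule count_list_map_bij) (use assms walls_closed[OF assms(2)] in \<open>simp_all add: W.conjugate_eq_iff\<close>)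
  show ?thesis using assms by (simp add: walls_append ordered_pairs_append 1 2)
qed

lemma even_ordered_pairs_pcong:
  "(u, w) \<in> pcong \<Longrightarrow> s \<in> carrier W \<Longrightarrow> t \<in> carrier W \<Longrightarrow> apart s t \<Longrightarrow>
    even (ordered_pairs (walls u) s t) \<longleftrightarrow> even (ordered_pairs (walls w) s t)"
proof (induction arbitrary: s t rule: pres_cong.induct)
  case (pres_append u u' v v')
  have [simp]: "u \<in> words" "u' \<in> words" "v \<in> words" "v' \<in> words"
    using pres_append.hyps pres_cong_subset by blast+
  have c: "cls u = cls u'" using pres_append.hyps by (simp add: cls_eq_iff)
  have "even (count_list (walls u) s) \<longleftrightarrow> even (count_list (walls u') s)"
    by (rule even_count_pcong) (use pres_append in auto)
  moreover have "even (count_list (walls v) t') \<longleftrightarrow> even (count_list (walls v') t')" if "t' \<in> carrier W" for t'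
    by (rule even_count_pcong) (use pres_append that in auto)
  ultimately show ?case
    using pres_append.IH pres_append.prems c
    by (simp add: ordered_pairs_walls_append apart_conjugate)
next
  case (pres_cancel a b)
  then show ?case by (auto simp: conjugate_def gen_inv gen_sq apart_def)
next
  case (pres_relator r)
  then consider v where "v \<in> pverts L" "r = [(v, True), (v, True)]"
    | i j where "(i, j) \<in> bip_edges L" "r = concat (replicate m [(Xv i, True), (Yv j, True)])"
    by (auto simp: coxeter_relators_def)
  then show ?case
  proof cases
    case 1
    then show ?thesis using pres_relator by (auto simp: conjugate_def gen_inv gen_sq apart_def)
  next
    case 2
    obtain l where l: "walls r = l @ l" "set l \<subseteq> D (i, j)" using walls_relator_double[OF 2(1)] 2(2) by auto
    have "d \<in> conjugate W \<one>\<^bsub>W\<^esub> ` D (i, j)" if "d \<in> D (i, j)" for d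
      using that D_closed[OF 2(1)] by (auto intro!: image_eqI[of _ _ d])
    then have "\<not> (s \<in> D (i, j) \<and> t \<in> D (i, j))"
      using pres_relator 2(1) unfolding apart_def by blast
    then have "count_list l s * count_list l t = 0" using l(2) by (auto simp: count_list_0_iff)
    then have "ordered_pairs (walls r) s t = 2 * ordered_pairs l s t" by (simp add: l ordered_pairs_append)
    then show ?thesis by simp
  qed
qed auto

section \<open>The kernel is torsion-free of index \<open>2m\<close>\<close>

lemma obtain_reduced:
  assumes "g \<in> carrier W" obtains w where "reduced w" "cls w = g"
proof -
  obtain w0 where "w0 \<in> words \<and> cls w0 = g" using assms by (auto simp: carrier_eq)
  from ex_has_least_nat[of "\<lambda>w. w \<in> words \<and> cls w = g", OF this, of length] that
  show ?thesis unfolding reduced_def by blast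
qed

lemma conjugate_K: "g \<in> carrier W \<Longrightarrow> h \<in> K \<Longrightarrow> conjugate W g h \<in> K"
  using conjugate_mem_K[of "inv\<^bsub>W\<^esub> g" "conjugate W g h"] by (simp add: K_def)

lemma D_mult: assumes "e \<in> bip_edges L" "c \<in> D e" "d \<in> D e" shows "c \<cdot> d \<in> D e"
  using assms by (cases e) (auto simp: D_def dih_mult)

lemma conjugate_D_mult:
  assumes "e \<in> bip_edges L" "h \<in> carrier W" "a \<in> conjugate W h ` D e" "b \<in> conjugate W h ` D e"
  shows "a \<cdot> b \<in> conjugate W h ` D e"
  using assms D_mult[OF assms(1)] D_closed[OF assms(1)] by (auto simp: W.conjugate_mult_dist)

lemma conjugate_D_K_trivial:
  assumes "e \<in> bip_edges L" "h \<in> carrier W" "a \<in> conjugate W h ` D e" "a \<in> K"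
  shows "a = \<one>\<^bsub>W\<^esub>"
proof -
  obtain d where d: "d \<in> D e" "a = conjugate W h d" using assms by auto
  have "d \<in> K" by (rule conjugate_mem_K[OF assms(2) D_closed[OF assms(1) d(1)]]) (use assms(4) d in simp)
  then have "d = \<one>\<^bsub>W\<^esub>" using D_K_trivial[of "fst e" "snd e"] assms(1) d(1) by simp
  then show ?thesis using d assms by simp
qed

text \<open>Two such reflections in one conjugate of \<open>D e\<close> would have their product
  both there and in \<open>K\<close>, hence trivial.\<close>

lemma apart_iff_K:
  assumes "s \<in> carrier W" "t \<in> carrier W" "t \<cdot> t = \<one>\<^bsub>W\<^esub>" "s \<cdot> t \<in> K"
  shows "apart s t \<longleftrightarrow> s \<noteq> t"
proof -
  have "s = t" if "h \<in> carrier W" "e \<in> bip_edges L" "s \<in> conjugate W h ` D e" "t \<in> conjugate W h ` D e" for h e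
  proof -
    have "s \<cdot> t = \<one>\<^bsub>W\<^esub>"
      by (rule conjugate_D_K_trivial[OF that(2,1) conjugate_D_mult[OF that(2,1,3,4)] assms(4)])
    then show "s = t" using assms by (metis W.inv_equality)
  qed
  then show ?thesis unfolding apart_def by blast
qed

lemma gshift_gen: "v \<in> pverts L \<Longrightarrow> gshift (gen v) = letter_shift v mod period"
  by (simp add: gen_def gshift_cls)

lemma even_ordered_pairs_cong:
  assumes "cls u = cls w" "u \<in> words" "w \<in> words" "s \<in> carrier W" "t \<in> carrier W" "apart s t"
  shows "even (ordered_pairs (walls u) s t) \<longleftrightarrow> even (ordered_pairs (walls w) s t)"
  using assms even_ordered_pairs_pcong cls_eq_iff by blast

text \<open>If the half-space of \<open>s\<close> and its translate by \<open>g\<close> have disjoint walls, they are nested, since the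
  quadrants containing \<open>1\<close>, \<open>g\<close> and \<open>g s\<close> are not empty.\<close>

lemma crosses_mult_nested:
  assumes g: "g \<in> K" and s: "s \<in> pverts L" and gs: "crosses g (gen s)"
    and gs': "\<not> crosses (inv\<^bsub>W\<^esub> g) (gen s)" and ne: "conjugate W g (gen s) \<noteq> gen s"
    and y: "y \<in> carrier W" "crosses y (gen s)"
  shows "crosses (g \<cdot> y) (gen s)"
proof (rule ccontr)
  define t where "t = conjugate W g (gen s)"
  have [simp]: "g \<in> carrier W" "gen s \<in> carrier W" "t \<in> carrier W"
    using g s by (simp_all add: K_def t_def)
  have ct: "conjugate W (inv\<^bsub>W\<^esub> g) t = gen s" by (simp add: t_def)
  have tt: "t \<cdot> t = \<one>\<^bsub>W\<^esub>" using s by (simp add: t_def W.conjugate_mult_dist gen_sq)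
  \<comment> \<open>The product of the two reflections is the commutator of \<open>s\<close> and
    \<open>g\<close>, which lies in the normal subgroup \<open>K\<close>.\<close>
  have "gen s \<cdot> t = conjugate W (gen s) g \<cdot> inv\<^bsub>W\<^esub> g"
    using s by (simp add: t_def conjugate_def W.m_assoc gen_inv)
  then have "gen s \<cdot> t \<in> K"
    using conjugate_K[of "gen s" g] g s subgroup.m_closed[OF subgroup_K] subgroup.m_inv_closed[OF subgroup_K] by simp
  then have ap: "apart (gen s) t" using apart_iff_K[of "gen s" t] tt ne by (simp add: t_def)
  have gt: "\<not> crosses g t" using crosses_mult[of g "inv\<^bsub>W\<^esub> g" t] gs' by (simp add: ct)
  have gst: "crosses (g \<cdot> gen s) t" using crosses_mult[of g "gen s" t] gt s by (simp add: ct crosses_gen)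
  let ?z = "g \<cdot> y"
  assume zs: "\<not> crosses ?z (gen s)"
  have zt: "crosses ?z t" using crosses_mult[of g y t] gt y by (simp add: ct)
  obtain w where w: "reduced w" "cls w = g" by (rule obtain_reduced[of g]) auto
  obtain u where u: "reduced u" "cls u = ?z" by (rule obtain_reduced[of ?z]) (use y in auto)
  have rest: "inv\<^bsub>W\<^esub> ?z \<cdot> (g \<cdot> gen s) \<in> carrier W" using y by simp
  obtain v where v: "reduced v" "cls v = inv\<^bsub>W\<^esub> ?z \<cdot> (g \<cdot> gen s)" by (rule obtain_reduced[OF rest])
  have wd: "w \<in> words" "u \<in> words" "v \<in> words" using w u v by (auto simp: reduced_def)
  have uv: "cls (u @ v) = g \<cdot> gen s" using wd u v y by (simp add: cls_append del: W.inv_mult_group)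
  have ws: "cls (w @ [(s, True)]) = g \<cdot> gen s" using wd w s by (simp add: cls_append cls_letter)
  have vt: "\<not> crosses (cls v) (conjugate W (inv\<^bsub>W\<^esub> ?z) t)"
    using crosses_mult[of ?z "cls v" t] y wd gst zt uv u by (simp add: cls_append)
  have "t \<notin> set (walls w)" using crosses_reduced[OF w(1), of t] gt w by simp
  moreover have "odd (count_list (walls w) (gen s))" using crosses_cls[of w "gen s"] wd w gs by simp
  \<comment> \<open>Two galleries from \<open>1\<close> to \<open>g s\<close> are compared. The one
    through \<open>g\<close> crosses the wall of \<open>s\<close> an odd number of times on the way
    to \<open>g\<close>, and the wall of \<open>t\<close> only with its last letter.\<close>
  ultimately have "odd (ordered_pairs (walls (w @ [(s, True)])) (gen s) t)"
    using wd w s by (simp add: ordered_pairs_walls_append ct ordered_pairs_eq_0)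
  then have "odd (ordered_pairs (walls (u @ v)) (gen s) t)"
    using even_ordered_pairs_cong[of "u @ v" "w @ [(s, True)]" "gen s" t] uv ws wd s ap by simp
  \<comment> \<open>The gallery through \<open>g y\<close> avoids the wall of \<open>s\<close>
    before that point and the wall of \<open>t\<close> after it, so it never crosses them in this
    order.\<close>
  moreover have "gen s \<notin> set (walls u)" using crosses_reduced[OF u(1), of "gen s"] zs u by simp
  moreover have "conjugate W (inv\<^bsub>W\<^esub> ?z) t \<notin> set (walls v)"
    using crosses_reduced[OF v(1), of "conjugate W (inv\<^bsub>W\<^esub> ?z) t"] vt y by simp
  ultimately show False using wd u
    by (simp add: ordered_pairs_walls_append ordered_pairs_eq_0 count_list_0_iff)
qed

text \<open>The minimum is taken over all words of nontrivial elements of \<open>K\<close> killed by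
  the same exponent \<open>n\<close>. These elements are closed under conjugation, so
  \<open>w\<close> is reduced and no conjugate of \<open>g\<close> has a shorter word.\<close>

lemma torsion_free_aux:
  assumes w: "w \<in> words" "cls w \<in> K" "cls w \<noteq> \<one>\<^bsub>W\<^esub>" "n > 0" "cls w [^]\<^bsub>W\<^esub> (n::nat) = \<one>\<^bsub>W\<^esub>"
    and min: "\<And>u. u \<in> words \<Longrightarrow> cls u \<in> K \<Longrightarrow> cls u \<noteq> \<one>\<^bsub>W\<^esub> \<Longrightarrow> cls u [^]\<^bsub>W\<^esub> n = \<one>\<^bsub>W\<^esub> \<Longrightarrow>
      length w \<le> length u"
  shows False
proof -
  define g where "g = cls w"
  have [simp]: "g \<in> carrier W" using w by (simp add: g_def)
  have red: "reduced u" if "u \<in> words" "cls u = g" "length u = length w" for u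
    using that min w unfolding reduced_def g_def by auto
  have commute: "gen s \<cdot> g = g \<cdot> gen s" if s: "s \<in> pverts L" and cr: "crosses g (gen s)" for s
  proof (rule ccontr)
    assume ne: "\<not> ?thesis"
    have [simp]: "gen s \<in> carrier W" using s by simp
    have "gen s \<in> set (walls w)" using crosses_reduced[OF red[OF w(1)], of "gen s"] cr by (simp add: g_def)
    then obtain p where p: "p < length w" "walls w ! p = gen s" by (metis in_set_conv_nth length_walls)
    define v where "v = take p w @ drop (Suc p) w"
    have tw: "take n v \<in> words" "drop n v \<in> words" if "v \<in> words" for n v
      using that by (metis append_take_drop_id words_simps(3))+
    have v: "v \<in> words" "length w = Suc (length v)" "cls v = gen s \<cdot> g"
      using p w(1) nth_walls[of w p] by (auto simp: v_def tw g_def)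
    define w' where "w' = (s, True) # v"
    have w': "w' \<in> words" "cls w' = g" "length w' = length w"
      using v s by (simp_all add: w'_def cls_Cons)
    show False
    proof (cases "crosses (inv\<^bsub>W\<^esub> g) (gen s)")
      \<comment> \<open>Here \<open>s\<close> is a right descent too, so \<open>g s\<close> arises
        from \<open>s v\<close> by deleting one letter. If it is the initial \<open>s\<close>, then
        \<open>s\<close> and \<open>g\<close> commute; otherwise the conjugate \<open>s g s\<close>
        has a word shorter by two.\<close>
      case True
      have rw: "rev w' \<in> words" "cls (rev w') = inv\<^bsub>W\<^esub> g" using cls_rev w' by simp_all
      have "reduced (rev w')" unfolding reduced_def
      proof (intro conjI ballI impI rw)
        fix u assume u: "u \<in> words" "cls u = cls (rev w')"
        then have "cls (rev u) = g" using cls_rev[of u] rw by simp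
        then show "length (rev w') \<le> length u"
          using red[OF w'(1,2,3)] cls_rev[of u] u w' unfolding reduced_def by (metis length_rev)
      qed
      then have "gen s \<in> set (walls (rev w'))" using crosses_reduced[of "rev w'" "gen s"] True rw by simp
      then obtain q where q: "q < length w'" "walls (rev w') ! q = gen s"
        by (metis in_set_conv_nth length_walls length_rev)
      define z where "z = take q (rev w') @ drop (Suc q) (rev w')"
      have z: "z \<in> words" "cls z = gen s \<cdot> inv\<^bsub>W\<^esub> g"
        using nth_walls[OF rw(1), of q] q rw by (simp_all add: z_def tw)
      have rz: "rev z \<in> words" "cls (rev z) = g \<cdot> gen s"
        using cls_rev[OF z(1)] z(2) s by (simp_all add: W.inv_mult_group gen_inv)
      define r where "r = length w' - Suc q"
      have r: "rev z = take r w' @ drop (Suc r) w'" "r < length w'"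
        using q by (simp_all add: z_def r_def take_rev drop_rev Suc_diff_Suc)
      show False
      proof (cases r)
        case 0
        then show False using r rz v ne by (simp add: w'_def)
      next
        case (Suc r')
        define z' where "z' = take r' v @ drop (Suc r') v"
        have "rev z = (s, True) # z'" using r Suc by (simp add: w'_def z'_def)
        moreover have z': "z' \<in> words" using v by (simp add: z'_def tw)
        ultimately have "gen s \<cdot> cls z' = g \<cdot> gen s" using rz s by (simp add: cls_Cons)
        then have "gen s \<cdot> (gen s \<cdot> cls z') = gen s \<cdot> (g \<cdot> gen s)" by simp
        then have c: "cls z' = conjugate W (gen s) g"
          using z' s by (simp add: conjugate_def W.m_assoc gen_inv)
        have "cls z' \<in> K" using c w by (simp add: conjugate_K g_def)
        moreover have "cls z' [^]\<^bsub>W\<^esub> n = \<one>\<^bsub>W\<^esub>" using c w by (simp add: W.conjugate_pow g_def)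
        moreover have "cls z' \<noteq> \<one>\<^bsub>W\<^esub>"
        proof
          assume "cls z' = \<one>\<^bsub>W\<^esub>"
          then have "conjugate W (inv\<^bsub>W\<^esub> gen s) (conjugate W (gen s) g) = \<one>\<^bsub>W\<^esub>" using c by simp
          then show False using w by (simp add: g_def)
        qed
        ultimately have "length w \<le> length z'" using min z' by blast
        moreover have "length z' < length w" using v by (simp add: z'_def)
        ultimately show False by simp
      qed
    next
      \<comment> \<open>Now \<open>g\<close> carries the half-space of \<open>s\<close> not
        containing \<open>1\<close> into itself, so it contains all positive powers of
        \<open>g\<close>, among them the power \<open>n\<close>, which is \<open>1\<close>.\<close>
      case False
      have ne': "conjugate W g (gen s) \<noteq> gen s"
      proof
        assume "conjugate W g (gen s) = gen s"
        then have "g \<cdot> gen s \<cdot> inv\<^bsub>W\<^esub> g \<cdot> g = gen s \<cdot> g" by (simp add: conjugate_def)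
        then show False using ne by (simp add: W.m_assoc)
      qed
      have "crosses (g [^]\<^bsub>W\<^esub> Suc k) (gen s)" for k
      proof (induction k)
        case (Suc k)
        have "crosses (g \<cdot> g [^]\<^bsub>W\<^esub> Suc k) (gen s)"
          by (rule crosses_mult_nested[OF _ s cr False ne' _ Suc]) (use w in \<open>simp_all add: g_def\<close>)
        then show ?case by (simp only: W.nat_pow_Suc2[OF \<open>g \<in> carrier W\<close>])
      qed (use cr in simp)
      from this[of "n - 1"] show False using w s by (simp add: g_def)
    qed
  qed
  have hd: "crosses g (gen (fst x))" if "x # v \<in> words" "cls (x # v) = g" "length (x # v) = length w" for x v
    using crosses_reduced[OF red[OF that], of "gen (fst x)"] that by simp
  \<comment> \<open>From \<open>g = x v\<close> and \<open>x g = g x\<close> follows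
    \<open>v x = g\<close>.\<close>
  have rot1: "rotate1 u \<in> words \<and> cls (rotate1 u) = g" if "u \<in> words" "cls u = g" "length u = length w" for u
  proof (cases u)
    case (Cons x v)
    have "gen (fst x) \<cdot> g = g \<cdot> gen (fst x)" using commute[of "fst x"] hd[of x v] that Cons by simp
    moreover have "cls v = gen (fst x) \<cdot> g" using that Cons by (auto simp: cls_Cons)
    ultimately show ?thesis using that Cons by (simp add: cls_append cls_letter W.m_assoc gen_sq)
  qed (use that in simp)
  have rot: "rotate k w \<in> words \<and> cls (rotate k w) = g" for k
    by (induction k) (use w rot1 in \<open>simp_all add: g_def\<close>)
  have letter: "\<exists>v. x # v \<in> words \<and> cls (x # v) = g \<and> length (x # v) = length w" if x: "x \<in> set w" for x
  proof -
    obtain k where k: "k < length w" "w ! k = x" using x by (metis in_set_conv_nth)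
    then have "rotate k w = x # drop (Suc k) w @ take k w"
      using Cons_nth_drop_Suc[of k w] by (simp add: rotate_drop_take)
    then show ?thesis using rot[of k] by (metis length_rotate)
  qed
  have lw: "fst x \<in> pverts L" if "x \<in> set w" for x using letter[OF that] by auto
  \<comment> \<open>The rotation beginning with \<open>x\<close> crosses the wall of
    \<open>x\<close> first, the one beginning with \<open>y\<close> that of \<open>y\<close>; as
    both spell \<open>g\<close>, the order parity cannot be an invariant for these two
    walls.\<close>
  have not_apart: "\<not> apart (gen (fst x)) (gen (fst y))" if xy: "x \<in> set w" "y \<in> set w" for x y
  proof
    let ?s = "gen (fst x)" and ?t = "gen (fst y)"
    assume ap: "apart ?s ?t"
    obtain u where u: "x # u \<in> words" "cls (x # u) = g" "length (x # u) = length w" using letter[OF xy(1)] by blast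
    obtain v where v: "y # v \<in> words" "cls (y # v) = g" "length (y # v) = length w" using letter[OF xy(2)] by blast
    have du: "distinct (walls (x # u))" and dv: "distinct (walls (y # v))"
      using reduced_distinct red u v by blast+
    have "?t \<in> set (walls (x # u))" using crosses_reduced[OF red[OF u], of ?t] hd[OF v] u lw[OF xy(2)] by simp
    moreover have "?s \<noteq> ?t" using ap by (simp add: apart_def)
    ultimately have "odd (ordered_pairs (walls (x # u)) ?s ?t)"
      using du by (auto simp: ordered_pairs_eq_0 odd_count_iff_distinct)
    moreover have "even (ordered_pairs (walls (y # v)) ?s ?t)"
      using dv \<open>?s \<noteq> ?t\<close> by (auto simp: ordered_pairs_eq_0)
    ultimately show False
      using even_ordered_pairs_cong[of "x # u" "y # v" ?s ?t] u v ap lw xy by simp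
  qed
  \<comment> \<open>Two letters of the same kind have their product in \<open>K\<close>, where not
    being apart means being equal. So at most one \<open>x\<close>-generator and one
    \<open>y\<close>-generator occur in \<open>w\<close>.\<close>
  have diff: "letter_shift (fst x) \<noteq> letter_shift (fst y)"
    if xy: "x \<in> set w" "y \<in> set w" "gen (fst x) \<noteq> gen (fst y)" for x y
  proof
    assume "letter_shift (fst x) = letter_shift (fst y)"
    then have "gshift (gen (fst x) \<cdot> inv\<^bsub>W\<^esub> gen (fst y)) = 0"
      using gshift_eq_iff[of "gen (fst x)" "gen (fst y)"] lw xy by (simp add: gshift_gen K_def)
    then have "gen (fst x) \<cdot> gen (fst y) \<in> K" using lw xy by (simp add: gen_inv K_def)
    then show False using apart_iff_K[of "gen (fst x)" "gen (fst y)"] not_apart[OF xy(1,2)] xy lw by (simp add: gen_sq)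
  qed
  show False
  proof (cases "\<exists>x\<in>set w. \<exists>y\<in>set w. gen (fst x) \<noteq> gen (fst y)")
    case True
    then obtain x y where xy: "x \<in> set w" "y \<in> set w" "gen (fst x) \<noteq> gen (fst y)" by blast
    obtain h e where he: "h \<in> carrier W" "e \<in> bip_edges L"
      "gen (fst x) \<in> conjugate W h ` D e" "gen (fst y) \<in> conjugate W h ` D e"
      using not_apart[OF xy(1,2)] xy(3) unfolding apart_def by blast
    have let_in: "gen (fst z) \<in> conjugate W h ` D e" if "z \<in> set w" for z
    proof -
      have "gen (fst z) = gen (fst x) \<or> gen (fst z) = gen (fst y)"
        using diff[OF xy] diff[OF that xy(1)] diff[OF that xy(2)]
          letter_shift_cases[of "fst x"] letter_shift_cases[of "fst y"] letter_shift_cases[of "fst z"] by metis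
      with he show ?thesis by auto
    qed
    have one: "\<one>\<^bsub>W\<^esub> \<in> conjugate W h ` D e"
    proof -
      have "\<one>\<^bsub>W\<^esub> \<in> D e" using he(2) dih_0[of "fst e" "snd e"] rangeI[of "dih e" 0] by (simp add: D_def)
      then show ?thesis using he(1) by (intro image_eqI[of _ _ "\<one>\<^bsub>W\<^esub>"]) simp_all
    qed
    have "cls u \<in> conjugate W h ` D e" if "u \<in> words" "set u \<subseteq> set w" for u
      using that
    proof (induction u)
      case Nil
      then show ?case using one by (simp add: cls_Nil)
    next
      case (Cons z u)
      then show ?case using let_in[of z] conjugate_D_mult[OF he(2,1)] by (simp add: cls_Cons)
    qed
    then show False using conjugate_D_K_trivial[OF he(2,1)] w by blast
  next
    case False
    show False
    proof (cases w)
      case Nil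
      then show False using w by (simp add: cls_Nil)
    next
      case wx: (Cons x v)
      show False
      proof (cases v)
        case Nil
        have "gshift g = letter_shift (fst x) mod period" using wx Nil w by (simp add: g_def gshift_cls)
        then have "period dvd letter_shift (fst x)" using w by (simp add: K_def g_def mod_eq_0_iff_dvd)
        then have "even (letter_shift (fst x))" by (rule dvd_trans[OF dvd_triv_left])
        then show False by simp
      next
        \<comment> \<open>All letters denote one involution, so the first two cancel and leave a
          shorter word of \<open>g\<close>.\<close>
        case (Cons y u)
        have "gen (fst y) = gen (fst x)" using False wx Cons by auto
        then have "cls u = g" using w wx Cons by (simp add: g_def cls_Cons)
        then show False using min[of u] w wx Cons by (simp add: g_def)
      qed
    qed
  qed
qed

lemma torsion_free_K: "torsion_free (W\<lparr>carrier := K\<rparr>)"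
  unfolding torsion_free_def
proof (intro ballI allI impI, rule ccontr)
  fix x and n :: nat
  assume x: "x \<in> carrier (W\<lparr>carrier := K\<rparr>)" "n > 0" "x [^]\<^bsub>W\<lparr>carrier := K\<rparr>\<^esub> n = \<one>\<^bsub>W\<lparr>carrier := K\<rparr>\<^esub>"
    "x \<noteq> \<one>\<^bsub>W\<lparr>carrier := K\<rparr>\<^esub>"
  obtain w0 where w0: "w0 \<in> words" "cls w0 = x" using x by (auto simp: K_def carrier_eq)
  let ?P = "\<lambda>w. w \<in> words \<and> cls w \<in> K \<and> cls w \<noteq> \<one>\<^bsub>W\<^esub> \<and> cls w [^]\<^bsub>W\<^esub> n = \<one>\<^bsub>W\<^esub>"
  have "?P w0" using x w0 by (simp flip: W.nat_pow_consistent)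
  from ex_has_least_nat[of ?P, OF this, of length] obtain w where "?P w" "\<forall>u. ?P u \<longrightarrow> length w \<le> length u"
    by blast
  then show False using torsion_free_aux[of w n] x(2) by blast
qed

section \<open>Dihedral subgroups against torsion-free subgroups\<close>

context
  fixes i j :: nat
  assumes ij: "(i, j) \<in> bip_edges L"
begin

lemma dih_inv: "inv\<^bsub>W\<^esub> (dih (i, j) k) = dih (i, j) (if even k then - k else k)"
  by (rule W.inv_equality) (simp_all add: dih_mult[OF ij] dih_0[OF ij] dih_closed[OF ij])

lemma dih_torsion: "\<exists>n::nat. n > 0 \<and> dih (i, j) k [^]\<^bsub>W\<^esub> n = \<one>\<^bsub>W\<^esub>"
proof (cases "even k")
  case True
  have "dih (i, j) k [^]\<^bsub>W\<^esub> n = dih (i, j) (int n * k)" for n :: nat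
    using True by (induction n) (auto simp: dih_mult[OF ij] dih_0[OF ij] algebra_simps)
  moreover obtain c where "k = 2 * c" using True by blast
  ultimately have "dih (i, j) k [^]\<^bsub>W\<^esub> m = \<one>\<^bsub>W\<^esub>"
    using dih_periodic[OF ij, of 0 c] by (simp add: dih_0[OF ij] algebra_simps)
  then show ?thesis using m_ge_2 by (intro exI[of _ m]) auto
next
  case False
  then have "dih (i, j) k [^]\<^bsub>W\<^esub> (2::nat) = \<one>\<^bsub>W\<^esub>"
    by (simp add: numeral_2_eq_2 dih_mult[OF ij] dih_0[OF ij] dih_closed[OF ij])
  then show ?thesis by (intro exI[of _ 2]) auto
qed

lemma dih_torsion_free:
  assumes "torsion_free (W\<lparr>carrier := H\<rparr>)" "dih (i, j) k \<in> H"
  shows "dih (i, j) k = \<one>\<^bsub>W\<^esub>"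
  using dih_torsion[of k] assms unfolding torsion_free_def by (auto simp flip: W.nat_pow_consistent)

lemma gshift_dih_mod: "gshift (dih (i, j) (gshift g)) = gshift g"
  using gshift_range[of g] by (simp add: gshift_dih[OF ij])

lemma card_rcosets_K: "card (rcosets\<^bsub>W\<^esub> K) = 2 * m"
proof -
  have eq: "K #>\<^bsub>W\<^esub> g = K #>\<^bsub>W\<^esub> h \<longleftrightarrow> gshift g = gshift h" if "g \<in> carrier W" "h \<in> carrier W" for g h
    using W.rcoset_eq_iff[OF subgroup_K that] gshift_eq_iff[OF that] by simp
  have "bij_betw (\<lambda>k. K #>\<^bsub>W\<^esub> dih (i, j) (int k)) {..<2 * m} (rcosets\<^bsub>W\<^esub> K)"
  proof (rule bij_betw_imageI)
    show "inj_on (\<lambda>k. K #>\<^bsub>W\<^esub> dih (i, j) (int k)) {..<2 * m}"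
      by (rule inj_onI) (simp add: eq dih_closed[OF ij] gshift_dih[OF ij])
    show "(\<lambda>k. K #>\<^bsub>W\<^esub> dih (i, j) (int k)) ` {..<2 * m} = rcosets\<^bsub>W\<^esub> K"
    proof (intro equalityI subsetI)
      fix A assume "A \<in> rcosets\<^bsub>W\<^esub> K"
      then obtain g where g: "g \<in> carrier W" "A = K #>\<^bsub>W\<^esub> g" by (auto simp: RCOSETS_def)
      then have "A = K #>\<^bsub>W\<^esub> dih (i, j) (int (nat (gshift g)))"
        using gshift_range[of g] by (simp add: eq gshift_dih_mod dih_closed[OF ij])
      moreover have "nat (gshift g) \<in> {..<2 * m}" using gshift_range[of g] by simp
      ultimately show "A \<in> (\<lambda>k. K #>\<^bsub>W\<^esub> dih (i, j) (int k)) ` {..<2 * m}" by blast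
    qed (use dih_closed[OF ij] in \<open>auto simp: RCOSETS_def\<close>)
  qed
  from bij_betw_same_card[OF this] show ?thesis by simp
qed

text \<open>Elements of the dihedral subgroup have finite order, so \<open>H\<close> meets it
  trivially and its \<open>2m\<close> elements lie in distinct cosets.\<close>

lemma torsion_free_index:
  assumes H: "subgroup H W" "torsion_free (W\<lparr>carrier := H\<rparr>)" "finite (rcosets\<^bsub>W\<^esub> H)"
  shows "2 * m \<le> card (rcosets\<^bsub>W\<^esub> H)"
proof -
  have "inj_on (\<lambda>k. H #>\<^bsub>W\<^esub> dih (i, j) (int k)) {..<2 * m}"
  proof (rule inj_onI)
    fix k l assume kl: "k \<in> {..<2 * m}" "l \<in> {..<2 * m}"
      and "H #>\<^bsub>W\<^esub> dih (i, j) (int k) = H #>\<^bsub>W\<^esub> dih (i, j) (int l)"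
    then have in_H: "dih (i, j) (int k) \<cdot> inv\<^bsub>W\<^esub> dih (i, j) (int l) \<in> H"
      using W.rcoset_eq_iff[OF H(1)] dih_closed[OF ij] by simp
    then have "dih (i, j) (int k) \<cdot> inv\<^bsub>W\<^esub> dih (i, j) (int l) = \<one>\<^bsub>W\<^esub>"
      unfolding dih_inv dih_mult[OF ij] by (rule dih_torsion_free[OF H(2)])
    then have "dih (i, j) (int k) = dih (i, j) (int l)"
      using dih_closed[OF ij] by (metis W.inv_equality W.inv_closed W.inv_inv)
    then have "gshift (dih (i, j) (int k)) = gshift (dih (i, j) (int l))" by simp
    then show "k = l" using kl by (simp add: gshift_dih[OF ij])
  qed
  moreover have "(\<lambda>k. H #>\<^bsub>W\<^esub> dih (i, j) (int k)) ` {..<2 * m} \<subseteq> rcosets\<^bsub>W\<^esub> H"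
    using dih_closed[OF ij] by (auto simp: RCOSETS_def)
  ultimately show ?thesis using card_inj_on_le[OF _ _ H(3)] by fastforce
qed

text \<open>For \<open>x\<close> in \<open>H\<close> but not in \<open>K\<close>, the dihedral
  element with the same image as \<open>x\<close> lies in the coset \<open>K x\<close>, hence in
  \<open>H\<close>, although it is nontrivial of finite order.\<close>

lemma K_maximal:
  assumes H: "subgroup H W" "torsion_free (W\<lparr>carrier := H\<rparr>)" and sub: "K \<subset> H" shows False
proof -
  obtain x where x: "x \<in> H" "x \<notin> K" using sub by blast
  have xc: "x \<in> carrier W" using subgroup.mem_carrier[OF H(1) x(1)] .
  let ?d = "dih (i, j) (gshift x)"
  have "?d \<cdot> inv\<^bsub>W\<^esub> x \<in> K"
    using gshift_eq_iff[of ?d x] gshift_dih_mod xc dih_closed[OF ij] by simp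
  then have "?d \<cdot> inv\<^bsub>W\<^esub> x \<cdot> x \<in> H" using sub x subgroup.m_closed[OF H(1)] by blast
  then have "?d \<in> H" using xc dih_closed[OF ij] by (simp add: W.m_assoc)
  then have "?d = \<one>\<^bsub>W\<^esub>" by (rule dih_torsion_free[OF H(2)])
  then have "gshift x = 0" using gshift_dih_mod[of x] by simp
  then show False using x xc by (simp add: K_def)
qed

end

end

section \<open>Edge paths in the complex\<close>

lemma homotopic_paths_cancel_left:
  fixes S :: "'a::real_normed_vector set"
  assumes "path p" "path_image p \<subseteq> S" "path q" "path_image q \<subseteq> S" "pathfinish p = pathstart q"
  shows "homotopic_paths S (reversepath p +++ (p +++ q)) q"
proof -
  have "homotopic_paths S (reversepath p +++ (p +++ q)) ((reversepath p +++ p) +++ q)"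
    using assms by (intro homotopic_paths_assoc) auto
  also have "homotopic_paths S \<dots> (linepath (pathstart q) (pathstart q) +++ q)"
    using assms homotopic_paths_linv[of p S] by (intro homotopic_paths_join) auto
  also have "homotopic_paths S \<dots> q" using assms by (intro homotopic_paths_lid) auto
  finally show ?thesis .
qed

text \<open>For putting together two pieces, each of the form radius, edge path, reversed radius:
  the inner radii cancel. It serves equally for products of loops conjugated by a fixed
  path.\<close>

lemma homotopic_paths_cancel_middle:
  fixes S :: "'a::real_normed_vector set"
  assumes "path p" "path_image p \<subseteq> S" "path u" "path_image u \<subseteq> S" "path q" "path_image q \<subseteq> S"
    "path v" "path_image v \<subseteq> S" "path r" "path_image r \<subseteq> S"
    "pathfinish p = pathstart u" "pathfinish u = pathfinish q" "pathfinish q = pathstart v" "pathfinish v = pathstart r"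
  shows "homotopic_paths S ((p +++ (u +++ reversepath q)) +++ (q +++ (v +++ r))) (p +++ ((u +++ v) +++ r))"
proof -
  have "homotopic_paths S ((p +++ (u +++ reversepath q)) +++ (q +++ (v +++ r)))
      (p +++ ((u +++ reversepath q) +++ (q +++ (v +++ r))))"
    by (rule homotopic_paths_sym, rule homotopic_paths_assoc) (use assms in \<open>auto simp: path_image_join\<close>)
  also have "homotopic_paths S \<dots> (p +++ (u +++ (reversepath q +++ (q +++ (v +++ r)))))"
    by (intro homotopic_paths_join homotopic_paths_sym[OF homotopic_paths_assoc])
      (use assms in \<open>auto simp: path_image_join\<close>)
  also have "homotopic_paths S \<dots> (p +++ (u +++ (v +++ r)))"
    by (intro homotopic_paths_join homotopic_paths_cancel_left) (use assms in \<open>auto simp: path_image_join\<close>)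
  also have "homotopic_paths S \<dots> (p +++ ((u +++ v) +++ r))"
    by (intro homotopic_paths_join homotopic_paths_assoc) (use assms in \<open>auto simp: path_image_join\<close>)
  finally show ?thesis .
qed

lemma homotopic_paths_eq_simply_connected:
  fixes S :: "'a::real_normed_vector set"
  assumes "simply_connected T" "T \<subseteq> S" "path p" "path_image p \<subseteq> T" "path q" "path_image q \<subseteq> T"
    "pathstart p = pathstart q" "pathfinish p = pathfinish q"
  shows "homotopic_paths S p q"
  using assms homotopic_paths_subset[of T p q S] unfolding simply_connected_eq_homotopic_paths by metis

lemma homotopic_paths_conj_cancel:
  fixes S :: "'a::real_normed_vector set"
  assumes "path c" "path_image c \<subseteq> S" "path q" "path_image q \<subseteq> S" "pathfinish c = pathstart q" "pathfinish q = pathfinish c"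
  shows "homotopic_paths S (reversepath c +++ ((c +++ (q +++ reversepath c)) +++ c)) q"
proof -
  have "homotopic_paths S ((c +++ (q +++ reversepath c)) +++ c) (c +++ ((q +++ reversepath c) +++ c))"
    by (rule homotopic_paths_sym, rule homotopic_paths_assoc) (use assms in \<open>auto simp: path_image_join\<close>)
  also have "homotopic_paths S \<dots> (c +++ (q +++ (reversepath c +++ c)))"
    by (intro homotopic_paths_join homotopic_paths_sym[OF homotopic_paths_assoc])
      (use assms in \<open>auto simp: path_image_join\<close>)
  also have "homotopic_paths S \<dots> (c +++ (q +++ linepath (pathfinish q) (pathfinish q)))"
    using homotopic_paths_linv[of c S] assms by (intro homotopic_paths_join) (auto simp: path_image_join)
  also have "homotopic_paths S \<dots> (c +++ q)"
    by (intro homotopic_paths_join homotopic_paths_rid) (use assms in auto)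
  finally have h: "homotopic_paths S ((c +++ (q +++ reversepath c)) +++ c) (c +++ q)" .
  have "homotopic_paths S (reversepath c +++ ((c +++ (q +++ reversepath c)) +++ c)) (reversepath c +++ (c +++ q))"
    by (rule homotopic_paths_join[OF _ h]) (use assms in auto)
  also have "homotopic_paths S \<dots> q" by (rule homotopic_paths_cancel_left) (use assms in auto)
  finally show ?thesis .
qed

lemma path_near:
  fixes g :: "real \<Rightarrow> 'a::topological_space"
  assumes "path g" "x \<in> {0..1}" "open T" "g x \<in> T"
  shows "\<exists>d>0. \<forall>t\<in>{0..1}. \<bar>t - x\<bar> < d \<longrightarrow> g t \<in> T"
proof -
  have "continuous_on {0..1} g" using assms by (simp add: path_def)
  then have "\<forall>\<^sub>F t in at x within {0..1}. g t \<in> T"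
    using assms unfolding continuous_on_def by (auto dest!: topological_tendstoD[of g _ _ T])
  then obtain d where d: "d > 0" "\<And>t. t \<in> {0..1} \<Longrightarrow> t \<noteq> x \<Longrightarrow> dist t x < d \<Longrightarrow> g t \<in> T"
    unfolding eventually_at by blast
  then show ?thesis using assms(4) by (intro exI[of _ d]) (auto simp: dist_real_def, metis)
qed

section \<open>Edge paths spelled by words\<close>

locale bipartite_complex = bipartite_coxeter m L + polygon_space m "bip_edges L"
  for m :: nat and L :: "vertex pair_pre_digraph" +
  assumes x_edge: "Xv i \<in> pverts L \<Longrightarrow> \<exists>j. (i, j) \<in> bip_edges L"
    and y_edge: "Yv j \<in> pverts L \<Longrightarrow> \<exists>i. (i, j) \<in> bip_edges L"
    and E_ne: "bip_edges L \<noteq> {}"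
begin

abbreviation E where "E \<equiv> bip_edges L"

lemma continuous_on_embed: "continuous_on A (embed e)"
  by (rule continuous_embed[OF continuous_on_id])

lemma edge_at: assumes "v \<in> pverts L" shows "\<exists>i j. (i, j) \<in> E \<and> v \<in> {Xv i, Yv j}"
  using assms x_edge y_edge by (cases v) blast+

text \<open>Sides of even index carry \<open>x\<close>-labels, those of odd index
  \<open>y\<close>-labels; so \<open>x\<close> leads up from an even corner and down from an odd
  one, and \<open>y\<close> the other way round.\<close>

definition step :: "vertex \<Rightarrow> int \<Rightarrow> int" where
  "step v k = k + (if even k then letter_shift v else - letter_shift v)"

definition endpt :: "vertex gword \<Rightarrow> int \<Rightarrow> int" where
  "endpt w k = k + (if even k then shift w else - shift w)"

lemma endpt_Nil [simp]: "endpt [] k = k"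
  by (simp add: endpt_def)

lemma endpt_Cons: "endpt (x # w) k = endpt w (step (fst x) k)"
  by (simp add: endpt_def step_def)

lemma endpt_append: "endpt (u @ w) k = endpt w (endpt u k)"
  by (induction u arbitrary: k) (simp_all add: endpt_Cons)

lemma step_cong: "[k = l] (mod period) \<Longrightarrow> [step v k = step v l] (mod period)"
  using even_mod_period[of k l] by (auto simp: step_def intro: cong_add cong_diff)

lemma endpt_cong: "[k = l] (mod period) \<Longrightarrow> [endpt w k = endpt w l] (mod period)"
  using even_mod_period[of k l] by (auto simp: endpt_def intro: cong_add cong_diff)

lemma endpt_shift_cong: "[shift u = shift w] (mod period) \<Longrightarrow> [endpt u k = endpt w k] (mod period)"
  by (auto simp: endpt_def intro: cong_add cong_diff)

definition vtx :: "int \<Rightarrow> complex \<times> real \<times> real" where "vtx k = (corner k, 0, 0)"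

lemma vtx_cong: "[k = l] (mod period) \<Longrightarrow> vtx k = vtx l"
  using corner_cong by (simp add: vtx_def)

lemma embed_corner_vtx: "embed e (corner k) = vtx k"
  by (simp add: vtx_def embed_corner)

definition side_path :: "vertex \<Rightarrow> int \<Rightarrow> real \<Rightarrow> complex" where
  "side_path v k = linepath (corner k) (corner (step v k))"

text \<open>The index set to \<open>0\<close> is immaterial, as its weight vanishes along the side
  (\<open>edge_path_eq\<close>); the pair need not be an edge of \<open>L\<close>. In this way an
  edge path depends on the label alone.\<close>

fun vertex_code :: "vertex \<Rightarrow> nat \<times> nat" where
  "vertex_code (Xv i) = (i, 0)"
| "vertex_code (Yv j) = (0, j)"

definition edge_path :: "vertex \<Rightarrow> int \<Rightarrow> real \<Rightarrow> complex \<times> real \<times> real" where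
  "edge_path v k = embed (vertex_code v) \<circ> side_path v k"

fun word_path :: "int \<Rightarrow> vertex gword \<Rightarrow> real \<Rightarrow> complex \<times> real \<times> real" where
  "word_path k [] = linepath (vtx k) (vtx k)"
| "word_path k (x # w) = edge_path (fst x) k +++ word_path (step (fst x) k) w"

fun boundary_path :: "int \<Rightarrow> vertex gword \<Rightarrow> real \<Rightarrow> complex" where
  "boundary_path k [] = linepath (corner k) (corner k)"
| "boundary_path k (x # w) = side_path (fst x) k +++ boundary_path (step (fst x) k) w"

lemma embed_side_eq:
  assumes "side_dist l z = 0"
  shows "even l \<Longrightarrow> embed (i, j) z = embed (i, j') z" "odd l \<Longrightarrow> embed (i, j) z = embed (i', j) z"
  using assms x_weight_eq_0_iff[of z] y_weight_eq_0_iff[of z] by (auto simp: embed_def)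

lemma side_dist_side_path:
  "side_dist (min k (step v k)) (side_path v k t) = 0"
proof -
  have *: "side_dist (min k l) (linepath (corner k) (corner l) t) = 0" if "l = k + 1 \<or> l = k - 1" for l
    using that side_dist_corner_0(1)[of "min k l"] side_dist_corner_0(2)[of "min k l"]
    by (auto simp: linepath_def side_dist_linepath)
  show ?thesis unfolding side_path_def
    by (rule *) (use letter_shift_cases[of v] in \<open>auto simp: step_def\<close>)
qed

lemma edge_path_eq:
  assumes "v \<in> {Xv i, Yv j}" shows "edge_path v k = embed (i, j) \<circ> side_path v k"
proof
  fix t
  have s: "side_dist (min k (step v k)) (side_path v k t) = 0" by (rule side_dist_side_path)
  have "v = Xv i \<Longrightarrow> even (min k (step v k))" "v = Yv j \<Longrightarrow> odd (min k (step v k))"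
    by (auto simp: step_def min_def)
  then show "edge_path v k t = (embed (i, j) \<circ> side_path v k) t"
    using assms embed_side_eq[OF s] by (auto simp: edge_path_def)
qed

lemma side_path_props [simp]:
  "path (side_path v k)" "pathstart (side_path v k) = corner k" "pathfinish (side_path v k) = corner (step v k)"
  by (simp_all add: side_path_def)

lemma side_path_image: "path_image (side_path v k) \<subseteq> P"
  unfolding side_path_def path_image_linepath
  by (rule closed_segment_subset[OF corner_in_P corner_in_P convex_P])

lemma path_image_embed:
  "e \<in> E \<Longrightarrow> path_image p \<subseteq> P \<Longrightarrow> path_image (embed e \<circ> p) \<subseteq> S"
  using embed_in_S[of e] unfolding path_image_compose by blast

lemma path_embed [simp]: "path p \<Longrightarrow> path (embed e \<circ> p)"
  by (rule path_continuous_image[OF _ continuous_on_embed])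

lemma edge_path_props [simp]:
  "path (edge_path v k)" "pathstart (edge_path v k) = vtx k" "pathfinish (edge_path v k) = vtx (step v k)"
  by (simp_all add: edge_path_def pathstart_compose pathfinish_compose embed_corner_vtx)

lemma edge_path_image: "v \<in> pverts L \<Longrightarrow> path_image (edge_path v k) \<subseteq> S"
  using edge_at[of v] edge_path_eq path_image_embed[OF _ side_path_image] by metis

lemma pathstart_word_path [simp]: "pathstart (word_path k w) = vtx k"
  by (cases w) simp_all

lemma pathfinish_word_path [simp]: "pathfinish (word_path k w) = vtx (endpt w k)"
  by (induction w arbitrary: k) (simp_all add: endpt_Cons)

lemma path_word_path [simp]: "path (word_path k w)"
  by (induction w arbitrary: k) simp_all

lemma vtx_in_S: "vtx k \<in> S"
  using E_ne embed_in_S[OF _ corner_in_P] embed_corner_vtx by (metis ex_in_conv)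

lemma boundary_path_props [simp]:
  "path (boundary_path k w)" "pathstart (boundary_path k w) = corner k"
  "pathfinish (boundary_path k w) = corner (endpt w k)"
proof -
  show s: "pathstart (boundary_path k w) = corner k" for k w by (cases w) simp_all
  show "path (boundary_path k w)" "pathfinish (boundary_path k w) = corner (endpt w k)"
    by (induction w arbitrary: k) (simp_all add: endpt_Cons s)
qed

lemma boundary_path_image: "path_image (boundary_path k w) \<subseteq> P"
  by (induction w arbitrary: k) (simp_all add: path_image_join side_path_image corner_in_P)

lemma word_path_eq_boundary:
  "w \<in> lists ({Xv i, Yv j} \<times> UNIV) \<Longrightarrow> word_path k w = embed (i, j) \<circ> boundary_path k w"
proof (induction w arbitrary: k)
  case Nil
  show ?case by (auto simp: linepath_def embed_corner_vtx fun_eq_iff simp flip: scaleR_left_distrib)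
next
  case (Cons x w)
  then have x: "fst x \<in> {Xv i, Yv j}" by auto
  have "word_path (step (fst x) k) w = embed (i, j) \<circ> boundary_path (step (fst x) k) w"
    by (rule Cons.IH) (use Cons.prems in auto)
  then show ?case by (simp only: word_path.simps boundary_path.simps path_compose_join edge_path_eq[OF x])
qed

lemma homotopic_in_polygon:
  assumes "e \<in> E" "path p" "path q" "path_image p \<subseteq> P" "path_image q \<subseteq> P"
    "pathstart p = pathstart q" "pathfinish p = pathfinish q"
  shows "homotopic_paths S (embed e \<circ> p) (embed e \<circ> q)"
proof (rule homotopic_paths_continuous_image)
  show "homotopic_paths P p q"
  proof (rule homotopic_paths_linear)
    fix t :: real assume "t \<in> {0..1}"
    then show "closed_segment (p t) (q t) \<subseteq> P"
      using assms by (intro closed_segment_subset convex_P) (auto simp: path_image_def)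
  qed (use assms in auto)
  show "continuous_on P (embed e)" by (rule continuous_on_embed)
  show "embed e \<in> P \<rightarrow> S" using embed_in_S[OF assms(1)] by blast
qed

text \<open>Both words run along the boundary of one polygon to the same corner, and the polygon is
  convex.\<close>

lemma homotopic_edge_words:
  assumes e: "(i, j) \<in> E" and u: "u \<in> lists ({Xv i, Yv j} \<times> UNIV)" and w: "w \<in> lists ({Xv i, Yv j} \<times> UNIV)"
    and "[shift u = shift w] (mod period)"
  shows "homotopic_paths S (word_path k u) (word_path k w)"
  unfolding word_path_eq_boundary[OF u] word_path_eq_boundary[OF w]
  using corner_cong[OF endpt_shift_cong[OF assms(4), of k]]
  by (intro homotopic_in_polygon[OF e]) (simp_all add: boundary_path_image)

lemma word_path_cong: "[k = l] (mod period) \<Longrightarrow> word_path k w = word_path l w"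
proof (induction w arbitrary: k l)
  case Nil
  then show ?case using vtx_cong[OF Nil] by simp
next
  case (Cons x w)
  note s = step_cong[OF Cons.prems, of "fst x"]
  have "side_path (fst x) k = side_path (fst x) l"
    unfolding side_path_def using corner_cong[OF Cons.prems] corner_cong[OF s] by simp
  then show ?case using Cons.IH[OF s] by (simp add: edge_path_def)
qed

lemma word_path_image: "w \<in> words \<Longrightarrow> path_image (word_path k w) \<subseteq> S"
  by (induction w arbitrary: k) (simp_all add: path_image_join edge_path_image vtx_in_S)

lemma word_path_append:
  "u \<in> words \<Longrightarrow> w \<in> words \<Longrightarrow>
    homotopic_paths S (word_path k (u @ w)) (word_path k u +++ word_path (endpt u k) w)"
proof (induction u arbitrary: k)
  case Nil
  show ?case
    unfolding word_path.simps append_Nil endpt_Nil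
    by (rule homotopic_paths_sym, rule homotopic_paths_lid') (use Nil word_path_image in auto)
next
  case (Cons x u)
  have "homotopic_paths S (word_path k ((x # u) @ w))
    (edge_path (fst x) k +++ (word_path (step (fst x) k) u +++ word_path (endpt u (step (fst x) k)) w))"
    using Cons edge_path_image by (auto intro!: homotopic_paths_join)
  also have "homotopic_paths S \<dots> ((edge_path (fst x) k +++ word_path (step (fst x) k) u) +++ word_path (endpt u (step (fst x) k)) w)"
    by (rule homotopic_paths_assoc) (use Cons.prems edge_path_image word_path_image in auto)
  finally show ?case by (simp add: endpt_Cons)
qed

text \<open>Each defining relation lives in a single polygon; a relation in one letter
  \<open>v\<close> borrows any polygon with sides labelled by \<open>v\<close>.\<close>

lemma word_path_pcong: "(u, w) \<in> pcong \<Longrightarrow> homotopic_paths S (word_path k u) (word_path k w)"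
proof (induction arbitrary: k rule: pres_cong.induct)
  case (pres_refl w)
  then show ?case using word_path_image by simp
next
  case (pres_sym v w)
  then show ?case using homotopic_paths_sym by blast
next
  case (pres_trans u v w)
  then show ?case using homotopic_paths_trans by blast
next
  case (pres_append u u' v v')
  have [simp]: "u \<in> words" "u' \<in> words" "v \<in> words" "v' \<in> words"
    using pres_append.hyps pres_cong_subset by blast+
  have e: "[endpt u k = endpt u' k] (mod period)"
    by (rule endpt_shift_cong[OF shift_pcong[OF pres_append.hyps(1)]])
  have "homotopic_paths S (word_path k (u @ v)) (word_path k u +++ word_path (endpt u k) v)"
    by (simp add: word_path_append)
  also have "homotopic_paths S \<dots> (word_path k u' +++ word_path (endpt u k) v')"
    by (rule homotopic_paths_join) (use pres_append.IH in auto)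
  also have "word_path (endpt u k) v' = word_path (endpt u' k) v'" by (rule word_path_cong[OF e])
  also have "homotopic_paths S (word_path k u' +++ word_path (endpt u' k) v') (word_path k (u' @ v'))"
    by (rule homotopic_paths_sym) (simp add: word_path_append)
  finally show ?case .
next
  case (pres_cancel a b)
  obtain i j where ij: "(i, j) \<in> E" "a \<in> {Xv i, Yv j}" using edge_at[OF pres_cancel] by blast
  show ?case by (rule homotopic_edge_words[OF ij(1)]) (use ij in auto)
next
  case (pres_relator r)
  then consider v where "v \<in> pverts L" "r = [(v, True), (v, True)]"
    | i j where "(i, j) \<in> E" "r = concat (replicate m [(Xv i, True), (Yv j, True)])"
    by (auto simp: coxeter_relators_def)
  then show ?case
  proof cases
    case 1
    obtain i j where ij: "(i, j) \<in> E" "v \<in> {Xv i, Yv j}" using edge_at[OF 1(1)] by blast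
    show ?thesis by (rule homotopic_edge_words[OF ij(1)]) (use ij 1 in auto)
  next
    case 2
    show ?thesis
    proof (rule homotopic_edge_words[OF 2(1)])
      show "r \<in> lists ({Xv i, Yv j} \<times> UNIV)" using 2(2) by (auto simp: in_lists_conv_set)
      show "[shift r = shift []] (mod period)" by (simp add: 2(2) shift_concat_replicate cong_iff_dvd_diff)
    qed simp
  qed
qed

text \<open>An arbitrary choice suffices, since a contractible star is simply connected and all such
  paths are homotopic.\<close>

definition radius :: "int \<Rightarrow> complex \<times> real \<times> real \<Rightarrow> real \<Rightarrow> complex \<times> real \<times> real" where
  "radius k p = (SOME g. path g \<and> path_image g \<subseteq> star k \<and> pathstart g = p \<and> pathfinish g = vtx k)"

lemma vtx_in_star: "vtx k \<in> star k"
  using vtx_in_S[of k] in_star_corner[of k] by (simp add: star_def vtx_def)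

lemma radius:
  assumes "p \<in> star k"
  shows "path (radius k p)" "path_image (radius k p) \<subseteq> star k"
    "pathstart (radius k p) = p" "pathfinish (radius k p) = vtx k"
proof -
  have "path_connected (star k)" by (rule contractible_imp_path_connected[OF contractible_star])
  then have "\<exists>g. path g \<and> path_image g \<subseteq> star k \<and> pathstart g = p \<and> pathfinish g = vtx k"
    using assms vtx_in_star unfolding path_connected_def by blast
  from someI_ex[OF this] show "path (radius k p)" "path_image (radius k p) \<subseteq> star k"
    "pathstart (radius k p) = p" "pathfinish (radius k p) = vtx k"
    by (simp_all add: radius_def)
qed

lemma radius_image: "p \<in> star k \<Longrightarrow> path_image (radius k p) \<subseteq> S"
  using radius(2) star_subset by blast

lemma homotopic_in_star:
  assumes "path p" "path_image p \<subseteq> star k" "path q" "path_image q \<subseteq> star k"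
    "pathstart p = pathstart q" "pathfinish p = pathfinish q"
  shows "homotopic_paths S p q"
  by (rule homotopic_paths_eq_simply_connected[OF contractible_imp_simply_connected[OF contractible_star] star_subset])
    (use assms in auto)

lemma radius_linepath:
  assumes "e \<in> E" "z \<in> P" "embed e z \<in> star k"
  shows "homotopic_paths S (radius k (embed e z)) (embed e \<circ> linepath z (corner k))"
proof (rule homotopic_in_star)
  have z: "in_star k z" using assms(3) by (simp add: star_def)
  show "path_image (embed e \<circ> linepath z (corner k)) \<subseteq> star k"
  proof -
    have "linepath z (corner k) t \<in> P \<and> in_star k (linepath z (corner k) t)" if "t \<in> {0..1}" for t
      using in_star_side[OF assms(2) z that] convexD_alt[OF convex_P assms(2) corner_in_P, of t] that
      by (simp add: linepath_def)
    then show ?thesis using embed_in_S[OF assms(1)]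
      by (auto simp: path_image_def star_def simp del: split_paired_All)
  qed
  show "pathfinish (radius k (embed e z)) = pathfinish (embed e \<circ> linepath z (corner k))"
    using radius[OF assms(3)] by (simp add: pathfinish_compose embed_corner_vtx)
qed (use radius[OF assms(3)] in \<open>simp_all add: pathstart_compose\<close>)

text \<open>In one polygon containing \<open>p\<close>, convexity deforms the segment to corner
  \<open>l\<close> into the segment to corner \<open>k\<close> followed by a walk along the
  boundary.\<close>

lemma radius_change:
  assumes p: "p \<in> star k" "p \<in> star l"
  shows "\<exists>w\<in>words. endpt w k = l \<and> homotopic_paths S (radius l p) (radius k p +++ word_path k w)"
proof -
  obtain e z where ez: "e \<in> E" "z \<in> P" "p = embed e z" using p by (auto simp: star_def S_def)
  obtain i j where e: "e = (i, j)" by force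
  \<comment> \<open>The sign is reversed for odd \<open>k\<close> because \<open>endpt\<close>
    subtracts the shift there.\<close>
  obtain w where w: "w \<in> lists ({Xv i, Yv j} \<times> UNIV)" "shift w = (if even k then l - k else k - l)"
    using ex_edge_word by blast
  have ww: "w \<in> words" using cls_eq_dih[OF ez(1)[unfolded e] w(1)] by simp
  have el: "endpt w k = l" using w(2) by (auto simp: endpt_def)
  have "homotopic_paths S (radius l p) (embed e \<circ> linepath z (corner l))"
    using radius_linepath ez p by blast
  also have "homotopic_paths S \<dots> (embed e \<circ> (linepath z (corner k) +++ boundary_path k w))"
    by (rule homotopic_in_polygon[OF ez(1)])
      (use ez(2) el corner_in_P closed_segment_subset[OF _ _ convex_P] boundary_path_image in \<open>auto simp: path_image_join\<close>)
  also have "\<dots> = (embed e \<circ> linepath z (corner k)) +++ word_path k w"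
    unfolding word_path_eq_boundary[OF w(1)] e by (rule path_compose_join)
  also have "homotopic_paths S \<dots> (radius k p +++ word_path k w)"
    by (rule homotopic_paths_join[OF homotopic_paths_sym])
      (use radius_linepath ez p word_path_image[OF ww] in \<open>auto simp: pathfinish_compose embed_corner_vtx\<close>)
  finally show ?thesis using ww el by blast
qed

lemma radius_change_reverse:
  assumes p: "p \<in> star k" "p \<in> star l"
  shows "\<exists>w\<in>words. endpt w k = l \<and>
    homotopic_paths S (reversepath (radius k p)) (word_path k w +++ reversepath (radius l p))"
proof -
  obtain w where w: "w \<in> words" "endpt w k = l" "homotopic_paths S (radius l p) (radius k p +++ word_path k w)"
    using radius_change[OF p] by blast
  have [simp]: "path (radius k p)" "path (radius l p)" "pathfinish (radius k p) = vtx k"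
     "pathfinish (radius l p) = vtx l" "pathstart (radius k p) = p" "pathstart (radius l p) = p"
    using radius p by auto
  note im = radius_image[OF p(1)] radius_image[OF p(2)] word_path_image[OF w(1), of k]
  have "homotopic_paths S (word_path k w) (reversepath (radius k p) +++ (radius k p +++ word_path k w))"
    by (rule homotopic_paths_sym, rule homotopic_paths_cancel_left) (use im in auto)
  also have "homotopic_paths S \<dots> (reversepath (radius k p) +++ radius l p)"
    by (rule homotopic_paths_join[OF _ homotopic_paths_sym[OF w(3)]]) (use im in auto)
  finally have "homotopic_paths S (word_path k w +++ reversepath (radius l p))
      ((reversepath (radius k p) +++ radius l p) +++ reversepath (radius l p))"
    by (rule homotopic_paths_join) (use im w in auto)
  also have "homotopic_paths S \<dots> (reversepath (radius k p) +++ (radius l p +++ reversepath (radius l p)))"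
    by (rule homotopic_paths_sym, rule homotopic_paths_assoc) (use im in auto)
  also have "homotopic_paths S \<dots> (reversepath (radius k p) +++ linepath p p)"
    using homotopic_paths_rinv[of "radius l p" S] im by (intro homotopic_paths_join) auto
  also have "homotopic_paths S \<dots> (reversepath (radius k p))"
    by (rule homotopic_paths_rid') (use im in auto)
  finally show ?thesis using w homotopic_paths_sym by blast
qed

lemma eventually_star:
  assumes g: "path g" "path_image g \<subseteq> S" and x: "x \<in> {0..1}" "g x \<in> star k"
  shows "\<exists>d>0. \<forall>t\<in>{0..1}. \<bar>t - x\<bar> < d \<longrightarrow> g t \<in> star k"
proof -
  obtain T where T: "open T" "star k = S \<inter> T" using openin_star[of k] by (auto simp: openin_open)
  then show ?thesis using path_near[OF g(1) x(1) T(1)] x(2) g(2) by (fastforce simp: path_image_def)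
qed

lemma path_decomposition:
  assumes g: "path g" "path_image g \<subseteq> S"
    and "g 0 \<in> star k" "g 1 \<in> star l"
  shows "\<exists>w\<in>words. [endpt w k = l] (mod period) \<and>
    homotopic_paths S g (radius k (g 0) +++ (word_path k w +++ reversepath (radius l (g 1))))"
proof -
  \<comment> \<open>Quantifying over the stars at both ends allows adjacent pieces to be glued at
    any common star of the middle point.\<close>
  define Q where "Q = (\<lambda>a b. 0 \<le> a \<longrightarrow> a \<le> b \<longrightarrow> b \<le> 1 \<longrightarrow> (\<forall>k l. g a \<in> star k \<longrightarrow> g b \<in> star l \<longrightarrow>
    (\<exists>w\<in>words. [endpt w k = l] (mod period) \<and>
    homotopic_paths S (subpath a b g) (radius k (g a) +++ (word_path k w +++ reversepath (radius l (g b)))))))"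
  have gS: "g t \<in> S" if "0 \<le> t" "t \<le> 1" for t using g that by (auto simp: path_image_def)
  have "(0::real) \<le> 1" by simp
  then have "Q 0 1"
  proof (induction rule: Bolzano)
    case (trans a b c)
    show ?case unfolding Q_def
    proof (intro impI allI)
      fix k l assume *: "0 \<le> a" "a \<le> c" "c \<le> 1" "g a \<in> star k" "g c \<in> star l"
      obtain r where r: "g b \<in> star r" using ex_star[OF gS[of b]] trans * by auto
      obtain u where u: "u \<in> words" "[endpt u k = r] (mod period)"
        "homotopic_paths S (subpath a b g) (radius k (g a) +++ (word_path k u +++ reversepath (radius r (g b))))"
        using trans * r unfolding Q_def by force
      obtain v where v: "v \<in> words" "[endpt v r = l] (mod period)"
        "homotopic_paths S (subpath b c g) (radius r (g b) +++ (word_path r v +++ reversepath (radius l (g c))))"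
        using trans * r unfolding Q_def by force
      have wr: "word_path r v = word_path (endpt u k) v" using word_path_cong[OF u(2)] by simp
      have vr: "vtx (endpt u k) = vtx r" by (rule vtx_cong[OF u(2)])
      have vl: "vtx (endpt v r) = vtx l" by (rule vtx_cong[OF v(2)])
      have vl': "vtx (endpt v (endpt u k)) = vtx l"
        using vtx_cong[OF endpt_cong[OF u(2), of v]] vl by simp
      note rad = radius[OF *(4)] radius[OF *(5)] radius[OF r]
      note im = radius_image[OF *(4)] radius_image[OF *(5)] radius_image[OF r]
        word_path_image[OF u(1), of k] word_path_image[OF v(1), of r]
      have "homotopic_paths S (subpath a c g) (subpath a b g +++ subpath b c g)"
        by (rule homotopic_paths_sym, rule homotopic_join_subpaths) (use g trans * in auto)
      also have "homotopic_paths S \<dots> ((radius k (g a) +++ (word_path k u +++ reversepath (radius r (g b)))) +++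
          (radius r (g b) +++ (word_path r v +++ reversepath (radius l (g c)))))"
        by (rule homotopic_paths_join[OF u(3) v(3)]) simp
      also have "homotopic_paths S \<dots> (radius k (g a) +++ ((word_path k u +++ word_path r v) +++ reversepath (radius l (g c))))"
        by (rule homotopic_paths_cancel_middle) (use rad im vr vl in auto)
      also have "homotopic_paths S \<dots> (radius k (g a) +++ (word_path k (u @ v) +++ reversepath (radius l (g c))))"
        using homotopic_paths_sym[OF word_path_append[OF u(1) v(1), of k]] rad im vr vl'
        unfolding wr by (intro homotopic_paths_join) auto
      finally have "homotopic_paths S (subpath a c g)
        (radius k (g a) +++ (word_path k (u @ v) +++ reversepath (radius l (g c))))" .
      moreover have "[endpt (u @ v) k = l] (mod period)"
        unfolding endpt_append using endpt_cong[OF u(2), of v] v(2) cong_trans by blast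
      ultimately show "\<exists>w\<in>words. [endpt w k = l] (mod period) \<and>
        homotopic_paths S (subpath a c g) (radius k (g a) +++ (word_path k w +++ reversepath (radius l (g c))))"
        using u v by (intro bexI[of _ "u @ v"]) auto
    qed
  next
    \<comment> \<open>Near \<open>x\<close> the path stays in one star \<open>r\<close> and is
      homotopic to a radius and a reversed radius there; these are then exchanged for the prescribed
      stars \<open>k\<close> and \<open>l\<close>.\<close>
    case (local x)
    then have x: "x \<in> {0..1}" by simp
    obtain r where r: "g x \<in> star r" using ex_star[OF gS[of x]] x by auto
    obtain d where d: "d > 0" "\<And>t. t \<in> {0..1} \<Longrightarrow> \<bar>t - x\<bar> < d \<Longrightarrow> g t \<in> star r"
      using eventually_star[OF g x r] by blast
    show ?case
    proof (intro exI[of _ d] conjI allI impI)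
      show "0 < d" by (rule d)
      fix a b assume ab: "a \<le> x \<and> x \<le> b \<and> b - a < d"
      show "Q a b" unfolding Q_def
      proof (intro impI allI)
        fix k l assume *: "0 \<le> a" "a \<le> b" "b \<le> 1" "g a \<in> star k" "g b \<in> star l"
        have st: "g t \<in> star r" if "a \<le> t" "t \<le> b" for t
          by (rule d(2)) (use that ab * in auto)
        have ra: "g a \<in> star r" and rb: "g b \<in> star r" using st * by auto
        obtain u where u: "u \<in> words" "endpt u k = r"
          "homotopic_paths S (radius r (g a)) (radius k (g a) +++ word_path k u)"
          using radius_change[OF *(4) ra] by blast
        obtain v where v: "v \<in> words" "endpt v r = l"
          "homotopic_paths S (reversepath (radius r (g b))) (word_path r v +++ reversepath (radius l (g b)))"
          using radius_change_reverse[OF rb *(5)] by blast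
        note rad = radius[OF *(4)] radius[OF *(5)] radius[OF ra] radius[OF rb]
        note im = radius_image[OF *(4)] radius_image[OF *(5)]
          word_path_image[OF u(1), of k] word_path_image[OF v(1), of r]
        have "homotopic_paths S (subpath a b g) (radius r (g a) +++ reversepath (radius r (g b)))"
        proof (rule homotopic_in_star)
          show "path (subpath a b g)" using g * by simp
          show "path_image (subpath a b g) \<subseteq> star r"
            using st * by (auto simp: path_image_subpath)
          show "path_image (radius r (g a) +++ reversepath (radius r (g b))) \<subseteq> star r"
            using rad by (auto simp: path_image_join)
        qed (use rad in auto)
        also have "homotopic_paths S \<dots> ((radius k (g a) +++ word_path k u) +++ (word_path r v +++ reversepath (radius l (g b))))"
          by (rule homotopic_paths_join[OF u(3) v(3)]) (use rad in auto)
        also have "homotopic_paths S \<dots> (radius k (g a) +++ (word_path k u +++ (word_path r v +++ reversepath (radius l (g b)))))"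
          by (rule homotopic_paths_sym, rule homotopic_paths_assoc) (use rad im u v in \<open>auto simp: path_image_join\<close>)
        also have "homotopic_paths S \<dots> (radius k (g a) +++ ((word_path k u +++ word_path r v) +++ reversepath (radius l (g b))))"
          using rad im u v by (intro homotopic_paths_join homotopic_paths_assoc) (auto simp: path_image_join)
        also have "homotopic_paths S \<dots> (radius k (g a) +++ (word_path k (u @ v) +++ reversepath (radius l (g b))))"
          using homotopic_paths_sym[OF word_path_append[OF u(1) v(1), of k]] rad im u v
          by (intro homotopic_paths_join) auto
        finally have "homotopic_paths S (subpath a b g)
          (radius k (g a) +++ (word_path k (u @ v) +++ reversepath (radius l (g b))))" .
        moreover have "endpt (u @ v) k = l" using u v by (simp add: endpt_append)
        ultimately show "\<exists>w\<in>words. [endpt w k = l] (mod period) \<and>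
          homotopic_paths S (subpath a b g) (radius k (g a) +++ (word_path k w +++ reversepath (radius l (g b))))"
          using u v by (intro bexI[of _ "u @ v"]) auto
      qed
    qed
  qed
  then show ?thesis using assms unfolding Q_def by (simp add: subpath_trivial)
qed

section \<open>Holonomy\<close>

text \<open>An arbitrary choice that jumps where polygons are glued; each index is locally constant
  only where its weight does not vanish.\<close>

definition cell_of :: "complex \<times> real \<times> real \<Rightarrow> nat \<times> nat" where
  "cell_of p = (SOME e. e \<in> E \<and> p \<in> embed e ` P)"

lemma cell_of: assumes "p \<in> S" shows "cell_of p \<in> E" "embed (cell_of p) (fst p) = p"
proof -
  have "\<exists>e. e \<in> E \<and> p \<in> embed e ` P" using assms by (auto simp: S_def)
  from someI_ex[OF this] have *: "cell_of p \<in> E" "p \<in> embed (cell_of p) ` P"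
    by (simp_all only: cell_of_def)
  from *(2) obtain z where "p = embed (cell_of p) z" by blast
  then show "cell_of p \<in> E" "embed (cell_of p) (fst p) = p" using *(1) by (metis fst_embed)+
qed

lemma cell_of_coordinates:
  assumes "p \<in> S"
  shows "fst (snd p) = x_weight (fst p) * real (fst (cell_of p))"
    "snd (snd p) = y_weight (fst p) * real (snd (cell_of p))"
  using arg_cong[OF cell_of(2)[OF assms], of "\<lambda>q. fst (snd q)"]
    arg_cong[OF cell_of(2)[OF assms], of "\<lambda>q. snd (snd q)"] by (simp_all add: embed_def)

text \<open>Coordinate divided by weight recovers the index as a continuous function with natural
  numbers as values.\<close>

lemma cell_of_x_locally_constant:
  assumes p: "p \<in> S" "x_weight (fst p) \<noteq> 0"
  shows "\<exists>T. open T \<and> p \<in> T \<and> (\<forall>q\<in>S \<inter> T. fst (cell_of q) = fst (cell_of p))"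
proof -
  let ?f = "\<lambda>q. fst (snd q) / x_weight (fst q)"
  let ?U = "{q :: complex \<times> real \<times> real. x_weight (fst q) \<noteq> 0}"
  have U: "open ?U" by (intro open_Collect_neq continuous_intros)
  have f: "?f q = real (fst (cell_of q))" if "q \<in> S" "q \<in> ?U" for q
    using cell_of_coordinates[OF that(1)] that(2) by simp
  have "continuous_on ?U ?f" by (intro continuous_intros) auto
  then have "open (?U \<inter> ?f -` ball (?f p) 1)" by (rule continuous_open_preimage[OF _ U]) simp
  moreover have "fst (cell_of q) = fst (cell_of p)" if "q \<in> S" "q \<in> ?U \<inter> ?f -` ball (?f p) 1" for q
    using that f[of q] f[OF p(1)] p(2) by (auto simp: dist_real_def)
  ultimately show ?thesis using p(2) by (intro exI[of _ "?U \<inter> ?f -` ball (?f p) 1"]) auto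
qed

lemma cell_of_y_locally_constant:
  assumes p: "p \<in> S" "y_weight (fst p) \<noteq> 0"
  shows "\<exists>T. open T \<and> p \<in> T \<and> (\<forall>q\<in>S \<inter> T. snd (cell_of q) = snd (cell_of p))"
proof -
  let ?f = "\<lambda>q. snd (snd q) / y_weight (fst q)"
  let ?U = "{q :: complex \<times> real \<times> real. y_weight (fst q) \<noteq> 0}"
  have U: "open ?U" by (intro open_Collect_neq continuous_intros)
  have f: "?f q = real (snd (cell_of q))" if "q \<in> S" "q \<in> ?U" for q
    using cell_of_coordinates[OF that(1)] that(2) by simp
  have "continuous_on ?U ?f" by (intro continuous_intros) auto
  then have "open (?U \<inter> ?f -` ball (?f p) 1)" by (rule continuous_open_preimage[OF _ U]) simp
  moreover have "snd (cell_of q) = snd (cell_of p)" if "q \<in> S" "q \<in> ?U \<inter> ?f -` ball (?f p) 1" for q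
    using that f[of q] f[OF p(1)] p(2) by (auto simp: dist_real_def)
  ultimately show ?thesis using p(2) by (intro exI[of _ "?U \<inter> ?f -` ball (?f p) 1"]) auto
qed

text \<open>The element read along the boundary of \<open>e\<close> from corner \<open>k\<close> to
  corner \<open>l\<close>: the transition function between the trivialisations of the flat bundle
  over two stars.\<close>

definition transition :: "int \<Rightarrow> int \<Rightarrow> nat \<times> nat \<Rightarrow> vertex gword set" where
  "transition k l e = inv\<^bsub>W\<^esub> (dih e k) \<cdot> dih e l"

lemma dih_E_closed [simp]: "e \<in> E \<Longrightarrow> dih e k \<in> carrier W"
  using dih_closed[of "fst e" "snd e"] by simp

lemma transition_mult:
  "e \<in> E \<Longrightarrow> g \<in> carrier W \<Longrightarrow> g \<cdot> dih e k \<cdot> transition k l e = g \<cdot> dih e l"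
  by (simp add: transition_def W.m_assoc)

lemma transition_inv: "e \<in> E \<Longrightarrow> transition l k e = inv\<^bsub>W\<^esub> transition k l e"
  by (simp add: transition_def W.inv_mult_group)

lemma dih_E_cong: "e \<in> E \<Longrightarrow> [k = l] (mod period) \<Longrightarrow> dih e k = dih e l"
  using dih_cong[of "fst e" "snd e"] by simp

lemma transition_Suc:
  assumes "e \<in> E" "[l = k + 1] (mod period)"
  shows "transition k l e = gen (if even k then Xv (fst e) else Yv (snd e))"
proof -
  have "Xv (fst e) \<in> pverts L" "Yv (snd e) \<in> pverts L" using edge_verts[of "fst e" "snd e"] assms by simp_all
  then show ?thesis using dih_Suc[of "fst e" "snd e" k] dih_E_cong[OF assms] assms(1)
    by (simp add: transition_def)
qed

lemma weights_in_two_stars: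
  assumes "p \<in> star k" "p \<in> star (k + 1)"
  shows "even k \<Longrightarrow> x_weight (fst p) \<noteq> 0" "odd k \<Longrightarrow> y_weight (fst p) \<noteq> 0"
proof -
  have *: "[s = k] (mod period)" if "side_dist s (fst p) = 0" for s
    using star_inter_side[OF _ _ that] assms by (simp add: star_def)
  show "even k \<Longrightarrow> x_weight (fst p) \<noteq> 0" "odd k \<Longrightarrow> y_weight (fst p) \<noteq> 0"
    unfolding x_weight_eq_0_iff y_weight_eq_0_iff using * even_mod_period by blast+
qed

text \<open>For adjacent corners the transition is one generator, and the two stars together avoid
  the sides on which its index is forgotten. Other distinct corners have stars meeting only in
  interiors of polygons, where the polygon itself is locally constant.\<close>

lemma transition_locally_constant:
  assumes k: "p \<in> star k" and l: "p \<in> star l"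
  shows "\<exists>T. open T \<and> p \<in> T \<and> (\<forall>q\<in>S \<inter> T. transition k l (cell_of q) = transition k l (cell_of p))"
proof -
  have pS: "p \<in> S" using k star_subset by blast
  have next_star: "\<exists>T. open T \<and> p \<in> T \<and> (\<forall>q\<in>S \<inter> T. transition k l (cell_of q) = transition k l (cell_of p))"
    if k: "p \<in> star k" and l: "p \<in> star l" and kl: "[l = k + 1] (mod period)" for k l
  proof -
    have l': "p \<in> star (k + 1)" using l star_cong[OF kl] by simp
    show ?thesis
    proof (cases "even k")
      case True
      obtain T where T: "open T" "p \<in> T" "\<forall>q\<in>S \<inter> T. fst (cell_of q) = fst (cell_of p)"
        using cell_of_x_locally_constant[OF pS weights_in_two_stars(1)[OF k l' True]] by blast
      have "transition k l (cell_of q) = transition k l (cell_of p)" if "q \<in> S \<inter> T" for q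
        using transition_Suc[OF cell_of(1) kl, of q] transition_Suc[OF cell_of(1)[OF pS] kl] T(3) that True by simp
      with T show ?thesis by blast
    next
      case False
      obtain T where T: "open T" "p \<in> T" "\<forall>q\<in>S \<inter> T. snd (cell_of q) = snd (cell_of p)"
        using cell_of_y_locally_constant[OF pS weights_in_two_stars(2)[OF k l' False]] by blast
      have "transition k l (cell_of q) = transition k l (cell_of p)" if "q \<in> S \<inter> T" for q
        using transition_Suc[OF cell_of(1) kl, of q] transition_Suc[OF cell_of(1)[OF pS] kl] T(3) that False by simp
      with T show ?thesis by blast
    qed
  qed
  consider "[k = l] (mod period)" | "[l = k + 1] (mod period)" | "[k = l + 1] (mod period)"
    | "\<not> [k = l] (mod period)" "\<not> [l = k + 1] (mod period)" "\<not> [k = l + 1] (mod period)" by blast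
  then show ?thesis
  proof cases
    case 1
    then have "transition k l (cell_of q) = \<one>\<^bsub>W\<^esub>" if "q \<in> S" for q
      using cell_of(1)[OF that] dih_E_cong[OF _ 1, of "cell_of q"] by (simp add: transition_def)
    then show ?thesis using pS by (intro exI[of _ UNIV]) auto
  next
    case 2
    then show ?thesis by (rule next_star[OF k l])
  next
    case 3
    from next_star[OF l k this] obtain T where T: "open T" "p \<in> T"
      "\<forall>q\<in>S \<inter> T. transition l k (cell_of q) = transition l k (cell_of p)" by blast
    have "transition k l (cell_of q) = transition k l (cell_of p)" if "q \<in> S \<inter> T" for q
      using T(3) that transition_inv[OF cell_of(1)[OF pS], of k l] transition_inv[OF cell_of(1), of q k l] by simp
    then show ?thesis using T by blast
  next
    case 4
    \<comment> \<open>A side through \<open>p\<close> would be \<open>k\<close> or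
      \<open>k - 1\<close> and also \<open>l\<close> or \<open>l - 1\<close>; each combination makes
      \<open>k\<close> and \<open>l\<close> equal or adjacent modulo \<open>2m\<close>.\<close>
    have no: "side_dist s (fst p) \<noteq> 0" for s
    proof
      assume "side_dist s (fst p) = 0"
      then have "period dvd s - k \<or> period dvd s - (k - 1)" "period dvd s - l \<or> period dvd s - (l - 1)"
        using k l by (simp_all add: star_def in_star_def cong_iff_dvd_diff)
      moreover have "\<not> period dvd k - l" "\<not> period dvd l - (k + 1)" "\<not> period dvd k - (l + 1)"
        using 4 by (simp_all add: cong_iff_dvd_diff)
      moreover have "k - l = (s - l) - (s - k)" "k - l = (s - (l - 1)) - (s - (k - 1))"
        "l - (k + 1) = (s - k) - (s - (l - 1))" "k - (l + 1) = (s - l) - (s - (k - 1))" by simp_all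
      ultimately show False by (metis dvd_diff)
    qed
    have "x_weight (fst p) \<noteq> 0" "y_weight (fst p) \<noteq> 0"
      using no by (auto simp: x_weight_eq_0_iff y_weight_eq_0_iff)
    then obtain T T' where "open T" "p \<in> T" "\<forall>q\<in>S \<inter> T. fst (cell_of q) = fst (cell_of p)"
      "open T'" "p \<in> T'" "\<forall>q\<in>S \<inter> T'. snd (cell_of q) = snd (cell_of p)"
      using cell_of_x_locally_constant[OF pS] cell_of_y_locally_constant[OF pS] by blast
    then have "cell_of q = cell_of p" if "q \<in> S \<inter> (T \<inter> T')" for q
      using that by (intro prod_eqI) auto
    then show ?thesis using \<open>open T\<close> \<open>open T'\<close> \<open>p \<in> T\<close> \<open>p \<in> T'\<close>
      by (intro exI[of _ "T \<inter> T'"]) auto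
  qed
qed

text \<open>\<open>\<sigma> t\<close> is the value at \<open>g t\<close> of a section of the flat bundle, read at the vertex \<open>0\<close> of the chosen
  polygon containing \<open>g t\<close>; \<open>chart\<close> reads it at the vertex \<open>k\<close>, which is independent of the choice
  up to the transition functions.\<close>

definition chart :: "(real \<Rightarrow> vertex gword set) \<Rightarrow> (real \<Rightarrow> complex \<times> real \<times> real) \<Rightarrow> int \<Rightarrow> real \<Rightarrow> vertex gword set" where
  "chart \<sigma> g k t = \<sigma> t \<cdot> dih (cell_of (g t)) k"

text \<open>A flat section along the path. Local constancy is demanded of the charts and not of
  \<open>\<sigma>\<close>, whose values change with the jumps of \<open>cell_of\<close>.\<close>

definition horizontal :: "(real \<Rightarrow> complex \<times> real \<times> real) \<Rightarrow> (real \<Rightarrow> vertex gword set) \<Rightarrow> real \<Rightarrow> real \<Rightarrow> bool" where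
  "horizontal g \<sigma> a b \<longleftrightarrow> (\<forall>t\<in>{a..b}. \<sigma> t \<in> carrier W) \<and>
    (\<forall>t\<in>{a..b}. \<forall>k. g t \<in> star k \<longrightarrow>
      (\<exists>d>0. \<forall>s\<in>{a..b}. \<bar>s - t\<bar> < d \<longrightarrow> chart \<sigma> g k s = chart \<sigma> g k t))"

lemma chart_transition:
  "g t \<in> S \<Longrightarrow> \<sigma> t \<in> carrier W \<Longrightarrow>
    chart \<sigma> g l t = chart \<sigma> g k t \<cdot> transition k l (cell_of (g t))"
  by (simp add: chart_def transition_mult cell_of)

lemma horizontal_mono: "horizontal g \<sigma> a b \<Longrightarrow> a \<le> a' \<Longrightarrow> b' \<le> b \<Longrightarrow> horizontal g \<sigma> a' b'"
proof -
  assume *: "horizontal g \<sigma> a b" "a \<le> a'" "b' \<le> b"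
  then have sub: "{a'..b'} \<subseteq> {a..b}" by auto
  show ?thesis unfolding horizontal_def
  proof (intro conjI ballI allI impI)
    fix t assume "t \<in> {a'..b'}"
    then show "\<sigma> t \<in> carrier W" using * sub unfolding horizontal_def by blast
  next
    fix t k assume t: "t \<in> {a'..b'}" "g t \<in> star k"
    then obtain d where "d > 0" "\<forall>s\<in>{a..b}. \<bar>s - t\<bar> < d \<longrightarrow> chart \<sigma> g k s = chart \<sigma> g k t"
      using *(1) sub unfolding horizontal_def by blast
    then show "\<exists>d>0. \<forall>s\<in>{a'..b'}. \<bar>s - t\<bar> < d \<longrightarrow> chart \<sigma> g k s = chart \<sigma> g k t"
      using sub by blast
  qed
qed

text \<open>Transition functions are locally constant, so a single chart at each time
  suffices.\<close>

lemma horizontalI: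
  assumes g: "path g" "path_image g \<subseteq> S" and ab: "0 \<le> a" "b \<le> 1"
    and c: "\<And>t. t \<in> {a..b} \<Longrightarrow> \<sigma> t \<in> carrier W"
    and k: "\<And>t. t \<in> {a..b} \<Longrightarrow> \<exists>k. g t \<in> star k \<and> (\<exists>d>0. \<forall>s\<in>{a..b}. \<bar>s - t\<bar> < d \<longrightarrow> chart \<sigma> g k s = chart \<sigma> g k t)"
  shows "horizontal g \<sigma> a b"
  unfolding horizontal_def
proof (intro conjI ballI allI impI c)
  fix t l assume t: "t \<in> {a..b}" "g t \<in> star l"
  have gS: "g s \<in> S" if "s \<in> {a..b}" for s using g ab that by (auto simp: path_image_def)
  obtain k d where kd: "g t \<in> star k" "d > 0" "\<forall>s\<in>{a..b}. \<bar>s - t\<bar> < d \<longrightarrow> chart \<sigma> g k s = chart \<sigma> g k t"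
    using k[OF t(1)] by blast
  obtain T where T: "open T" "g t \<in> T"
    "\<forall>q\<in>S \<inter> T. transition k l (cell_of q) = transition k l (cell_of (g t))"
    using transition_locally_constant[OF kd(1) t(2)] by blast
  have "t \<in> {0..1}" using t ab by auto
  then obtain d' where d': "d' > 0" "\<forall>s\<in>{0..1}. \<bar>s - t\<bar> < d' \<longrightarrow> g s \<in> T"
    using path_near[OF g(1) _ T(1,2)] by blast
  show "\<exists>d>0. \<forall>s\<in>{a..b}. \<bar>s - t\<bar> < d \<longrightarrow> chart \<sigma> g l s = chart \<sigma> g l t"
  proof (intro exI[of _ "min d d'"] conjI ballI impI)
    fix s assume s: "s \<in> {a..b}" "\<bar>s - t\<bar> < min d d'"
    then have "g s \<in> S \<inter> T" using d' gS ab by auto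
    then have "transition k l (cell_of (g s)) = transition k l (cell_of (g t))" using T(3) by blast
    moreover have "chart \<sigma> g k s = chart \<sigma> g k t" using kd(3) s by simp
    moreover have "chart \<sigma> g l s' = chart \<sigma> g k s' \<cdot> transition k l (cell_of (g s'))" if "s' \<in> {a..b}" for s'
      by (rule chart_transition) (use gS c that in auto)
    ultimately show "chart \<sigma> g l s = chart \<sigma> g l t" using s(1) t(1) by simp
  qed (use kd d' in simp)
qed

lemma horizontal_chart_constant:
  assumes h: "horizontal g \<sigma> a b" and st: "\<And>t. t \<in> {a..b} \<Longrightarrow> g t \<in> star k"
    and xy: "x \<in> {a..b}" "y \<in> {a..b}"
  shows "chart \<sigma> g k x = chart \<sigma> g k y"
proof (rule connected_local_const[OF _ xy])
  show "\<forall>t\<in>{a..b}. \<forall>\<^sub>F s in at t within {a..b}. chart \<sigma> g k t = chart \<sigma> g k s"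
  proof
    fix t assume t: "t \<in> {a..b}"
    then obtain d where "d > 0" "\<forall>s\<in>{a..b}. \<bar>s - t\<bar> < d \<longrightarrow> chart \<sigma> g k s = chart \<sigma> g k t"
      using h st unfolding horizontal_def by blast
    then show "\<forall>\<^sub>F s in at t within {a..b}. chart \<sigma> g k t = chart \<sigma> g k s"
      unfolding eventually_at by (intro exI[of _ d]) (auto simp: dist_real_def)
  qed
qed simp

lemma ex_horizontal:
  assumes g: "path g" "path_image g \<subseteq> S" and c: "c \<in> carrier W"
  shows "\<exists>\<sigma>. horizontal g \<sigma> 0 1 \<and> \<sigma> 0 = c"
proof -
  define Q where "Q = (\<lambda>a b. 0 \<le> a \<longrightarrow> b \<le> 1 \<longrightarrow> a \<le> b \<longrightarrow>
    (\<forall>c\<in>carrier W. \<exists>\<sigma>. horizontal g \<sigma> a b \<and> \<sigma> a = c))"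
  have gS: "g t \<in> S" if "0 \<le> t" "t \<le> 1" for t using g that by (auto simp: path_image_def)
  have "(0::real) \<le> 1" by simp
  then have "Q 0 1"
  proof (induction rule: Bolzano)
    case (trans a b c)
    show ?case unfolding Q_def
    proof (intro impI ballI)
      fix w assume *: "0 \<le> a" "c \<le> 1" "a \<le> c" "w \<in> carrier W"
      obtain \<sigma> where \<sigma>: "horizontal g \<sigma> a b" "\<sigma> a = w" using trans * unfolding Q_def by force
      then have "\<sigma> b \<in> carrier W" using trans by (simp add: horizontal_def)
      then obtain \<tau> where \<tau>: "horizontal g \<tau> b c" "\<tau> b = \<sigma> b" using trans * unfolding Q_def by force
      define \<rho> where "\<rho> = (\<lambda>t. if t \<le> b then \<sigma> t else \<tau> t)"
      have 1: "chart \<rho> g k t = chart \<sigma> g k t" if "t \<le> b" for k t using that by (simp add: chart_def \<rho>_def)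
      have 2: "chart \<rho> g k t = chart \<tau> g k t" if "b \<le> t" for k t using that \<tau>(2) by (cases "t = b") (auto simp: chart_def \<rho>_def)
      have "horizontal g \<rho> a c" unfolding horizontal_def
      proof (intro conjI ballI allI impI)
        fix t assume "t \<in> {a..c}"
        then show "\<rho> t \<in> carrier W" using \<sigma> \<tau> by (auto simp: horizontal_def \<rho>_def)
      next
        fix t k assume t: "t \<in> {a..c}" "g t \<in> star k"
        have d1: "\<exists>d>0. \<forall>s\<in>{a..b}. \<bar>s - t\<bar> < d \<longrightarrow> chart \<rho> g k s = chart \<rho> g k t"
        proof (cases "t \<le> b")
          case True
          then have "t \<in> {a..b}" using t by simp
          with \<sigma>(1) t obtain d where "d > 0" "\<forall>s\<in>{a..b}. \<bar>s - t\<bar> < d \<longrightarrow> chart \<sigma> g k s = chart \<sigma> g k t"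
            unfolding horizontal_def by blast
          then show ?thesis using 1 True by (intro exI[of _ d]) auto
        next
          case False
          then show ?thesis by (intro exI[of _ "t - b"]) auto
        qed
        have d2: "\<exists>d>0. \<forall>s\<in>{b..c}. \<bar>s - t\<bar> < d \<longrightarrow> chart \<rho> g k s = chart \<rho> g k t"
        proof (cases "b \<le> t")
          case True
          then have "t \<in> {b..c}" using t by simp
          with \<tau>(1) t obtain d where "d > 0" "\<forall>s\<in>{b..c}. \<bar>s - t\<bar> < d \<longrightarrow> chart \<tau> g k s = chart \<tau> g k t"
            unfolding horizontal_def by blast
          then show ?thesis using 2 True by (intro exI[of _ d]) auto
        next
          case False
          then show ?thesis by (intro exI[of _ "b - t"]) auto
        qed
        obtain d d' where dd: "d > 0" "\<forall>s\<in>{a..b}. \<bar>s - t\<bar> < d \<longrightarrow> chart \<rho> g k s = chart \<rho> g k t"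
          "d' > 0" "\<forall>s\<in>{b..c}. \<bar>s - t\<bar> < d' \<longrightarrow> chart \<rho> g k s = chart \<rho> g k t"
          using d1 d2 by blast
        show "\<exists>d>0. \<forall>s\<in>{a..c}. \<bar>s - t\<bar> < d \<longrightarrow> chart \<rho> g k s = chart \<rho> g k t"
        proof (intro exI[of _ "min d d'"] conjI ballI impI)
          fix s assume "s \<in> {a..c}" "\<bar>s - t\<bar> < min d d'"
          then show "chart \<rho> g k s = chart \<rho> g k t" using dd by (cases "s \<le> b") auto
        qed (use dd in simp)
      qed
      moreover have "\<rho> a = w" using trans \<sigma> by (simp add: \<rho>_def)
      ultimately show "\<exists>\<sigma>. horizontal g \<sigma> a c \<and> \<sigma> a = w" by blast
    qed
  next
    case (local x)
    then have x: "x \<in> {0..1}" by simp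
    obtain r where r: "g x \<in> star r" using ex_star[OF gS[of x]] x by auto
    obtain d where d: "d > 0" "\<And>t. t \<in> {0..1} \<Longrightarrow> \<bar>t - x\<bar> < d \<Longrightarrow> g t \<in> star r"
      using eventually_star[OF g x r] by blast
    show ?case
    proof (intro exI[of _ d] conjI allI impI)
      show "0 < d" by (rule d)
      fix a b assume ab: "a \<le> x \<and> x \<le> b \<and> b - a < d"
      show "Q a b" unfolding Q_def
      proof (intro impI ballI)
        fix w assume *: "0 \<le> a" "b \<le> 1" "a \<le> b" "w \<in> carrier W"
        have cE: "cell_of (g t) \<in> E" if "t \<in> {a..b}" for t using cell_of(1)[OF gS] that * by auto
        \<comment> \<open>Solved for the chart at \<open>r\<close> to keep the value it has at time
          \<open>a\<close>.\<close>
        define \<sigma> where "\<sigma> = (\<lambda>t. w \<cdot> dih (cell_of (g a)) r \<cdot> inv\<^bsub>W\<^esub> dih (cell_of (g t)) r)"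
        have ch: "chart \<sigma> g r t = w \<cdot> dih (cell_of (g a)) r" if "t \<in> {a..b}" for t
          using cE[OF that] cE[of a] * by (simp add: chart_def \<sigma>_def W.m_assoc)
        have "horizontal g \<sigma> a b"
        proof (rule horizontalI[OF g *(1,2)])
          show "\<sigma> t \<in> carrier W" if "t \<in> {a..b}" for t using cE[OF that] cE[of a] * by (simp add: \<sigma>_def)
          show "\<exists>k. g t \<in> star k \<and> (\<exists>d>0. \<forall>s\<in>{a..b}. \<bar>s - t\<bar> < d \<longrightarrow> chart \<sigma> g k s = chart \<sigma> g k t)"
            if "t \<in> {a..b}" for t
          proof (intro exI[of _ r] conjI exI[of _ 1] ballI impI)
            show "g t \<in> star r" by (rule d(2)) (use that ab * in auto)
          qed (use ch that in auto)
        qed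
        moreover have "\<sigma> a = w" using cE[of a] * by (simp add: \<sigma>_def W.m_assoc)
        ultimately show "\<exists>\<sigma>. horizontal g \<sigma> a b \<and> \<sigma> a = w" by blast
      qed
    qed
  qed
  then show ?thesis using c unfolding Q_def by simp
qed

text \<open>Neighbouring paths pass through the same stars on short time intervals, so their
  sections agree in the charts from one interval to the next. The final value is therefore locally
  constant in \<open>s\<close>, and the unit interval is connected.\<close>

lemma horizontal_homotopy:
  fixes h :: "real \<times> real \<Rightarrow> complex \<times> real \<times> real"
  assumes h: "continuous_on ({0..1} \<times> {0..1}) h" "h \<in> {0..1} \<times> {0..1} \<rightarrow> S"
    and h0: "\<And>s. s \<in> {0..1} \<Longrightarrow> h (s, 0) = x0" and h1: "\<And>s. s \<in> {0..1} \<Longrightarrow> h (s, 1) = x1"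
    and \<sigma>: "\<And>s. s \<in> {0..1} \<Longrightarrow> horizontal (\<lambda>t. h (s, t)) (\<sigma> s) 0 1" "\<And>s. s \<in> {0..1} \<Longrightarrow> \<sigma> s 0 = c"
  shows "\<sigma> 0 1 = \<sigma> 1 (1::real)"
proof -
  have hS: "h (s, t) \<in> S" if "s \<in> {0..1}" "t \<in> {0..1}" for s t using h(2) that by blast
  have near: "\<exists>d>0. \<forall>s\<in>{0..1}. \<forall>t\<in>{0..1}. \<bar>s - s0\<bar> < d \<longrightarrow> \<bar>t - t0\<bar> < d \<longrightarrow> h (s, t) \<in> T"
    if st: "s0 \<in> {0..1}" "t0 \<in> {0..1}" and T: "open T" "h (s0, t0) \<in> T" for s0 t0 :: real and T
  proof -
    obtain e where e: "e > 0" "\<And>y. dist y (h (s0, t0)) < e \<Longrightarrow> y \<in> T" using T unfolding open_dist by blast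
    obtain d where d: "d > 0" "\<And>p. p \<in> {0..1} \<times> {0..1} \<Longrightarrow> dist p (s0, t0) < d \<Longrightarrow> dist (h p) (h (s0, t0)) < e"
      using h(1) st e(1) unfolding continuous_on_iff by (metis mem_Times_iff fst_conv snd_conv)
    show ?thesis
    proof (intro exI[of _ "d / 2"] conjI ballI impI)
      fix s t assume s: "s \<in> {0..1}" "\<bar>s - s0\<bar> < d / 2" and t: "t \<in> {0..1}" "\<bar>t - t0\<bar> < d / 2"
      have "dist (s, t) (s0, t0) \<le> \<bar>s - s0\<bar> + \<bar>t - t0\<bar>"
        using sqrt_sum_squares_le_sum_abs[of "s - s0" "t - t0"] by (simp add: dist_Pair_Pair dist_real_def)
      then show "h (s, t) \<in> T" using e(2) d(2)[of "(s, t)"] s t by auto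
    qed (use d in simp)
  qed
  have tr_near: "\<exists>d>0. \<forall>s\<in>{0..1}. \<bar>s - s0\<bar> < d \<longrightarrow>
      transition k l (cell_of (h (s, t))) = transition k l (cell_of (h (s0, t)))"
    if st: "s0 \<in> {0..1}" "t \<in> {0..1}" and kl: "h (s0, t) \<in> star k" "h (s0, t) \<in> star l" for s0 t :: real and k l
  proof -
    obtain T where T: "open T" "h (s0, t) \<in> T"
      "\<forall>q\<in>S \<inter> T. transition k l (cell_of q) = transition k l (cell_of (h (s0, t)))"
      using transition_locally_constant[OF kl] by blast
    from near[OF st T(1,2)] obtain d where d: "d > 0"
      "\<And>s t'. s \<in> {0..1} \<Longrightarrow> t' \<in> {0..1} \<Longrightarrow> \<bar>s - s0\<bar> < d \<Longrightarrow> \<bar>t' - t\<bar> < d \<Longrightarrow> h (s, t') \<in> T" by blast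
    have "transition k l (cell_of (h (s, t))) = transition k l (cell_of (h (s0, t)))"
      if "s \<in> {0..1}" "\<bar>s - s0\<bar> < d" for s
      using d(1) d(2)[OF that(1) st(2) that(2)] T(3) hS[OF that(1) st(2)] by simp
    then show ?thesis using d(1) by blast
  qed
  have \<sigma>c: "\<sigma> s t \<in> carrier W" if "s \<in> {0..1}" "t \<in> {0..1}" for s t
    using \<sigma>(1) that unfolding horizontal_def by blast
  let ?ch = "\<lambda>s. chart (\<sigma> s) (\<lambda>t. h (s, t))"
  have tr: "?ch s l t = ?ch s k t \<cdot> transition k l (cell_of (h (s, t)))" if "s \<in> {0..1}" "t \<in> {0..1}" for s t k l
    by (rule chart_transition) (use hS \<sigma>c that in auto)
  have loc: "\<exists>d>0. \<forall>s\<in>{0..1}. \<bar>s - s0\<bar> < d \<longrightarrow> \<sigma> s 1 = \<sigma> s0 1" if s0: "s0 \<in> {0..1}" for s0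
  proof -
    \<comment> \<open>Membership in the stars is required of the path at \<open>s0\<close> only: the
      transitions there stay constant for nearby \<open>s\<close>, which permits the change of chart
      for all of them at once.\<close>
    define Q where "Q = (\<lambda>a b. 0 \<le> a \<longrightarrow> b \<le> 1 \<longrightarrow> a \<le> b \<longrightarrow>
      (\<forall>k l. h (s0, a) \<in> star k \<longrightarrow> h (s0, b) \<in> star l \<longrightarrow>
      (\<exists>d>0. \<forall>s\<in>{0..1}. \<bar>s - s0\<bar> < d \<longrightarrow> ?ch s k a = ?ch s0 k a \<longrightarrow> ?ch s l b = ?ch s0 l b)))"
    have "(0::real) \<le> 1" by simp
    then have "Q 0 1"
    proof (induction rule: Bolzano)
      case (trans a b c)
      show ?case unfolding Q_def
      proof (intro impI allI)
        fix k l assume *: "0 \<le> a" "c \<le> 1" "a \<le> c" "h (s0, a) \<in> star k" "h (s0, c) \<in> star l"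
        have "h (s0, b) \<in> S" using hS s0 trans * by auto
        then obtain r where r: "h (s0, b) \<in> star r" using ex_star by blast
        obtain d where d: "d > 0" "\<forall>s\<in>{0..1}. \<bar>s - s0\<bar> < d \<longrightarrow> ?ch s k a = ?ch s0 k a \<longrightarrow> ?ch s r b = ?ch s0 r b"
          using trans * r unfolding Q_def by force
        obtain d' where d': "d' > 0" "\<forall>s\<in>{0..1}. \<bar>s - s0\<bar> < d' \<longrightarrow> ?ch s r b = ?ch s0 r b \<longrightarrow> ?ch s l c = ?ch s0 l c"
          using trans * r unfolding Q_def by force
        show "\<exists>d>0. \<forall>s\<in>{0..1}. \<bar>s - s0\<bar> < d \<longrightarrow> ?ch s k a = ?ch s0 k a \<longrightarrow> ?ch s l c = ?ch s0 l c"
          using d d' by (intro exI[of _ "min d d'"]) auto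
      qed
    next
      case (local x)
      then have x: "x \<in> {0..1}" by simp
      obtain r where r: "h (s0, x) \<in> star r" using ex_star[OF hS[OF s0 x]] by blast
      obtain T where T: "open T" "star r = S \<inter> T" using openin_star[of r] by (auto simp: openin_open)
      obtain d where d: "d > 0"
        "\<And>s t. s \<in> {0..1} \<Longrightarrow> t \<in> {0..1} \<Longrightarrow> \<bar>s - s0\<bar> < d \<Longrightarrow> \<bar>t - x\<bar> < d \<Longrightarrow> h (s, t) \<in> T"
        using near[OF s0 x T(1)] r T(2) by blast
      show ?case
      proof (intro exI[of _ d] conjI allI impI)
        show "0 < d" by (rule d)
        fix a b assume ab: "a \<le> x \<and> x \<le> b \<and> b - a < d"
        show "Q a b" unfolding Q_def
        proof (intro impI allI)
          fix k l assume *: "0 \<le> a" "b \<le> 1" "a \<le> b" "h (s0, a) \<in> star k" "h (s0, b) \<in> star l"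
          have ab01: "a \<in> {0..1}" "b \<in> {0..1}" using * by auto
          have st: "h (s, t) \<in> star r" if "s \<in> {0..1}" "\<bar>s - s0\<bar> < d" "t \<in> {a..b}" for s t
            unfolding T(2) using d(2)[of s t] hS[of s t] that ab * by auto
          have ra: "h (s0, a) \<in> star r" "h (s0, b) \<in> star r" using st s0 d(1) * by auto
          obtain da where da: "da > 0" "\<And>s. s \<in> {0..1} \<Longrightarrow> \<bar>s - s0\<bar> < da \<Longrightarrow>
             transition k r (cell_of (h (s, a))) = transition k r (cell_of (h (s0, a)))"
            using tr_near[OF s0 ab01(1) *(4) ra(1)] by blast
          obtain db where db: "db > 0" "\<And>s. s \<in> {0..1} \<Longrightarrow> \<bar>s - s0\<bar> < db \<Longrightarrow>
             transition r l (cell_of (h (s, b))) = transition r l (cell_of (h (s0, b)))"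
            using tr_near[OF s0 ab01(2) ra(2) *(5)] by blast
          have const: "?ch s r a = ?ch s r b" if "s \<in> {0..1}" "\<bar>s - s0\<bar> < d" for s
          proof (rule horizontal_chart_constant)
            show "horizontal (\<lambda>t. h (s, t)) (\<sigma> s) a b" by (rule horizontal_mono[OF \<sigma>(1)[OF that(1)] *(1,2)])
          qed (use st[OF that] * in auto)
          show "\<exists>d>0. \<forall>s\<in>{0..1}. \<bar>s - s0\<bar> < d \<longrightarrow> ?ch s k a = ?ch s0 k a \<longrightarrow> ?ch s l b = ?ch s0 l b"
          proof (intro exI[of _ "min d (min da db)"] conjI ballI impI)
            fix s assume s: "s \<in> {0..1}" "\<bar>s - s0\<bar> < min d (min da db)" and eq: "?ch s k a = ?ch s0 k a"
            have "?ch s r a = ?ch s0 r a"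
              using tr[OF s(1) ab01(1), of r k] tr[OF s0 ab01(1), of r k] eq da(2)[OF s(1)] s(2) by simp
            then have "?ch s r b = ?ch s0 r b" using const[OF s(1)] const[OF s0] s(2) d(1) by simp
            then show "?ch s l b = ?ch s0 l b"
              using tr[OF s(1) ab01(2), of l r] tr[OF s0 ab01(2), of l r] db(2)[OF s(1)] s(2) by simp
          qed (use d da db in simp)
        qed
      qed
    qed
    have "x0 \<in> S" "x1 \<in> S" using h0[OF s0] h1[OF s0] hS[OF s0, of 0] hS[OF s0, of 1] by auto
    then obtain k l where kl: "x0 \<in> star k" "x1 \<in> star l" using ex_star by blast
    with \<open>Q 0 1\<close> have "\<exists>d>0. \<forall>s\<in>{0..1}. \<bar>s - s0\<bar> < d \<longrightarrow> ?ch s k 0 = ?ch s0 k 0 \<longrightarrow> ?ch s l 1 = ?ch s0 l 1"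
      unfolding Q_def using h0[OF s0] h1[OF s0] by simp
    then obtain d where d: "d > 0"
      "\<And>s. s \<in> {0..1} \<Longrightarrow> \<bar>s - s0\<bar> < d \<Longrightarrow> ?ch s k 0 = ?ch s0 k 0 \<Longrightarrow> ?ch s l 1 = ?ch s0 l 1"
      by blast
    have "\<sigma> s 1 = \<sigma> s0 1" if s: "s \<in> {0..1}" "\<bar>s - s0\<bar> < d" for s
    proof -
      have "?ch s k 0 = ?ch s0 k 0" using h0 s s0 \<sigma>(2) by (simp add: chart_def)
      then have "?ch s l 1 = ?ch s0 l 1" using d(2) s by blast
      then show ?thesis using h1 s s0 \<sigma>c[of s 1] \<sigma>c[of s0 1] cell_of(1)[OF \<open>x1 \<in> S\<close>] by (simp add: chart_def)
    qed
    with d(1) show ?thesis by blast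
  qed
  show ?thesis
  proof (rule connected_local_const[of "{0..1::real}" 0 1 "\<lambda>s. \<sigma> s 1"])
    show "\<forall>s\<in>{0..1}. \<forall>\<^sub>F s' in at s within {0..1}. \<sigma> s 1 = \<sigma> s' 1"
    proof
      fix s :: real assume "s \<in> {0..1}"
      from loc[OF this] obtain d where "d > 0" "\<forall>s'\<in>{0..1}. \<bar>s' - s\<bar> < d \<longrightarrow> \<sigma> s' 1 = \<sigma> s 1" by blast
      then show "\<forall>\<^sub>F s' in at s within {0..1}. \<sigma> s 1 = \<sigma> s' 1"
        unfolding eventually_at by (intro exI[of _ d]) (auto simp: dist_real_def)
    qed
  qed auto
qed

text \<open>A map not increasing distances keeps the radius of local constancy. Besides the halves
  of a joined path it covers the identity, for replacing a path by one with the same values on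
  \<open>[0,1]\<close>.\<close>

lemma horizontal_reparametrize:
  assumes h: "horizontal g \<sigma> 0 1" and \<phi>: "\<And>t. t \<in> {0..1} \<Longrightarrow> \<phi> t \<in> {0..1}"
    and lip: "\<And>s t. \<bar>\<phi> s - \<phi> t\<bar> \<le> \<bar>s - t\<bar>" and g': "\<And>t. t \<in> {0..1} \<Longrightarrow> g' t = g (\<phi> t)"
  shows "horizontal g' (\<lambda>t. \<sigma> (\<phi> t)) 0 1"
  unfolding horizontal_def
proof (intro conjI ballI allI impI)
  fix t :: real assume "t \<in> {0..1}"
  then show "\<sigma> (\<phi> t) \<in> carrier W" using h \<phi> unfolding horizontal_def by blast
next
  fix t :: real and k assume t: "t \<in> {0..1}" "g' t \<in> star k"
  then obtain d where d: "d > 0" "\<forall>s\<in>{0..1}. \<bar>s - \<phi> t\<bar> < d \<longrightarrow> chart \<sigma> g k s = chart \<sigma> g k (\<phi> t)"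
    using h \<phi>[OF t(1)] g'[OF t(1)] unfolding horizontal_def by metis
  show "\<exists>d>0. \<forall>s\<in>{0..1}. \<bar>s - t\<bar> < d \<longrightarrow> chart (\<lambda>t. \<sigma> (\<phi> t)) g' k s = chart (\<lambda>t. \<sigma> (\<phi> t)) g' k t"
  proof (intro exI[of _ d] conjI ballI impI d(1))
    fix s assume s: "s \<in> {0..1}" "\<bar>s - t\<bar> < d"
    then have "chart \<sigma> g k (\<phi> s) = chart \<sigma> g k (\<phi> t)" using d(2) \<phi> lip[of s t] by force
    then show "chart (\<lambda>t. \<sigma> (\<phi> t)) g' k s = chart (\<lambda>t. \<sigma> (\<phi> t)) g' k t"
      using g' s(1) t(1) by (simp add: chart_def)
  qed
qed

lemma horizontal_join:
  assumes "horizontal (p +++ q) \<sigma> 0 1" "pathfinish p = pathstart q"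
  shows "horizontal p (\<lambda>t. \<sigma> (t / 2)) 0 1" "horizontal q (\<lambda>t. \<sigma> ((1 + t) / 2)) 0 1"
proof -
  show "horizontal p (\<lambda>t. \<sigma> (t / 2)) 0 1"
    by (rule horizontal_reparametrize[OF assms(1)]) (auto simp: joinpaths_def)
  show "horizontal q (\<lambda>t. \<sigma> ((1 + t) / 2)) 0 1"
  proof (rule horizontal_reparametrize[OF assms(1)])
    fix t :: real assume "t \<in> {0..1}"
    moreover have "(2 + 2 * t) / 2 - 1 = t" by (simp add: field_simps)
    ultimately show "q t = (p +++ q) ((1 + t) / 2)"
      using assms(2) by (cases "t = 0") (auto simp: joinpaths_def pathstart_def pathfinish_def)
  qed (auto simp: field_simps abs_if)
qed

section \<open>Holonomy of edge paths\<close>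

lemma edge_path_star:
  assumes v: "v \<in> pverts L" and t: "t \<in> {0..1}"
  shows "t < 1 \<Longrightarrow> edge_path v k t \<in> star k" "0 < t \<Longrightarrow> edge_path v k t \<in> star (step v k)"
proof -
  have S: "edge_path v k t \<in> S" using edge_path_image[OF v, of k] t by (auto simp: path_image_def)
  have f: "fst (edge_path v k t) = (1 - t) *\<^sub>R corner k + t *\<^sub>R corner (step v k)"
    by (simp add: edge_path_def side_path_def linepath_def)
  show "t < 1 \<Longrightarrow> edge_path v k t \<in> star k"
    using S f in_star_segment[of t k] t by (simp add: star_def)
  show "0 < t \<Longrightarrow> edge_path v k t \<in> star (step v k)"
    using S f in_star_segment[of "1 - t" "step v k" k] t by (simp add: star_def add.commute)
qed

text \<open>The polygon chosen at the midpoint may differ from the one used to draw the path, but it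
  has the same index at \<open>v\<close>, because the weight of that index does not vanish
  there.\<close>

lemma transition_edge_path:
  assumes v: "v \<in> pverts L"
  shows "transition k (step v k) (cell_of (edge_path v k (1 / 2))) = gen v"
proof -
  let ?p = "edge_path v k (1 / 2)"
  \<comment> \<open>A letter may traverse its side in either direction; \<open>l\<close> is the
    number of the side.\<close>
  define l where "l = min k (step v k)"
  have st: "step v k = k + 1 \<or> step v k = k - 1" using letter_shift_cases[of v] by (auto simp: step_def)
  have "?p \<in> star k" "?p \<in> star (step v k)" using edge_path_star[OF v, of "1 / 2" k] by simp_all
  then have star: "?p \<in> star l" "?p \<in> star (l + 1)" using st by (auto simp: l_def min_def)
  then have S: "?p \<in> S" using star_subset by blast
  have "transition l (l + 1) (cell_of ?p) = gen v"
  proof (cases v)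
    case (Xv i)
    have ev: "even l" unfolding l_def Xv by (auto simp: step_def min_def)
    have "fst (snd ?p) = x_weight (fst ?p) * real i" by (simp add: Xv edge_path_def embed_def)
    then have "x_weight (fst ?p) * real (fst (cell_of ?p)) = x_weight (fst ?p) * real i"
      using cell_of_coordinates(1)[OF S] by metis
    then have "fst (cell_of ?p) = i" using weights_in_two_stars(1)[OF star ev] by simp
    then show ?thesis using transition_Suc[OF cell_of(1)[OF S], of "l + 1" l] ev Xv by simp
  next
    case (Yv j)
    have od: "odd l" unfolding l_def Yv by (auto simp: step_def min_def)
    have "snd (snd ?p) = y_weight (fst ?p) * real j" by (simp add: Yv edge_path_def embed_def)
    then have "y_weight (fst ?p) * real (snd (cell_of ?p)) = y_weight (fst ?p) * real j"
      using cell_of_coordinates(2)[OF S] by metis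
    then have "snd (cell_of ?p) = j" using weights_in_two_stars(2)[OF star od] by simp
    then show ?thesis using transition_Suc[OF cell_of(1)[OF S], of "l + 1" l] od Yv by simp
  qed
  moreover have "transition (l + 1) l (cell_of ?p) = inv\<^bsub>W\<^esub> transition l (l + 1) (cell_of ?p)"
    by (rule transition_inv[OF cell_of(1)[OF S]])
  moreover have "l = k \<and> l + 1 = step v k \<or> l + 1 = k \<and> l = step v k" using st by (auto simp: l_def)
  ultimately show ?thesis using gen_inv[OF v] by metis
qed

text \<open>The chart at \<open>k\<close> is constant on the first half of the edge and the chart at
  \<open>step v k\<close> on the second; the midpoint contributes the transition.\<close>

lemma horizontal_edge_path:
  assumes v: "v \<in> pverts L" and h: "horizontal (edge_path v k) \<sigma> 0 1"
  shows "chart \<sigma> (edge_path v k) k 0 \<cdot> gen v = chart \<sigma> (edge_path v k) (step v k) 1"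
proof -
  let ?g = "edge_path v k"
  have "chart \<sigma> ?g k 0 = chart \<sigma> ?g k (1 / 2)"
    by (rule horizontal_chart_constant[of _ _ 0 "1 / 2"])
      (use horizontal_mono[OF h] edge_path_star[OF v] in auto)
  moreover have "chart \<sigma> ?g (step v k) (1 / 2) = chart \<sigma> ?g (step v k) 1"
    by (rule horizontal_chart_constant[of _ _ "1 / 2" 1])
      (use horizontal_mono[OF h] edge_path_star[OF v] in auto)
  moreover have "chart \<sigma> ?g (step v k) (1 / 2) = chart \<sigma> ?g k (1 / 2) \<cdot> transition k (step v k) (cell_of (?g (1 / 2)))"
    by (rule chart_transition)
      (use h edge_path_star(1)[OF v, of "1 / 2" k] star_subset in \<open>auto simp: horizontal_def\<close>)
  ultimately show ?thesis using transition_edge_path[OF v, of k] by simp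
qed

lemma horizontal_word_path:
  "w \<in> words \<Longrightarrow> horizontal (word_path k w) \<sigma> 0 1 \<Longrightarrow>
    chart \<sigma> (word_path k w) k 0 \<cdot> cls w = chart \<sigma> (word_path k w) (endpt w k) 1"
proof (induction w arbitrary: k \<sigma>)
  case Nil
  have "chart \<sigma> (word_path k []) k 0 = chart \<sigma> (word_path k []) k 1"
    by (rule horizontal_chart_constant[OF Nil(2)]) (use vtx_in_star in auto)
  moreover have "chart \<sigma> (word_path k []) k 0 \<in> carrier W"
    using Nil(2) cell_of(1)[OF vtx_in_S] by (auto simp: chart_def horizontal_def)
  ultimately show ?case unfolding cls_Nil endpt_Nil by (metis W.r_one)
next
  case (Cons x w)
  let ?p = "edge_path (fst x) k" and ?q = "word_path (step (fst x) k) w"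
  let ?\<sigma> = "\<lambda>t. \<sigma> (t / 2)" and ?\<tau> = "\<lambda>t. \<sigma> ((1 + t) / 2)"
  have x: "fst x \<in> pverts L" "w \<in> words" using Cons.prems by simp_all
  have h: "horizontal (?p +++ ?q) \<sigma> 0 1" using Cons.prems by simp
  have j: "pathfinish ?p = pathstart ?q" by simp
  note hj = horizontal_join[OF h j]
  have "chart ?\<tau> ?q (step (fst x) k) 0 \<cdot> cls w = chart ?\<tau> ?q (endpt w (step (fst x) k)) 1"
    by (rule Cons.IH[OF x(2) hj(2)])
  moreover have "chart ?\<tau> ?q (step (fst x) k) 0 = chart ?\<sigma> ?p (step (fst x) k) 1"
    using j by (simp add: chart_def pathstart_def pathfinish_def)
  moreover have "chart ?\<sigma> ?p k 0 \<cdot> gen (fst x) = chart ?\<sigma> ?p (step (fst x) k) 1"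
    by (rule horizontal_edge_path[OF x(1) hj(1)])
  moreover have "chart ?\<tau> ?q (endpt w (step (fst x) k)) 1 = chart \<sigma> (?p +++ ?q) (endpt w (step (fst x) k)) 1"
    by (simp add: chart_def joinpaths_def)
  moreover have "chart ?\<sigma> ?p k 0 = chart \<sigma> (?p +++ ?q) k 0" by (simp add: chart_def joinpaths_def)
  moreover have "chart ?\<sigma> ?p k 0 \<in> carrier W"
  proof -
    have "\<sigma> 0 \<in> carrier W" using h by (simp add: horizontal_def)
    moreover have "?p 0 = vtx k" by (metis edge_path_props(2) pathstart_def)
    ultimately show ?thesis using cell_of(1)[OF vtx_in_S] by (simp add: chart_def)
  qed
  ultimately show ?case using x by (simp add: endpt_Cons cls_Cons flip: W.m_assoc)
qed

lemma homotopic_word_paths_cls: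
  assumes u: "u \<in> words" and w: "w \<in> words" and hom: "homotopic_paths S (word_path k u) (word_path k w)"
  shows "cls u = cls w"
proof -
  obtain h where h: "continuous_on ({0..1} \<times> {0..1}) h" "h \<in> ({0..1} \<times> {0..1}) \<rightarrow> S"
    and h0: "\<And>t. t \<in> {0..1} \<Longrightarrow> h (0, t) = word_path k u t" and h1: "\<And>t. t \<in> {0..1} \<Longrightarrow> h (1, t) = word_path k w t"
    and ends: "\<And>t. t \<in> {0..1::real} \<Longrightarrow> pathstart (h \<circ> Pair t) = vtx k \<and> pathfinish (h \<circ> Pair t) = vtx (endpt u k)"
    using hom unfolding homotopic_paths by auto
  have hs: "h (s, 0) = vtx k" "h (s, 1) = vtx (endpt u k)" if "s \<in> {0..1}" for s
    using ends[OF that] by (simp_all add: pathstart_def pathfinish_def)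
  have row: "path (\<lambda>t. h (s, t))" "path_image (\<lambda>t. h (s, t)) \<subseteq> S" if "s \<in> {0..1}" for s
  proof -
    show "path (\<lambda>t. h (s, t))" unfolding path_def
      by (rule continuous_on_compose2[OF h(1)]) (use that in \<open>auto intro!: continuous_intros\<close>)
    show "path_image (\<lambda>t. h (s, t)) \<subseteq> S" using h(2) that by (auto simp: path_image_def)
  qed
  have "\<exists>\<sigma>. horizontal (\<lambda>t. h (s, t)) \<sigma> 0 1 \<and> \<sigma> 0 = \<one>\<^bsub>W\<^esub>" if "s \<in> {0..1}" for s
    by (rule ex_horizontal[OF row[OF that]]) simp
  then obtain \<sigma> where \<sigma>: "\<And>s. s \<in> {0..1} \<Longrightarrow> horizontal (\<lambda>t. h (s, t)) (\<sigma> s) 0 1"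
    "\<And>s. s \<in> {0..1} \<Longrightarrow> \<sigma> s 0 = \<one>\<^bsub>W\<^esub>" by metis
  have eq1: "\<sigma> 0 1 = \<sigma> 1 1" by (rule horizontal_homotopy[OF h hs \<sigma>])
  have val: "dih (cell_of (vtx k)) k \<cdot> cls v = \<sigma> s 1 \<cdot> dih (cell_of (vtx (endpt v k))) (endpt v k)"
    if s: "s \<in> {0..1}" and v: "v \<in> words" and hv: "\<And>t. t \<in> {0..1} \<Longrightarrow> h (s, t) = word_path k v t" for s v
  proof -
    have "horizontal (word_path k v) (\<lambda>t. \<sigma> s t) 0 1"
      by (rule horizontal_reparametrize[OF \<sigma>(1)[OF s]]) (use hv in auto)
    from horizontal_word_path[OF v this] show ?thesis
      using \<sigma>(2)[OF s] pathstart_word_path[of k v] pathfinish_word_path[of k v] cell_of(1)[OF vtx_in_S]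
      by (simp add: chart_def pathstart_def pathfinish_def)
  qed
  have vtx: "vtx (endpt u k) = vtx (endpt w k)"
    using homotopic_paths_imp_pathfinish[OF hom] by simp
  \<comment> \<open>The homotopy gives equal end points only; congruent indices are needed to read
    both end values in the same chart.\<close>
  then have "[endpt u k = endpt w k] (mod period)" using corner_inj by (simp add: vtx_def)
  then have "dih (cell_of (vtx (endpt u k))) (endpt u k) = dih (cell_of (vtx (endpt w k))) (endpt w k)"
    unfolding vtx using dih_E_cong[OF cell_of(1)[OF vtx_in_S]] by blast
  then have "dih (cell_of (vtx k)) k \<cdot> cls u = dih (cell_of (vtx k)) k \<cdot> cls w"
    using val[OF _ u h0] val[OF _ w h1] eq1 by simp
  then show ?thesis using u w cell_of(1)[OF vtx_in_S] by simp
qed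

end

section \<open>The fundamental group of the complex\<close>

text \<open>Chains of edges sharing an endpoint are the form of connectedness that the gluing needs
  at corners, where all polygons have to be identified.\<close>

locale connected_bipartite_complex = bipartite_complex m L
  for m :: nat and L :: "vertex pair_pre_digraph" +
  assumes linked: "e \<in> bip_edges L \<Longrightarrow> e' \<in> bip_edges L \<Longrightarrow>
    (e, e') \<in> {(a, b). a \<in> bip_edges L \<and> b \<in> bip_edges L \<and> (fst a = fst b \<or> snd a = snd b)}\<^sup>*"
begin

abbreviation union_space where "union_space \<equiv> polygon_union m L"
abbreviation gl where "gl \<equiv> glue_equiv m L"
abbreviation X where "X \<equiv> polygon_complex m L"

definition F :: "(nat \<times> nat) \<times> complex \<Rightarrow> complex \<times> real \<times> real" where
  "F p = embed (fst p) (snd p)"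

lemma topspace_union: "topspace union_space = E \<times> P"
  by (auto simp: polygon_union_def)

lemma polygon_edge_eq: "polygon_edge (2 * m) k = linepath (corner (int k)) (corner (int k + 1))"
  by (simp add: polygon_edge_def polygon_corner_eq add.commute)

lemma edge_label_eqD:
  assumes "edge_label e k = edge_label e' k'"
  shows "k = k'" "even k \<Longrightarrow> fst e = fst e'" "odd k \<Longrightarrow> snd e = snd e'"
proof -
  obtain i j i' j' where e: "e = (i, j)" "e' = (i', j')" by force
  have "even k \<longleftrightarrow> even k'" using assms by (auto simp: e split: if_splits)
  moreover have "k div 2 = k' div 2" using assms by (simp add: e)
  ultimately show "k = k'" by (metis dvd_mult_div_cancel odd_two_times_div_two_succ)
  with assms show "even k \<Longrightarrow> fst e = fst e'" "odd k \<Longrightarrow> snd e = snd e'" by (simp_all add: e)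
qed

lemma side_dist_polygon_edge: "side_dist (int k) (polygon_edge (2 * m) k t) = 0"
  by (simp add: polygon_edge_eq linepath_def side_dist_linepath side_dist_corner_0)

lemma glue_F: assumes "(x, y) \<in> glue m L" shows "F x = F y"
proof -
  from assms obtain e e' k k' t where *: "x = (e, polygon_edge (2 * m) k t)" "y = (e', polygon_edge (2 * m) k' t)"
    "edge_label e k = edge_label e' k'" unfolding glue_def by blast
  let ?z = "polygon_edge (2 * m) k t"
  have "embed e ?z = embed e' ?z"
  proof (cases "even k")
    case True
    then have "even (int k)" by simp
    from embed_side_eq(1)[OF side_dist_polygon_edge this, of "fst e" "snd e" t "snd e'"]
    show ?thesis using edge_label_eqD(2)[OF *(3) True] by (metis prod.collapse)
  next
    case False
    then have "odd (int k)" by simp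
    from embed_side_eq(2)[OF side_dist_polygon_edge this, of "fst e" "snd e" t "fst e'"]
    show ?thesis using edge_label_eqD(3)[OF *(3) False] by (metis prod.collapse)
  qed
  then show ?thesis unfolding F_def * edge_label_eqD(1)[OF *(3), symmetric] by simp
qed

lemma glue_side:
  assumes z: "z \<in> P" "side_dist l z = 0" and e: "e \<in> E" "e' \<in> E"
    and par: "even l \<Longrightarrow> fst e = fst e'" "odd l \<Longrightarrow> snd e = snd e'"
  shows "((e, z), (e', z)) \<in> glue m L"
proof -
  define k where "k = nat (l mod period)"
  have k: "int k = l mod period" "k < 2 * m" using period_pos by (simp_all add: k_def nat_less_iff)
  have ev: "even k \<longleftrightarrow> even l" by (metis k(1) dvd_mod_iff dvd_triv_left even_of_nat)
  have "side_dist (int k) z = 0" using z(2) side_dist_cong[of "int k" l z] k by simp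
  then obtain t where t: "t \<in> {0..1}" "z = polygon_edge (2 * m) k t"
    using side_dist_0_segment[OF z(1)] by (auto simp: polygon_edge_eq linepath_def in_segment)
  have "edge_label e k = edge_label e' k" using par ev by (cases e; cases e') auto
  then show ?thesis unfolding glue_def using e t k(2) by blast
qed

text \<open>A nonzero weight forces its index to agree; a zero weight puts \<open>z\<close> on a
  side along which polygons differing in that index are glued. At a corner both weights vanish, and
  a chain from \<open>linked\<close> joins arbitrary polygons.\<close>

lemma F_eq_glue:
  assumes e: "e \<in> E" "e' \<in> E" and z: "z \<in> P" and eq: "F (e, z) = F (e', z)"
  shows "((e, z), (e', z)) \<in> (glue m L)\<^sup>*"
proof (cases "x_weight z = 0")
  case True
  then obtain l where l: "odd l" "side_dist l z = 0" using x_weight_eq_0_iff by blast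
  show ?thesis
  proof (cases "y_weight z = 0")
    case True
    then obtain l' where l': "even l'" "side_dist l' z = 0" using y_weight_eq_0_iff by blast
    from linked[OF e] show ?thesis
    proof (induction rule: rtrancl_induct)
      case (step a b)
      have "((a, z), (b, z)) \<in> glue m L"
        using step(2) glue_side[OF z l(2), of a b] glue_side[OF z l'(2), of a b] l(1) l'(1) by auto
      with step(3) show ?case by (rule rtrancl_into_rtrancl)
    qed simp
  next
    case False
    then have "snd e = snd e'" using eq by (simp add: F_def embed_def)
    then show ?thesis using glue_side[OF z l(2) e] l(1) by auto
  qed
next
  case x: False
  then have f: "fst e = fst e'" using eq by (simp add: F_def embed_def)
  show ?thesis
  proof (cases "y_weight z = 0")
    case True
    then obtain l' where l': "even l'" "side_dist l' z = 0" using y_weight_eq_0_iff by blast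
    then show ?thesis using glue_side[OF z l'(2) e] f by auto
  next
    case False
    then have "snd e = snd e'" using eq by (simp add: F_def embed_def)
    then have "e = e'" using f by (simp add: prod_eq_iff)
    then show ?thesis by simp
  qed
qed

lemma glue_equiv_iff:
  assumes "x \<in> topspace union_space" "y \<in> topspace union_space"
  shows "(x, y) \<in> gl \<longleftrightarrow> F x = F y"
proof
  assume "(x, y) \<in> gl"
  then have "(x, y) \<in> (glue m L)\<^sup>*" by (simp add: glue_equiv_def)
  then show "F x = F y" by (induction rule: rtrancl_induct) (simp_all add: glue_F)
next
  assume eq: "F x = F y"
  then have "snd x = snd y" by (metis F_def fst_embed)
  then show "(x, y) \<in> gl"
    using F_eq_glue[of "fst x" "fst y" "snd x"] assms eq by (auto simp: topspace_union glue_equiv_def)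
qed

definition to_S :: "((nat \<times> nat) \<times> complex) set \<Rightarrow> complex \<times> real \<times> real" where
  "to_S A = F (SOME x. x \<in> A)"

lemma to_S_class: assumes "x \<in> topspace union_space" shows "to_S (gl `` {x}) = F x"
proof -
  define y where "y = (SOME y. y \<in> gl `` {x})"
  have "x \<in> gl `` {x}" using assms equiv_class_self[OF equiv_glue_equiv] by blast
  then have "y \<in> gl `` {x}" unfolding y_def by (rule someI)
  then have xy: "(x, y) \<in> gl" by blast
  then have "y \<in> topspace union_space" by (simp add: glue_equiv_def)
  then have "F x = F y" using assms xy glue_equiv_iff by blast
  then show ?thesis by (simp add: to_S_def y_def)
qed

lemma topspace_X: "topspace X = topspace union_space // gl"
  unfolding polygon_complex_def by (rule topspace_quotient_topology[OF equiv_glue_equiv])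

lemma to_S_image: "to_S ` topspace X = S"
proof -
  have "to_S ` topspace X = F ` topspace union_space"
    unfolding topspace_X quotient_def using to_S_class by (auto simp: image_iff) (metis singletonI)
  also have "\<dots> = (\<Union>e\<in>E. \<Union>z\<in>P. {F (e, z)})" unfolding topspace_union by blast
  also have "\<dots> = S" by (auto simp: F_def S_def)
  finally show ?thesis .
qed

lemma inj_to_S: "inj_on to_S (topspace X)"
proof (rule inj_onI)
  fix A B assume AB: "A \<in> topspace X" "B \<in> topspace X" "to_S A = to_S B"
  then obtain x y where xy: "x \<in> topspace union_space" "A = gl `` {x}" "y \<in> topspace union_space" "B = gl `` {y}"
    unfolding topspace_X by (metis quotientE)
  then have "(x, y) \<in> gl" using AB(3) to_S_class glue_equiv_iff by simp
  then show "A = B" using xy equiv_class_eq[OF equiv_glue_equiv] by blast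
qed

lemma continuous_F: "continuous_map union_space (top_of_set S) F"
  unfolding continuous_map_def
proof (intro conjI allI impI)
  show "F \<in> topspace union_space \<rightarrow> topspace (top_of_set S)" by (auto simp: topspace_union F_def embed_in_S)
  fix U assume U: "openin (top_of_set S) U"
  have "openin (top_of_set P) {z \<in> P. embed e z \<in> U}" if "e \<in> E" for e
  proof -
    have "continuous_map (top_of_set P) (top_of_set S) (embed e)"
      using continuous_on_embed embed_in_S[OF that] by auto
    from openin_continuous_map_preimage[OF this U] show ?thesis by simp
  qed
  then show "openin union_space {x \<in> topspace union_space. F x \<in> U}"
    unfolding topspace_union unfolding polygon_union_def openin_sum_topology by (auto simp: F_def)
qed

lemma continuous_to_S: "continuous_map X (top_of_set S) to_S"
proof (rule continuous_compose_quotient_map)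
  show "quotient_map union_space X (\<lambda>x. gl `` {x})"
    unfolding polygon_complex_def by (rule quotient_map_quotient_topology[OF equiv_glue_equiv])
  show "continuous_map union_space (top_of_set S) (to_S \<circ> (\<lambda>x. gl `` {x}))"
    by (rule continuous_map_eq[OF continuous_F]) (simp add: to_S_class)
qed

lemma compact_union_space: "compact_space union_space"
proof -
  have "compactin union_space (\<Union>e\<in>E. Pair e ` P)"
  proof (rule compactin_Union)
    show "finite ((\<lambda>e. Pair e ` P) ` E)" using finite_E by simp
    fix A assume "A \<in> (\<lambda>e. Pair e ` P) ` E"
    then obtain e where e: "e \<in> E" "A = Pair e ` P" by blast
    have "continuous_map (top_of_set P) union_space (Pair e)"
      unfolding polygon_union_def using continuous_map_component_injection[OF e(1), of "\<lambda>_. top_of_set P"] by simp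
    moreover have "compactin (top_of_set P) P" using compact_P by (simp add: compactin_subtopology)
    ultimately show "compactin union_space A" unfolding e(2) by (rule image_compactin[rotated])
  qed
  moreover have "(\<Union>e\<in>E. Pair e ` P) = topspace union_space" by (auto simp: topspace_union)
  ultimately show ?thesis by (simp add: compact_space_def)
qed

lemma compact_X: "compact_space X"
proof -
  have q: "quotient_map union_space X (\<lambda>x. gl `` {x})"
    unfolding polygon_complex_def by (rule quotient_map_quotient_topology[OF equiv_glue_equiv])
  then have "compactin X ((\<lambda>x. gl `` {x}) ` topspace union_space)"
    using compact_union_space image_compactin quotient_imp_continuous_map unfolding compact_space_def by blast
  then show ?thesis using quotient_imp_surjective_map[OF q] by (simp add: compact_space_def)
qed

text \<open>A continuous bijection from a compact space to a Hausdorff space; finiteness of the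
  graph enters through compactness.\<close>

lemma homeomorphic_to_S: "homeomorphic_map X (top_of_set S) to_S"
  by (rule continuous_imp_homeomorphic_map[OF continuous_to_S compact_X])
    (simp_all add: Hausdorff_space_subtopology to_S_image inj_to_S)

section \<open>Transfer of loops to the embedded complex\<close>

lemma path_to_S: assumes "p \<in> loops_at X x0"
  shows "path (to_S \<circ> p)" "path_image (to_S \<circ> p) \<subseteq> S" "pathstart (to_S \<circ> p) = to_S x0" "pathfinish (to_S \<circ> p) = to_S x0"
proof -
  have "pathin (top_of_set S) (to_S \<circ> p)"
    using assms pathin_compose[OF _ continuous_to_S] by (auto simp: loops_at_def)
  then show "path (to_S \<circ> p)" "path_image (to_S \<circ> p) \<subseteq> S" unfolding pathin_canon_iff by (auto simp: path_image_def)
  show "pathstart (to_S \<circ> p) = to_S x0" "pathfinish (to_S \<circ> p) = to_S x0"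
    using assms by (auto simp: loops_at_def pathstart_def pathfinish_def)
qed

lemma loops_in_X: assumes "p \<in> loops_at X x0" "t \<in> {0..1}" shows "p t \<in> topspace X"
  using assms by (auto simp: loops_at_def pathin_def continuous_map_def Pi_iff)

lemma to_S_join: "to_S \<circ> join_loops p q = (to_S \<circ> p) +++ (to_S \<circ> q)"
  by (auto simp: join_loops_def joinpaths_def fun_eq_iff)

definition from_S where "from_S = inv_into (topspace X) to_S"

lemma from_S: "x \<in> topspace X \<Longrightarrow> from_S (to_S x) = x" "p \<in> S \<Longrightarrow> to_S (from_S p) = p"
  using inj_to_S to_S_image by (auto simp: from_S_def f_inv_into_f)

lemma continuous_from_S: "continuous_map (top_of_set S) X from_S"
proof -
  obtain g where g: "homeomorphic_maps X (top_of_set S) to_S g"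
    using homeomorphic_to_S homeomorphic_map_maps by blast
  have "g p = from_S p" if p: "p \<in> S" for p
  proof -
    obtain x where x: "x \<in> topspace X" "p = to_S x" using p to_S_image by blast
    then show ?thesis using g from_S(1) by (simp add: homeomorphic_maps_def)
  qed
  then show ?thesis using g continuous_map_eq[of "top_of_set S" X g from_S] by (simp add: homeomorphic_maps_def)
qed

lemma from_S_loop:
  assumes x0: "x0 \<in> topspace X" and q: "path q" "path_image q \<subseteq> S" "pathstart q = to_S x0" "pathfinish q = to_S x0"
  shows "from_S \<circ> q \<in> loops_at X x0"
proof -
  have "pathin (top_of_set S) q" using q by (auto simp: pathin_canon_iff path_image_def)
  then have "pathin X (from_S \<circ> q)" by (rule pathin_compose[OF _ continuous_from_S])
  then show ?thesis using q from_S(1)[OF x0] by (simp add: loops_at_def pathstart_def pathfinish_def)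
qed

lemma to_from_S: "path q \<Longrightarrow> path_image q \<subseteq> S \<Longrightarrow> homotopic_paths S q (to_S \<circ> (from_S \<circ> q))"
  by (rule homotopic_paths_eq) (auto simp: path_image_def from_S(2) image_subset_iff)

text \<open>Composition with the homeomorphism in either direction. It is undone by its inverse only
  at times in \<open>[0,1]\<close>, which is all that homotopies see.\<close>

lemma loop_homotopy_iff:
  assumes p: "p \<in> loops_at X x0" and q: "q \<in> loops_at X x0"
  shows "(p, q) \<in> loop_homotopy X x0 \<longleftrightarrow> homotopic_paths S (to_S \<circ> p) (to_S \<circ> q)"
proof
  assume "(p, q) \<in> loop_homotopy X x0"
  then have "homotopic_with (\<lambda>r. r 0 = x0 \<and> r 1 = x0) (top_of_set {0..1}) X p q" by (simp add: loop_homotopy_def)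
  from homotopic_with_compose_continuous_map_left[OF this continuous_to_S,
    of "\<lambda>r. pathstart r = pathstart (to_S \<circ> p) \<and> pathfinish r = pathfinish (to_S \<circ> p)"]
  show "homotopic_paths S (to_S \<circ> p) (to_S \<circ> q)"
    unfolding homotopic_paths_def using path_to_S[OF p] by (simp add: pathstart_def pathfinish_def)
next
  assume h: "homotopic_paths S (to_S \<circ> p) (to_S \<circ> q)"
  have x0: "x0 \<in> topspace X" using loops_in_X[OF p, of 0] p by (simp add: loops_at_def)
  have "homotopic_with (\<lambda>r. r 0 = x0 \<and> r 1 = x0) (top_of_set {0..1}) X (from_S \<circ> (to_S \<circ> p)) (from_S \<circ> (to_S \<circ> q))"
    by (rule homotopic_with_compose_continuous_map_left[OF h[unfolded homotopic_paths_def] continuous_from_S])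
      (use path_to_S[OF p] from_S(1)[OF x0] in \<open>simp add: pathstart_def pathfinish_def\<close>)
  then have "homotopic_with (\<lambda>r. r 0 = x0 \<and> r 1 = x0) (top_of_set {0..1}) X p q"
    by (rule homotopic_with_eq) (use loops_in_X[OF p] loops_in_X[OF q] from_S(1) in auto)
  then show "(p, q) \<in> loop_homotopy X x0" using p q by (simp add: loop_homotopy_def)
qed

lemma equiv_loop_homotopy: "equiv (loops_at X x0) (loop_homotopy X x0)"
proof (rule equivI)
  show "loop_homotopy X x0 \<subseteq> loops_at X x0 \<times> loops_at X x0" by (auto simp: loop_homotopy_def)
  show "refl_on (loops_at X x0) (loop_homotopy X x0)"
    using path_to_S by (auto intro!: refl_onI simp: loop_homotopy_iff)
  show "sym (loop_homotopy X x0)"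
    by (rule symI) (metis (no_types, lifting) homotopic_paths_sym loop_homotopy_def loop_homotopy_iff case_prodD mem_Collect_eq)
  show "trans (loop_homotopy X x0)"
  proof (rule transI)
    fix p q r assume pq: "(p, q) \<in> loop_homotopy X x0" and qr: "(q, r) \<in> loop_homotopy X x0"
    then have l: "p \<in> loops_at X x0" "q \<in> loops_at X x0" "r \<in> loops_at X x0" by (auto simp: loop_homotopy_def)
    show "(p, r) \<in> loop_homotopy X x0"
      using pq qr homotopic_paths_trans unfolding loop_homotopy_iff[OF l(1,2)] loop_homotopy_iff[OF l(2,3)] loop_homotopy_iff[OF l(1,3)] by blast
  qed
qed

definition loop_class where "loop_class x0 p = loop_homotopy X x0 `` {p}"

lemma loop_class_eq_iff:
  "p \<in> loops_at X x0 \<Longrightarrow> q \<in> loops_at X x0 \<Longrightarrow>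
    loop_class x0 p = loop_class x0 q \<longleftrightarrow> homotopic_paths S (to_S \<circ> p) (to_S \<circ> q)"
  unfolding loop_class_def
  using eq_equiv_class_iff[OF equiv_loop_homotopy] loop_homotopy_iff by metis

text \<open>Continuity of the join is obtained in \<open>S\<close> and carried back by
  \<open>from_S\<close>.\<close>

lemma join_loops_closed:
  assumes "p \<in> loops_at X x0" "q \<in> loops_at X x0" shows "join_loops p q \<in> loops_at X x0"
proof -
  have x0: "x0 \<in> topspace X" using loops_in_X[OF assms(1), of 0] assms by (simp add: loops_at_def)
  let ?j = "(to_S \<circ> p) +++ (to_S \<circ> q)"
  have j: "path ?j" "path_image ?j \<subseteq> S" "pathstart ?j = to_S x0" "pathfinish ?j = to_S x0"
    using path_to_S[OF assms(1)] path_to_S[OF assms(2)] by (auto simp: path_image_join)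
  have "from_S \<circ> ?j \<in> loops_at X x0" by (rule from_S_loop[OF x0 j])
  moreover have "(from_S \<circ> ?j) t = join_loops p q t" if "t \<in> {0..1}" for t
    using that loops_in_X[OF assms(1)] loops_in_X[OF assms(2)]
    by (auto simp: joinpaths_def join_loops_def from_S(1))
  ultimately show ?thesis unfolding loops_at_def pathin_def
    by (auto intro: continuous_map_eq) 
qed

lemma loop_class_mult:
  assumes p: "p \<in> loops_at X x0" and q: "q \<in> loops_at X x0"
  shows "loop_class x0 p \<otimes>\<^bsub>fundamental_group X x0\<^esub> loop_class x0 q = loop_class x0 (join_loops p q)"
proof -
  have eq: "loop_class x0 (join_loops p' q') = loop_class x0 (join_loops p q)"
    if "p' \<in> loop_class x0 p" "q' \<in> loop_class x0 q" for p' q'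
  proof -
    have l: "p' \<in> loops_at X x0" "q' \<in> loops_at X x0"
      using that by (auto simp: loop_class_def loop_homotopy_def)
    have "homotopic_paths S (to_S \<circ> p') (to_S \<circ> p)" "homotopic_paths S (to_S \<circ> q') (to_S \<circ> q)"
      using that l p q loop_homotopy_iff homotopic_paths_sym by (auto simp: loop_class_def)
    then have "homotopic_paths S (to_S \<circ> join_loops p' q') (to_S \<circ> join_loops p q)"
      unfolding to_S_join by (rule homotopic_paths_join) (use path_to_S l in auto)
    then show ?thesis using l p q by (simp add: loop_class_eq_iff join_loops_closed)
  qed
  have ne: "p \<in> loop_class x0 p" "q \<in> loop_class x0 q"
    unfolding loop_class_def using p q equiv_class_self[OF equiv_loop_homotopy] by auto
  have "(\<Union>p'\<in>loop_class x0 p. \<Union>q'\<in>loop_class x0 q. loop_class x0 (join_loops p' q')) =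
    (\<Union>p'\<in>loop_class x0 p. \<Union>q'\<in>loop_class x0 q. loop_class x0 (join_loops p q))"
    by (intro SUP_cong refl eq)
  also have "\<dots> = loop_class x0 (join_loops p q)" using ne by blast
  finally show ?thesis by (simp add: fundamental_group_def loop_class_def)
qed

text \<open>The end differs from \<open>k\<close> by the shift up to sign, and the sign does not
  affect divisibility; so the closed edge paths are those spelling elements of
  \<open>K\<close>.\<close>

lemma gshift_0_iff_endpt: "w \<in> words \<Longrightarrow> gshift (cls w) = 0 \<longleftrightarrow> [endpt w k = k] (mod period)"
  by (auto simp: gshift_cls endpt_def cong_iff_dvd_diff mod_eq_0_iff_dvd)

lemma fundamental_group_iso_K:
  assumes x0: "x0 \<in> topspace X"
  shows "fundamental_group X x0 \<cong> W\<lparr>carrier := K\<rparr>"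
proof -
  define y0 where "y0 = to_S x0"
  have y0: "y0 \<in> S" using x0 to_S_image by (auto simp: y0_def)
  then obtain k where k: "y0 \<in> star k" using ex_star by blast
  define c where "c = radius k y0"
  have c: "path c" "path_image c \<subseteq> S" "pathstart c = y0" "pathfinish c = vtx k"
    using radius[OF k] radius_image[OF k] by (simp_all add: c_def)
  \<comment> \<open>Conjugation by the radius \<open>c\<close> moves loops at vertex
    \<open>k\<close> to the arbitrary base point.\<close>
  define lp where "lp w = c +++ (word_path k w +++ reversepath c)" for w
  have fin: "pathfinish (word_path k w) = vtx k" if "w \<in> words" "cls w \<in> K" for w
    using that gshift_0_iff_endpt[of w k] vtx_cong[of "endpt w k" k] by (simp add: K_def)
  have lp: "path (lp w)" "path_image (lp w) \<subseteq> S" "pathstart (lp w) = y0" "pathfinish (lp w) = y0"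
    if "w \<in> words" "cls w \<in> K" for w
    using c fin[OF that] word_path_image[OF that(1), of k] by (auto simp: lp_def path_image_join)
  have lp_iff: "homotopic_paths S (lp u) (lp w) \<longleftrightarrow> cls u = cls w"
    if u: "u \<in> words" "cls u \<in> K" and w: "w \<in> words" "cls w \<in> K" for u w
  proof
    assume "cls u = cls w"
    then have "homotopic_paths S (word_path k u) (word_path k w)"
      using u w word_path_pcong by (simp add: cls_eq_iff)
    then show "homotopic_paths S (lp u) (lp w)" unfolding lp_def
      by (intro homotopic_paths_join) (use c fin[OF u] in auto)
  next
    assume h: "homotopic_paths S (lp u) (lp w)"
    \<comment> \<open>Undoing the conjugation leads back to word paths, to which the holonomy
      applies.\<close>
    have canc: "homotopic_paths S (reversepath c +++ (lp v +++ c)) (word_path k v)" if "v \<in> words" "cls v \<in> K" for v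
      unfolding lp_def by (rule homotopic_paths_conj_cancel) (use c fin[OF that] word_path_image[OF that(1)] in auto)
    have "homotopic_paths S (reversepath c +++ (lp u +++ c)) (reversepath c +++ (lp w +++ c))"
      by (intro homotopic_paths_join h) (use c lp[OF u] in auto)
    then have "homotopic_paths S (word_path k u) (word_path k w)"
      using canc[OF u] canc[OF w] homotopic_paths_sym homotopic_paths_trans by metis
    then show "cls u = cls w" by (rule homotopic_word_paths_cls[OF u(1) w(1)])
  qed
  have lp_append: "homotopic_paths S (lp (u @ w)) (lp u +++ lp w)"
    if u: "u \<in> words" "cls u \<in> K" and w: "w \<in> words" "cls w \<in> K" for u w
  proof -
    have e: "[endpt u k = k] (mod period)" using u gshift_0_iff_endpt by (simp add: K_def)
    have "homotopic_paths S (word_path k (u @ w)) (word_path k u +++ word_path k w)"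
      using word_path_append[OF u(1) w(1), of k] word_path_cong[OF e] by simp
    then have "homotopic_paths S (lp (u @ w)) (c +++ ((word_path k u +++ word_path k w) +++ reversepath c))"
      unfolding lp_def
      by (intro homotopic_paths_join) (use c fin[OF w] homotopic_paths_imp_pathfinish in \<open>fastforce simp: path_image_join\<close>)+
    also have "homotopic_paths S \<dots> ((c +++ (word_path k u +++ reversepath c)) +++ (c +++ (word_path k w +++ reversepath c)))"
      by (rule homotopic_paths_sym, rule homotopic_paths_cancel_middle)
        (use c fin[OF u] fin[OF w] word_path_image[OF u(1), of k] word_path_image[OF w(1), of k] in auto)
    finally show ?thesis by (simp only: lp_def)
  qed
  define wd where "wd g = (SOME w. w \<in> words \<and> cls w = g)" for g
  have wd: "wd g \<in> words" "cls (wd g) = g" if "g \<in> K" for g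
  proof -
    have "\<exists>w. w \<in> words \<and> cls w = g" using that by (auto simp: K_def carrier_eq)
    from someI_ex[OF this] show "wd g \<in> words" "cls (wd g) = g" by (simp_all add: wd_def)
  qed
  define \<Psi> where "\<Psi> g = loop_class x0 (from_S \<circ> lp (wd g))" for g
  have loop: "from_S \<circ> lp w \<in> loops_at X x0" if "w \<in> words" "cls w \<in> K" for w
    by (rule from_S_loop[OF x0]) (use lp[OF that] in \<open>simp_all add: y0_def\<close>)
  have toS: "homotopic_paths S (lp w) (to_S \<circ> (from_S \<circ> lp w))" if "w \<in> words" "cls w \<in> K" for w
    by (rule to_from_S) (use lp[OF that] in auto)
  have \<Psi>_eq: "\<Psi> g = loop_class x0 p \<longleftrightarrow> homotopic_paths S (lp (wd g)) (to_S \<circ> p)" if "g \<in> K" "p \<in> loops_at X x0" for g p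
  proof -
    have G: "wd g \<in> words" "cls (wd g) \<in> K" using wd that(1) by simp_all
    have "\<Psi> g = loop_class x0 p \<longleftrightarrow> homotopic_paths S (to_S \<circ> (from_S \<circ> lp (wd g))) (to_S \<circ> p)"
      unfolding \<Psi>_def by (rule loop_class_eq_iff[OF loop[OF G] that(2)])
    then show ?thesis
      using homotopic_paths_trans[OF toS[OF G]] homotopic_paths_trans[OF homotopic_paths_sym[OF toS[OF G]]] by blast
  qed
  have "\<Psi> \<in> iso (W\<lparr>carrier := K\<rparr>) (fundamental_group X x0)"
  proof (rule isoI)
    show "\<Psi> \<in> hom (W\<lparr>carrier := K\<rparr>) (fundamental_group X x0)"
    proof (rule homI)
      fix g assume "g \<in> carrier (W\<lparr>carrier := K\<rparr>)"
      then have "from_S \<circ> lp (wd g) \<in> loops_at X x0" using loop wd by simp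
      then show "\<Psi> g \<in> carrier (fundamental_group X x0)"
        by (simp add: \<Psi>_def fundamental_group_def loop_class_def quotientI)
    next
      fix g h assume "g \<in> carrier (W\<lparr>carrier := K\<rparr>)" "h \<in> carrier (W\<lparr>carrier := K\<rparr>)"
      then have gh: "g \<in> K" "h \<in> K" by simp_all
      have gh': "g \<cdot> h \<in> K" using gh subgroup.m_closed[OF subgroup_K] by blast
      have G: "wd g \<in> words" "cls (wd g) \<in> K" and H: "wd h \<in> words" "cls (wd h) \<in> K"
        using wd gh by auto
      have app: "wd g @ wd h \<in> words" "cls (wd g @ wd h) = g \<cdot> h"
        using wd gh by (simp_all add: cls_append)
      have "homotopic_paths S (lp (wd (g \<cdot> h))) (lp (wd g @ wd h))"
        using lp_iff wd[OF gh'] app gh' by simp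
      also have "homotopic_paths S \<dots> (lp (wd g) +++ lp (wd h))" by (rule lp_append[OF G H])
      also have "homotopic_paths S \<dots> ((to_S \<circ> (from_S \<circ> lp (wd g))) +++ (to_S \<circ> (from_S \<circ> lp (wd h))))"
        by (rule homotopic_paths_join[OF toS[OF G] toS[OF H]]) (use lp[OF G] lp[OF H] in simp)
      finally have "homotopic_paths S (lp (wd (g \<cdot> h))) (to_S \<circ> join_loops (from_S \<circ> lp (wd g)) (from_S \<circ> lp (wd h)))"
        by (simp only: to_S_join)
      then have "\<Psi> (g \<cdot> h) = loop_class x0 (join_loops (from_S \<circ> lp (wd g)) (from_S \<circ> lp (wd h)))"
        using \<Psi>_eq[OF gh' join_loops_closed[OF loop[OF G] loop[OF H]]] by blast
      then show "\<Psi> (g \<otimes>\<^bsub>W\<lparr>carrier := K\<rparr>\<^esub> h) = \<Psi> g \<otimes>\<^bsub>fundamental_group X x0\<^esub> \<Psi> h"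
        using loop_class_mult[OF loop[OF G] loop[OF H]] by (simp add: \<Psi>_def)
    qed
    show "bij_betw \<Psi> (carrier (W\<lparr>carrier := K\<rparr>)) (carrier (fundamental_group X x0))"
    proof (rule bij_betw_imageI)
      show "inj_on \<Psi> (carrier (W\<lparr>carrier := K\<rparr>))"
      proof (rule inj_onI)
        fix g h assume "g \<in> carrier (W\<lparr>carrier := K\<rparr>)" "h \<in> carrier (W\<lparr>carrier := K\<rparr>)" and eq: "\<Psi> g = \<Psi> h"
        then have gh: "g \<in> K" "h \<in> K" by simp_all
        have G: "wd g \<in> words" "cls (wd g) \<in> K" and H: "wd h \<in> words" "cls (wd h) \<in> K"
          using wd gh by auto
        have "homotopic_paths S (lp (wd g)) (to_S \<circ> (from_S \<circ> lp (wd h)))"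
          using \<Psi>_eq[OF gh(1) loop[OF H]] eq by (simp add: \<Psi>_def)
        then have "homotopic_paths S (lp (wd g)) (lp (wd h))"
          using homotopic_paths_trans homotopic_paths_sym[OF toS[OF H]] by blast
        then show "g = h" using lp_iff[OF G H] wd gh by simp
      qed
      show "\<Psi> ` carrier (W\<lparr>carrier := K\<rparr>) = carrier (fundamental_group X x0)"
      proof (intro equalityI subsetI)
        fix A assume "A \<in> \<Psi> ` carrier (W\<lparr>carrier := K\<rparr>)"
        then obtain g where "g \<in> K" "A = \<Psi> g" by auto
        then show "A \<in> carrier (fundamental_group X x0)"
          using loop wd by (simp add: \<Psi>_def fundamental_group_def loop_class_def quotientI)
      next
        fix A assume "A \<in> carrier (fundamental_group X x0)"
        then obtain p where p: "p \<in> loops_at X x0" "A = loop_class x0 p"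
          by (auto simp: fundamental_group_def loop_class_def elim: quotientE)
        note ps = path_to_S[OF p(1)]
        have ends: "(to_S \<circ> p) 0 = y0" "(to_S \<circ> p) 1 = y0"
          using ps by (simp_all add: pathstart_def pathfinish_def y0_def)
        \<comment> \<open>The same star is prescribed at both ends, so both radii are
          \<open>c\<close>, and the congruence places \<open>w\<close> in the kernel.\<close>
        obtain w where w: "w \<in> words" "[endpt w k = k] (mod period)"
          "homotopic_paths S (to_S \<circ> p) (lp w)"
          using path_decomposition[OF ps(1,2), of k k] k unfolding ends lp_def c_def by blast
        have wK: "cls w \<in> K" using w gshift_0_iff_endpt[of w k] by (simp add: K_def)
        have "homotopic_paths S (lp (wd (cls w))) (lp w)" using lp_iff[OF _ _ w(1) wK] wd[OF wK] wK by simp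
        then have "homotopic_paths S (lp (wd (cls w))) (to_S \<circ> p)"
          using homotopic_paths_trans homotopic_paths_sym[OF w(3)] by blast
        then have "\<Psi> (cls w) = A" using \<Psi>_eq[OF wK p(1)] p(2) by blast
        then show "A \<in> \<Psi> ` carrier (W\<lparr>carrier := K\<rparr>)" using wK by auto
      qed
    qed
  qed
  then have "W\<lparr>carrier := K\<rparr> \<cong> fundamental_group X x0" by (rule is_isoI)
  then show ?thesis
    using group.iso_sym[OF subgroup.subgroup_is_group[OF subgroup_K W.group_axioms]] by blast
qed

end

section \<open>Connectedness of the graph in terms of its edges\<close>

lemma bip_edges_linked:
  assumes "pair_graph L" and con: "Digraph_Component.connected (with_proj L)"
    and arcs: "\<And>u v. (u, v) \<in> parcs L \<Longrightarrow> (\<exists>i j. u = Xv i \<and> v = Yv j) \<or> (\<exists>i j. u = Yv j \<and> v = Xv i)"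
  shows "\<And>u v. u \<in> pverts L \<Longrightarrow> v \<in> pverts L \<Longrightarrow> (u, v) \<in> (parcs L)\<^sup>*"
    and "\<And>e e'. e \<in> bip_edges L \<Longrightarrow> e' \<in> bip_edges L \<Longrightarrow>
      (e, e') \<in> {(a, b). a \<in> bip_edges L \<and> b \<in> bip_edges L \<and> (fst a = fst b \<or> snd a = snd b)}\<^sup>*"
proof -
  interpret pair_graph L by fact
  let ?R = "{(a, b). a \<in> bip_edges L \<and> b \<in> bip_edges L \<and> (fst a = fst b \<or> snd a = snd b)}"
  have sym: "(v, u) \<in> parcs L" if "(u, v) \<in> parcs L" for u v
    using pair_sym_arcs that by (auto simp: symmetric_def elim: symE)
  show reach: "(u, v) \<in> (parcs L)\<^sup>*" if "u \<in> pverts L" "v \<in> pverts L" for u v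
  proof -
    have "strongly_connected (with_proj (mk_symmetric (with_proj L)))"
      using con by (simp add: connected_def)
    then have "(u, v) \<in> rtrancl_on (pverts L) (parcs (mk_symmetric (with_proj L)))"
      using that by (simp add: strongly_connected_def reachable_def)
    moreover have "parcs (mk_symmetric (with_proj L)) \<subseteq> parcs L" using sym by (auto simp: mk_symmetric_def)
    ultimately show ?thesis
      by (induction rule: rtrancl_on.induct) (auto intro: rtrancl_into_rtrancl)
  qed
  fix e e' assume e: "e \<in> bip_edges L" and e': "e' \<in> bip_edges L"
  have xv: "Xv (fst a) \<in> pverts L" if "a \<in> bip_edges L" for a
    using arc_fst_in_verts[of "(Xv (fst a), Yv (snd a))"] that by (auto simp: bip_edges_def)
  \<comment> \<open>Induction along a walk from an end of \<open>e\<close>; the claim covers all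
    edges at the current vertex, because the edge walked next is one of them and meets every edge at
    the following vertex.\<close>
  have "(Xv (fst e), v) \<in> (parcs L)\<^sup>* \<Longrightarrow> \<forall>a\<in>bip_edges L. v \<in> {Xv (fst a), Yv (snd a)} \<longrightarrow> (e, a) \<in> ?R\<^sup>*" for v
  proof (induction rule: rtrancl_induct)
    case base
    show ?case using e by (auto intro!: r_into_rtrancl)
  next
    case (step u v)
    then obtain b where b: "b \<in> bip_edges L" "u \<in> {Xv (fst b), Yv (snd b)}" "v \<in> {Xv (fst b), Yv (snd b)}"
      using arcs[OF step(2)] sym[OF step(2)] step(2) by (auto simp: bip_edges_def)
    then have eb: "(e, b) \<in> ?R\<^sup>*" using step(3) by blast
    show ?case
    proof (intro ballI impI)
      fix a assume "a \<in> bip_edges L" "v \<in> {Xv (fst a), Yv (snd a)}"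
      then have "(b, a) \<in> ?R" using b by auto
      with eb show "(e, a) \<in> ?R\<^sup>*" by (rule rtrancl_into_rtrancl)
    qed
  qed
  from this[OF reach[OF xv[OF e] xv[OF e']]] show "(e, e') \<in> ?R\<^sup>*" using e' by blast
qed

theorem theorem1p2:
  fixes m q1 q2 :: nat and L :: "vertex pair_pre_digraph"
  defines "X \<equiv> polygon_complex m L" and "W \<equiv> coxeter_group m L"
  assumes "m \<ge> 2" and "q1 \<ge> 2" and "q2 \<ge> 2"
    and "pair_graph L"
    and "Digraph_Component.connected (with_proj L)"
    and "pverts L = Xv ` {1..q1} \<union> Yv ` {1..q2}"
    and "\<And>u v. (u, v) \<in> parcs L \<Longrightarrow>
      u \<in> Xv ` {1..q1} \<and> v \<in> Yv ` {1..q2} \<or> u \<in> Yv ` {1..q2} \<and> v \<in> Xv ` {1..q1}"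
  shows "\<exists>K. subgroup K W \<and>
    (\<forall>x0\<in>topspace X. fundamental_group X x0 \<cong> W\<lparr>carrier := K\<rparr>) \<and>
    card (rcosets\<^bsub>W\<^esub> K) = 2 * m \<and>
    torsion_free (W\<lparr>carrier := K\<rparr>) \<and>
    (\<forall>K'. subgroup K' W \<and> torsion_free (W\<lparr>carrier := K'\<rparr>) \<longrightarrow> \<not> K \<subset> K') \<and>
    (\<forall>K'. subgroup K' W \<and> torsion_free (W\<lparr>carrier := K'\<rparr>) \<and> finite (rcosets\<^bsub>W\<^esub> K')
       \<longrightarrow> 2 * m \<le> card (rcosets\<^bsub>W\<^esub> K'))"
proof -
  interpret L: pair_graph L by fact
  have arcs: "(\<exists>i j. u = Xv i \<and> v = Yv j) \<or> (\<exists>i j. u = Yv j \<and> v = Xv i)" if "(u, v) \<in> parcs L" for u v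
    using assms(9)[OF that] by auto
  have reach: "(u, v) \<in> (parcs L)\<^sup>*" if "u \<in> pverts L" "v \<in> pverts L" for u v
    by (rule bip_edges_linked(1)[OF assms(6,7) _ that]) (rule arcs)
  have sym: "(v, u) \<in> parcs L" if "(u, v) \<in> parcs L" for u v
    using L.pair_sym_arcs that by (auto simp: symmetric_def elim: symE)
  \<comment> \<open>A walk to a different vertex has a first arc, so no vertex is isolated.\<close>
  have arc: "\<exists>v'. (u, v') \<in> parcs L" if "u \<in> pverts L" "v \<in> pverts L" "u \<noteq> v" for u v
    using reach[OF that(1,2)] that(3) by (auto elim: converse_rtranclE)
  have v11: "Xv 1 \<in> pverts L" "Yv 1 \<in> pverts L" using assms(4,5,8) by auto
  have x_edge: "\<exists>j. (i, j) \<in> bip_edges L" if i: "Xv i \<in> pverts L" for i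
    using arc[OF i v11(2)] arcs by (force simp: bip_edges_def)
  have y_edge: "\<exists>i. (i, j) \<in> bip_edges L" if j: "Yv j \<in> pverts L" for j
    using arc[OF j v11(1)] arcs sym by (force simp: bip_edges_def)
  interpret connected_bipartite_complex m L
  proof
    show "2 \<le> m" by fact
    show "Xv i \<in> pverts L \<and> Yv j \<in> pverts L" if "(i, j) \<in> bip_edges L" for i j
      using that L.arc_fst_in_verts[of "(Xv i, Yv j)"] L.arc_snd_in_verts[of "(Xv i, Yv j)"]
      by (simp add: bip_edges_def)
    have "bip_edges L = (\<lambda>(i, j). (Xv i, Yv j)) -` parcs L" by (auto simp: bip_edges_def)
    moreover have "inj (\<lambda>(i, j). (Xv i, Yv j))" by (auto simp: inj_on_def)
    ultimately show "finite (bip_edges L)" using finite_vimageI[OF L.pair_finite_arcs] by simp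
    show "bip_edges L \<noteq> {}" using x_edge[OF v11(1)] by auto
    show "(e, e') \<in> {(a, b). a \<in> bip_edges L \<and> b \<in> bip_edges L \<and> (fst a = fst b \<or> snd a = snd b)}\<^sup>*"
      if "e \<in> bip_edges L" "e' \<in> bip_edges L" for e e'
      by (rule bip_edges_linked(2)[OF assms(6,7) _ that]) (rule arcs)
  qed (use x_edge y_edge in auto)
  obtain i j where ij: "(i, j) \<in> bip_edges L" using E_ne by auto
  show ?thesis unfolding X_def W_def
    using subgroup_K fundamental_group_iso_K card_rcosets_K[OF ij] torsion_free_K
      K_maximal[OF ij] torsion_free_index[OF ij]
    by (intro exI[of _ K]) blast
qed

end
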